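(* (Working in ZF.) Let $\tau$ be a well-orderable scattered order type such that $\omega\omega^* \le \tau$ or $\omega^*\omega \le \tau$, and let $\mathbb{L} = \langle L, < \rangle$ be a linear order. If there is an ordinal $\alpha$ and an injection from the set $L$ into the power set $\mathcal P(\alpha)$, then $\mathbb{L} \not\rightarrow (\tau)^\tau$.
   Context: Order types are isomorphism classes of linear orders; $\tau$ is well-orderable if it is the type of a linear order whose underlying set is well-orderable. $\omega$ is the type of the natural numbers, $\omega^*$ its reverse, $\eta$ the type of the rationals. Multiplication is colexicographic: $\sigma\tau$ is the type of $\tau$-many consecutive copies of $\sigma$ (so $\omega\omega^*$ is $\omega^*$-many copies of $\omega$, and $\omega^*\omega$ is $\omega$-many copies of $\omega^*$). $\sigma \le \tau$ means any linear order of type $\tau$ has a suborder of type $\sigma$. A linear order is scattered if it has no densely ordered suborder with at least two elements. For a linear order $\mathbb{L}$ and order type $\tau$, $[\mathbb{L}]^\tau$ is the set of subsets of $L$ whose induced order has type $\tau$; $\mathbb{L} \rightarrow (\tau)^\tau$ means: for every $F : [\mathbb{L}]^\tau \to \{0,1\}$ there is $H \in [\mathbb{L}]^\tau$ with $F$ constant on $[H]^\tau$; $\not\rightarrow$ is its negation. *)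

theory Defs
  imports Main
begin

text \<open>
  HOL has a choice operator, so a theorem of ZF that is about the absence of choice cannot be
  stated about HOL's own sets and functions: there every set is well-orderable. Instead it is
  stated for the elements of an arbitrary model of first-order ZF, given as a type \<open>'a\<close> (the
  universe) with a membership relation \<open>E\<close>, where \<open>E x y\<close> reads ``x is an element of y''. Since
  Separation and Replacement are assumed for first-order formulas only, choice in HOL gives no
  choice inside the model; by completeness, truth in all models is provability in ZF.

  Below, every set, relation and function that the mathematics quantifies over is an element of
  the model. HOL sets and functions over \<open>'a\<close> occur only as abbreviations for first-order
  conditions on \<open>E\<close>; except in the two axiom schemas of ZF they are never quantified over.
\<close>

datatype fm = Mem nat nat | Eq nat nat | Neg fm | Conj fm fm | All fm

text \<open>De Bruijn indices: \<open>All\<close> binds variable 0 and shifts the others.\<close>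

primrec sat :: "('a \<Rightarrow> 'a \<Rightarrow> bool) \<Rightarrow> (nat \<Rightarrow> 'a) \<Rightarrow> fm \<Rightarrow> bool" where
  "sat E v (Mem i j) = E (v i) (v j)"
| "sat E v (Eq i j) = (v i = v j)"
| "sat E v (Neg p) = (\<not> sat E v p)"
| "sat E v (Conj p q) = (sat E v p \<and> sat E v q)"
| "sat E v (All p) = (\<forall>x. sat E (case_nat x v) p)"

definition elts :: "('a \<Rightarrow> 'a \<Rightarrow> bool) \<Rightarrow> 'a \<Rightarrow> 'a set" where
  "elts E A = {x. E x A}"

definition is_inductive :: "('a \<Rightarrow> 'a \<Rightarrow> bool) \<Rightarrow> 'a \<Rightarrow> bool" where
  "is_inductive E I \<longleftrightarrow>
     (\<exists>z \<in> elts E I. elts E z = {}) \<and>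
     (\<forall>x \<in> elts E I. \<exists>s \<in> elts E I. elts E s = insert x (elts E x))"

text \<open>In the two schemas the assignment \<open>v\<close> supplies the parameters.\<close>

definition ZF :: "('a \<Rightarrow> 'a \<Rightarrow> bool) \<Rightarrow> bool" where
  "ZF E \<longleftrightarrow>
     \<comment> \<open>Extensionality\<close>
     (\<forall>A B. elts E A = elts E B \<longrightarrow> A = B) \<and>
     \<comment> \<open>Foundation\<close>
     (\<forall>A. elts E A \<noteq> {} \<longrightarrow> (\<exists>x \<in> elts E A. elts E x \<inter> elts E A = {})) \<and>
     \<comment> \<open>Pairing\<close>
     (\<forall>x y. \<exists>P. elts E P = {x, y}) \<and>
     \<comment> \<open>Union\<close>
     (\<forall>A. \<exists>U. elts E U = (\<Union>x \<in> elts E A. elts E x)) \<and>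
     \<comment> \<open>Power set\<close>
     (\<forall>A. \<exists>P. elts E P = {X. elts E X \<subseteq> elts E A}) \<and>
     \<comment> \<open>Infinity\<close>
     (\<exists>I. is_inductive E I) \<and>
     \<comment> \<open>Separation\<close>
     (\<forall>p v A. \<exists>B. elts E B = {x \<in> elts E A. sat E (case_nat x v) p}) \<and>
     \<comment> \<open>Replacement\<close>
     (\<forall>p v A. (\<forall>x \<in> elts E A. \<exists>!y. sat E (case_nat x (case_nat y v)) p) \<longrightarrow>
        (\<exists>B. elts E B = {y. \<exists>x \<in> elts E A. sat E (case_nat x (case_nat y v)) p}))"

text \<open>
  The element of the model with the given extension. Below it is applied only to extensions
  that ZF proves to be sets; for those, Extensionality makes it well defined.
\<close>

definition the_set :: "('a \<Rightarrow> 'a \<Rightarrow> bool) \<Rightarrow> 'a set \<Rightarrow> 'a" where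
  "the_set E X = (THE A. elts E A = X)"

definition upair :: "('a \<Rightarrow> 'a \<Rightarrow> bool) \<Rightarrow> 'a \<Rightarrow> 'a \<Rightarrow> 'a" where
  "upair E x y = the_set E {x, y}"

definition pair :: "('a \<Rightarrow> 'a \<Rightarrow> bool) \<Rightarrow> 'a \<Rightarrow> 'a \<Rightarrow> 'a" where
  "pair E x y = upair E (upair E x x) (upair E x y)"

definition pow :: "('a \<Rightarrow> 'a \<Rightarrow> bool) \<Rightarrow> 'a \<Rightarrow> 'a" where
  "pow E A = the_set E {X. elts E X \<subseteq> elts E A}"

definition cross :: "('a \<Rightarrow> 'a \<Rightarrow> bool) \<Rightarrow> 'a \<Rightarrow> 'a \<Rightarrow> 'a" where
  "cross E A B = the_set E {pair E a b | a b. a \<in> elts E A \<and> b \<in> elts E B}"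

text \<open>Passing between a relation in the model and the relation on \<open>'a\<close> that it codes.\<close>

definition rel :: "('a \<Rightarrow> 'a \<Rightarrow> bool) \<Rightarrow> 'a \<Rightarrow> ('a \<times> 'a) set" where
  "rel E R = {(x, y). pair E x y \<in> elts E R}"

definition relset :: "('a \<Rightarrow> 'a \<Rightarrow> bool) \<Rightarrow> ('a \<times> 'a) set \<Rightarrow> 'a" where
  "relset E r = the_set E {pair E x y | x y. (x, y) \<in> r}"

definition is_fun :: "('a \<Rightarrow> 'a \<Rightarrow> bool) \<Rightarrow> 'a \<Rightarrow> 'a \<Rightarrow> 'a \<Rightarrow> bool" where
  "is_fun E f A B \<longleftrightarrow>
     elts E f \<subseteq> elts E (cross E A B) \<and> (\<forall>x \<in> elts E A. \<exists>!y. (x, y) \<in> rel E f)"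

definition app :: "('a \<Rightarrow> 'a \<Rightarrow> bool) \<Rightarrow> 'a \<Rightarrow> 'a \<Rightarrow> 'a" where
  "app E f x = (THE y. (x, y) \<in> rel E f)"

text \<open>
  Ordered sets are given by their carrier and their strict order relation, both elements of the
  model. An order type is given by any ordered set that represents it.
\<close>

type_synonym 'a ordset = "'a \<times> 'a"

definition lin_ord :: "('a \<Rightarrow> 'a \<Rightarrow> bool) \<Rightarrow> 'a ordset \<Rightarrow> bool" where
  "lin_ord E L \<longleftrightarrow>
     elts E (snd L) \<subseteq> elts E (cross E (fst L) (fst L)) \<and>
     strict_linear_order_on (elts E (fst L)) (rel E (snd L))"

definition well_ord :: "('a \<Rightarrow> 'a \<Rightarrow> bool) \<Rightarrow> 'a ordset \<Rightarrow> bool" where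
  "well_ord E L \<longleftrightarrow> lin_ord E L \<and>
     (\<forall>X. elts E X \<subseteq> elts E (fst L) \<and> elts E X \<noteq> {} \<longrightarrow>
        (\<exists>m \<in> elts E X. \<forall>x \<in> elts E X. x \<noteq> m \<longrightarrow> (m, x) \<in> rel E (snd L)))"

definition well_orderable :: "('a \<Rightarrow> 'a \<Rightarrow> bool) \<Rightarrow> 'a \<Rightarrow> bool" where
  "well_orderable E A \<longleftrightarrow> (\<exists>W. well_ord E (A, W))"

definition mem_ord :: "('a \<Rightarrow> 'a \<Rightarrow> bool) \<Rightarrow> 'a \<Rightarrow> 'a ordset" where
  "mem_ord E A = (A, relset E {(x, y). x \<in> elts E A \<and> y \<in> elts E A \<and> E x y})"

definition is_ordinal :: "('a \<Rightarrow> 'a \<Rightarrow> bool) \<Rightarrow> 'a \<Rightarrow> bool" where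
  "is_ordinal E \<alpha> \<longleftrightarrow>
     (\<forall>x \<in> elts E \<alpha>. elts E x \<subseteq> elts E \<alpha>) \<and> well_ord E (mem_ord E \<alpha>)"

definition omega :: "('a \<Rightarrow> 'a \<Rightarrow> bool) \<Rightarrow> 'a ordset" where
  "omega E = mem_ord E (the_set E {n. \<forall>I. is_inductive E I \<longrightarrow> n \<in> elts E I})"

definition reverse :: "('a \<Rightarrow> 'a \<Rightarrow> bool) \<Rightarrow> 'a ordset \<Rightarrow> 'a ordset" where
  "reverse E L = (fst L, relset E ((rel E (snd L))\<inverse>))"

text \<open>Colexicographic: the second coordinate is compared first.\<close>

definition ord_mult :: "('a \<Rightarrow> 'a \<Rightarrow> bool) \<Rightarrow> 'a ordset \<Rightarrow> 'a ordset \<Rightarrow> 'a ordset" where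
  "ord_mult E S T =
     (cross E (fst S) (fst T),
      relset E {(pair E a b, pair E a' b') | a b a' b'.
        a \<in> elts E (fst S) \<and> a' \<in> elts E (fst S) \<and>
        b \<in> elts E (fst T) \<and> b' \<in> elts E (fst T) \<and>
        ((b, b') \<in> rel E (snd T) \<or> b = b' \<and> (a, a') \<in> rel E (snd S))})"

definition suborder :: "('a \<Rightarrow> 'a \<Rightarrow> bool) \<Rightarrow> 'a ordset \<Rightarrow> 'a \<Rightarrow> 'a ordset" where
  "suborder E L X = (X, relset E (rel E (snd L) \<inter> elts E X \<times> elts E X))"

definition same_type :: "('a \<Rightarrow> 'a \<Rightarrow> bool) \<Rightarrow> 'a ordset \<Rightarrow> 'a ordset \<Rightarrow> bool" where
  "same_type E S T \<longleftrightarrow>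
     (\<exists>f. is_fun E f (fst S) (fst T) \<and>
          bij_betw (app E f) (elts E (fst S)) (elts E (fst T)) \<and>
          (\<forall>x \<in> elts E (fst S). \<forall>y \<in> elts E (fst S).
             (x, y) \<in> rel E (snd S) \<longleftrightarrow> (app E f x, app E f y) \<in> rel E (snd T)))"

definition type_le :: "('a \<Rightarrow> 'a \<Rightarrow> bool) \<Rightarrow> 'a ordset \<Rightarrow> 'a ordset \<Rightarrow> bool" where
  "type_le E S T \<longleftrightarrow>
     (\<exists>X. elts E X \<subseteq> elts E (fst T) \<and> same_type E (suborder E T X) S)"

definition dense_ord :: "('a \<Rightarrow> 'a \<Rightarrow> bool) \<Rightarrow> 'a ordset \<Rightarrow> bool" where
  "dense_ord E L \<longleftrightarrow>
     (\<forall>x \<in> elts E (fst L). \<forall>y \<in> elts E (fst L). (x, y) \<in> rel E (snd L) \<longrightarrow>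
        (\<exists>z \<in> elts E (fst L). (x, z) \<in> rel E (snd L) \<and> (z, y) \<in> rel E (snd L)))"

definition scattered :: "('a \<Rightarrow> 'a \<Rightarrow> bool) \<Rightarrow> 'a ordset \<Rightarrow> bool" where
  "scattered E L \<longleftrightarrow>
     \<not> (\<exists>X. elts E X \<subseteq> elts E (fst L) \<and>
            (\<exists>x \<in> elts E X. \<exists>y \<in> elts E X. x \<noteq> y) \<and> dense_ord E (suborder E L X))"

text \<open>The set \<open>[L]\<^sup>\<tau>\<close>.\<close>

definition typed_subsets :: "('a \<Rightarrow> 'a \<Rightarrow> bool) \<Rightarrow> 'a ordset \<Rightarrow> 'a ordset \<Rightarrow> 'a" where
  "typed_subsets E L \<tau> =
     the_set E {X. elts E X \<subseteq> elts E (fst L) \<and> same_type E (suborder E L X) \<tau>}"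

definition two :: "('a \<Rightarrow> 'a \<Rightarrow> bool) \<Rightarrow> 'a" where
  "two E = upair E (the_set E {}) (upair E (the_set E {}) (the_set E {}))"

text \<open>The partition relation \<open>L \<rightarrow> (\<tau>)\<^sup>\<tau>\<close>.\<close>

definition arrows :: "('a \<Rightarrow> 'a \<Rightarrow> bool) \<Rightarrow> 'a ordset \<Rightarrow> 'a ordset \<Rightarrow> bool" where
  "arrows E L \<tau> \<longleftrightarrow>
     (\<forall>F. is_fun E F (typed_subsets E L \<tau>) (two E) \<longrightarrow>
        (\<exists>H \<in> elts E (typed_subsets E L \<tau>). \<exists>c \<in> elts E (two E).
           \<forall>X \<in> elts E (typed_subsets E (suborder E L H) \<tau>). app E F X = c))"

end

theory Submission
  imports Defs
begin

text \<open>
  Colour a set \<open>X\<close> of type \<open>\<tau>\<close> by whether each infinite class of its finite condensation is, via the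
  injection into \<open>P(\<alpha>)\<close>, a comb growing to the right on the right of some centre and a comb growing to the
  left on the left of it. Every set of order type \<open>\<omega>\<close> has a definable infinite comb, so all classes of a
  given set of type \<open>\<tau>\<close> can be thinned at once, without changing the type, to get one colour.

  For the other colour, call \<open>x\<close> and \<open>y\<close> equivalent if the interval between them embeds neither
  \<open>\<omega>\<^sup>*\<omega>\<close> nor \<open>\<omega>\<omega>\<^sup>*\<close>. As \<open>\<tau>\<close> is scattered, some class embeds one of them, up to reversal \<open>\<omega>\<^sup>*\<omega>\<close>. A final
  segment of this class is an \<open>\<omega>\<close>-sum of pieces \<open>W + D\<close> with \<open>W\<close> a well-order and \<open>D\<close> an infinite reverse
  well-order, and it can be shifted to the right beyond any bound, since every late piece embeds in
  infinitely many others. The gap created by the shift has room for a comb growing to the right followed by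
  one growing to the left. These replace six consecutive points of an infinite class, which then has no centre.
\<close>

section \<open>Definability inside a model of ZF\<close>

text \<open>The colouring, the thinned set and the bad copy must all be elements of the model, where
  subsets of \<open>L\<close> come without any choice function. So each object is given by a
  first-order formula with parameters, and whatever has to be selected is either canonical (the
  comparison map of two well-orders, the leftmost unbounded path, an orbit) or selected by a
  well-order of the homogeneous set, which is pulled back from \<tau>. Choice and recursion of HOL
  appear only where finitely many of their values enter the model.

  Along a comb the levels at which neighbours split increase in the direction of growth, so three
  points cannot grow both ways. A class without endpoints has to be thinned separately on its two
  sides, and the best that can be reached is growth to the left followed by growth to the right;
  this is why the colour speaks of a centre. Three points growing right followed by three growing
  left have the two directions in the wrong order: any centre leaves one of the triples wholly on
  the side where it should grow the other way. This is the origin of the six points.\<close>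

primrec ren :: "(nat \<Rightarrow> nat) \<Rightarrow> fm \<Rightarrow> fm" where
  "ren f (Mem i j) = Mem (f i) (f j)"
| "ren f (Eq i j) = Eq (f i) (f j)"
| "ren f (Neg p) = Neg (ren f p)"
| "ren f (Conj p q) = Conj (ren f p) (ren f q)"
| "ren f (All p) = All (ren (case_nat 0 (\<lambda>n. Suc (f n))) p)"

lemma sat_ren: "sat E v (ren f p) = sat E (\<lambda>n. v (f n)) p"
proof (induction p arbitrary: v f)
  case (All p)
  have "(\<lambda>n. case_nat x v (case_nat 0 (\<lambda>n. Suc (f n)) n)) = case_nat x (\<lambda>n. v (f n))" for x
    by (auto split: nat.split)
  then show ?case by (simp add: All)
qed simp_all

text \<open>Even positions of the assignment carry the variables, odd positions the parameters.\<close>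

definition merge :: "(nat \<Rightarrow> 'a) \<Rightarrow> (nat \<Rightarrow> 'a) \<Rightarrow> nat \<Rightarrow> 'a" where
  "merge v c n = (if even n then v (n div 2) else c (n div 2))"

text \<open>Unlike \<open>THE\<close>, this has one fixed value whenever there is no unique witness, so that it stays
  first-order definable.\<close>

definition the1 :: "('a \<Rightarrow> bool) \<Rightarrow> 'a" where
  "the1 P = (if \<exists>!x. P x then THE x. P x else undefined)"

lemma the1_eq: "P x \<Longrightarrow> (\<And>y. P y \<Longrightarrow> y = x) \<Longrightarrow> the1 P = x"
  unfolding the1_def by (metis the_equality)

lemma the1I: "\<exists>!x. P x \<Longrightarrow> P (the1 P)"
  unfolding the1_def by (simp add: theI')

locale zf_model =
  fixes E :: "'a \<Rightarrow> 'a \<Rightarrow> bool"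
  assumes zf: "ZF E"
begin

text \<open>Separation in the model is available only for predicates of this form: first-order definable
  with parameters. A term is definable if its graph is.\<close>

definition fo :: "((nat \<Rightarrow> 'a) \<Rightarrow> bool) \<Rightarrow> bool" where
  "fo P \<longleftrightarrow> (\<exists>p c. \<forall>v. P v = sat E (merge v c) p)"

definition ft :: "((nat \<Rightarrow> 'a) \<Rightarrow> 'a) \<Rightarrow> bool" where
  "ft t \<longleftrightarrow> fo (\<lambda>v. v 0 = t (\<lambda>n. v (Suc n)))"

named_theorems fo

lemma fo_ren: assumes "fo P" shows "fo (\<lambda>v. P (\<lambda>n. v (f n)))"
proof -
  obtain p c where p: "\<And>v. P v = sat E (merge v c) p" using assms unfolding fo_def by blast
  have "P (\<lambda>n. v (f n)) = sat E (merge v c) (ren (\<lambda>n. if even n then 2 * f (n div 2) else n) p)" for v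
  proof -
    have "(\<lambda>n. merge v c (if even n then 2 * f (n div 2) else n)) = merge (\<lambda>n. v (f n)) c"
      by (auto simp: merge_def fun_eq_iff)
    then show ?thesis by (simp add: sat_ren p)
  qed
  then show ?thesis unfolding fo_def by blast
qed

lemma fo_not [fo]: assumes "fo P" shows "fo (\<lambda>v. \<not> P v)"
proof -
  obtain p c where p: "\<And>v. P v = sat E (merge v c) p" using assms unfolding fo_def by blast
  have "(\<not> P v) = sat E (merge v c) (Neg p)" for v by (simp add: p)
  then show ?thesis unfolding fo_def by blast
qed

lemma fo_conj [fo]: assumes "fo P" "fo Q" shows "fo (\<lambda>v. P v \<and> Q v)"
proof -
  obtain p c where p: "\<And>v. P v = sat E (merge v c) p" using assms(1) unfolding fo_def by blast
  obtain q d where q: "\<And>v. Q v = sat E (merge v d) q" using assms(2) unfolding fo_def by blast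
  \<comment> \<open>Each formula has its own parameters, \<open>c\<close> or \<open>d\<close>. In
    \<open>merge c d\<close> those of \<open>P\<close> occupy the even and those of \<open>Q\<close>
    the odd places, and the formulas are renamed to match.\<close>
  let ?p = "ren (\<lambda>n. if even n then n else Suc (2 * (2 * (n div 2)))) p"
  let ?q = "ren (\<lambda>n. if even n then n else Suc (2 * (Suc (2 * (n div 2))))) q"
  have "(P v \<and> Q v) = sat E (merge v (merge c d)) (Conj ?p ?q)" for v
  proof -
    have "(\<lambda>n. merge v (merge c d) (if even n then n else Suc (2 * (2 * (n div 2))))) = merge v c"
      "(\<lambda>n. merge v (merge c d) (if even n then n else Suc (2 * (Suc (2 * (n div 2)))))) = merge v d"
      by (auto simp: merge_def fun_eq_iff elim!: oddE)
    then show ?thesis by (simp add: sat_ren p q)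
  qed
  then show ?thesis unfolding fo_def by blast
qed

lemma fo_all [fo]: assumes "fo (\<lambda>v. P (\<lambda>n. v (Suc n)) (v 0))" shows "fo (\<lambda>v. \<forall>x. P v x)"
proof -
  obtain p c where p: "\<And>v. P (\<lambda>n. v (Suc n)) (v 0) = sat E (merge v c) p"
    using assms unfolding fo_def by blast
  \<comment> \<open>Under \<open>All\<close> the bound variable takes place 0 and all other places
    move up by one. Variable \<open>Suc k\<close> of the body is the outer variable
    \<open>k\<close>, found at \<open>2 * k\<close> before and at \<open>Suc (2 * k)\<close> after
    the shift.\<close>
  let ?f = "\<lambda>n. if even n then (case n div 2 of 0 \<Rightarrow> 0 | Suc k \<Rightarrow> Suc (2 * k)) else Suc n"
  have "(\<forall>x. P v x) = sat E (merge v c) (All (ren ?f p))" for v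
  proof -
    have "(\<lambda>n. case_nat x (merge v c) (?f n)) = merge (case_nat x v) c" for x
      by (auto simp: merge_def fun_eq_iff split: nat.split)
    moreover have "P v x = sat E (merge (case_nat x v) c) p" for x
      using p[of "case_nat x v"] by simp
    ultimately show ?thesis by (simp add: sat_ren)
  qed
  then show ?thesis unfolding fo_def by blast
qed

lemma fo_disj [fo]: assumes "fo P" "fo Q" shows "fo (\<lambda>v. P v \<or> Q v)"
proof -
  have "fo (\<lambda>v. \<not> (\<not> P v \<and> \<not> Q v))" by (intro fo assms)
  then show ?thesis by simp
qed

lemma fo_imp [fo]: assumes "fo P" "fo Q" shows "fo (\<lambda>v. P v \<longrightarrow> Q v)"
  unfolding imp_conv_disj by (intro fo assms)

lemma fo_iff [fo]: assumes "fo P" "fo Q" shows "fo (\<lambda>v. P v \<longleftrightarrow> Q v)"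
  unfolding iff_conv_conj_imp by (intro fo assms)

lemma fo_ex [fo]: assumes "fo (\<lambda>v. P (\<lambda>n. v (Suc n)) (v 0))" shows "fo (\<lambda>v. \<exists>x. P v x)"
proof -
  have "fo (\<lambda>v. \<not> (\<forall>x. \<not> P v x))" by (intro fo assms)
  then show ?thesis by simp
qed

lemma fo_const [fo]: "fo (\<lambda>v. b)"
proof (cases b)
  case True
  have "b = sat E (merge v v') (Neg (Conj (Eq 0 0) (Neg (Eq 0 0))))" for v v' using True by simp
  then show ?thesis unfolding fo_def by blast
next
  case False
  have "b = sat E (merge v v') (Conj (Eq 0 0) (Neg (Eq 0 0)))" for v v' using False by simp
  then show ?thesis unfolding fo_def by blast
qed

lemma ft_var [fo]: "ft (\<lambda>v. v n)"
proof -
  have "(v 0 = v (Suc n)) = sat E (merge v v') (Eq 0 (2 * Suc n))" for v v' by (simp add: merge_def)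
  then show ?thesis unfolding ft_def fo_def by blast
qed

lemma ft_const [fo]: "ft (\<lambda>v. a)"
proof -
  have "(v 0 = a) = sat E (merge v (\<lambda>_. a)) (Eq 0 1)" for v by (simp add: merge_def)
  then show ?thesis unfolding ft_def fo_def by blast
qed

lemma ft_ren: "ft t \<Longrightarrow> ft (\<lambda>v. t (\<lambda>n. v (f n)))"
  unfolding ft_def by (drule fo_ren[where f = "case_nat 0 (\<lambda>n. Suc (f n))"]) simp

lemma fo_subst:
  assumes "fo (\<lambda>v. P (\<lambda>n. v (Suc n)) (v 0))" "ft t" shows "fo (\<lambda>v. P v (t v))"
proof -
  have "fo (\<lambda>v. \<exists>x. x = t v \<and> P v x)"
    by (intro fo assms assms(2)[unfolded ft_def])
  then show ?thesis by simp
qed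

lemma fo_rel2:
  assumes "fo (\<lambda>v. R (v 0) (v 1))" "ft s" "ft t" shows "fo (\<lambda>v. R (s v) (t v))"
proof (rule fo_subst[OF _ assms(3)])
  have "fo (\<lambda>v. R (v 0) (v (Suc 0)))" using assms(1) by simp
  then show "fo (\<lambda>v. R (s (\<lambda>n. v (Suc n))) (v 0))"
    by (rule fo_subst[where P = "\<lambda>v x. R x (v 0)" and t = "\<lambda>v. s (\<lambda>n. v (Suc n))"])
       (rule ft_ren[OF assms(2)])
qed

lemma fo_rel3:
  assumes "fo (\<lambda>v. R (v 0) (v 1) (v 2))" "ft s" "ft t" "ft u" shows "fo (\<lambda>v. R (s v) (t v) (u v))"
proof (rule fo_subst[OF _ assms(4)])
  have 1: "fo (\<lambda>v. R (v 0) (v (Suc 0)) (v (Suc (Suc 0))))" using assms(1) by (simp add: numeral_2_eq_2)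
  have "fo (\<lambda>v. R (s (\<lambda>n. v (Suc (Suc n)))) (v 0) (v (Suc 0)))"
    by (rule fo_subst[where P = "\<lambda>v x. R x (v 0) (v (Suc 0))" and t = "\<lambda>v. s (\<lambda>n. v (Suc (Suc n)))"])
       (rule 1, rule ft_ren[OF assms(2)])
  then show "fo (\<lambda>v. R (s (\<lambda>n. v (Suc n))) (t (\<lambda>n. v (Suc n))) (v 0))"
    by (rule fo_subst[where P = "\<lambda>v x. R (s (\<lambda>n. v (Suc n))) x (v 0)" and t = "\<lambda>v. t (\<lambda>n. v (Suc n))"])
       (rule ft_ren[OF assms(3)])
qed

lemma fo_mem [fo]: "ft s \<Longrightarrow> ft t \<Longrightarrow> fo (\<lambda>v. E (s v) (t v))"
proof (rule fo_rel2[where R = E])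
  have "E (v 0) (v 1) = sat E (merge v v') (Mem 0 2)" for v v' by (simp add: merge_def)
  then show "fo (\<lambda>v. E (v 0) (v 1))" unfolding fo_def by blast
qed

lemma fo_eq [fo]: "ft s \<Longrightarrow> ft t \<Longrightarrow> fo (\<lambda>v. s v = t v)"
proof (rule fo_rel2[where R = "(=)"])
  have "(v 0 = v 1) = sat E (merge v v') (Eq 0 2)" for v v' by (simp add: merge_def)
  then show "fo (\<lambda>v. v 0 = v 1)" unfolding fo_def by blast
qed

lemma fo_ball [fo]:
  "fo (\<lambda>v. v 0 \<in> A (\<lambda>n. v (Suc n))) \<Longrightarrow> fo (\<lambda>v. P (\<lambda>n. v (Suc n)) (v 0)) \<Longrightarrow> fo (\<lambda>v. \<forall>x \<in> A v. P v x)"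
  unfolding Ball_def by (intro fo)

lemma fo_bex [fo]:
  "fo (\<lambda>v. v 0 \<in> A (\<lambda>n. v (Suc n))) \<Longrightarrow> fo (\<lambda>v. P (\<lambda>n. v (Suc n)) (v 0)) \<Longrightarrow> fo (\<lambda>v. \<exists>x \<in> A v. P v x)"
  unfolding Bex_def by (intro fo)

lemma fo_subset [fo]:
  assumes "fo (\<lambda>v. v 0 \<in> A (\<lambda>n. v (Suc n)))" "fo (\<lambda>v. v 0 \<in> B (\<lambda>n. v (Suc n)))"
  shows "fo (\<lambda>v. A v \<subseteq> B v)"
  unfolding subset_iff by (intro fo assms)

lemma fo_nonempty [fo]:
  assumes "fo (\<lambda>v. v 0 \<in> A (\<lambda>n. v (Suc n)))" shows "fo (\<lambda>v. A v = {})"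
proof -
  have "fo (\<lambda>v. \<not> (\<exists>x. x \<in> A v))" by (intro fo assms)
  moreover have "(\<lambda>v. \<not> (\<exists>x. x \<in> A v)) = (\<lambda>v. A v = {})" by blast
  ultimately show ?thesis by simp
qed

lemma fo_Collect [fo]: "fo (\<lambda>v. P v (s v)) \<Longrightarrow> fo (\<lambda>v. s v \<in> {x. P v x})"
  by simp

lemma fo_elts [fo]: "ft s \<Longrightarrow> ft t \<Longrightarrow> fo (\<lambda>v. s v \<in> elts E (t v))"
  unfolding elts_def by (intro fo)

lemma fo_Int [fo]: "fo (\<lambda>v. s v \<in> A v) \<Longrightarrow> fo (\<lambda>v. s v \<in> B v) \<Longrightarrow> fo (\<lambda>v. s v \<in> A v \<inter> B v)"
  unfolding Int_iff by (rule fo_conj)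

lemma fo_insert [fo]: "ft s \<Longrightarrow> ft t \<Longrightarrow> fo (\<lambda>v. s v \<in> A v) \<Longrightarrow> fo (\<lambda>v. s v \<in> insert (t v) (A v))"
  unfolding insert_iff by (rule fo_disj[OF fo_eq])

lemma fo_empty [fo]: "fo (\<lambda>v. s v \<in> {})"
  unfolding empty_iff by (rule fo_const)

lemma ft_if [fo]: assumes "fo P" "ft s" "ft t" shows "ft (\<lambda>v. if P v then s v else t v)"
proof -
  have "fo (\<lambda>v. (P (\<lambda>n. v (Suc n)) \<and> v 0 = s (\<lambda>n. v (Suc n))) \<or>
                 (\<not> P (\<lambda>n. v (Suc n)) \<and> v 0 = t (\<lambda>n. v (Suc n))))"
    by (intro fo fo_ren[OF assms(1), of Suc] ft_ren[OF assms(2), of Suc] ft_ren[OF assms(3), of Suc])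
  moreover have "(\<lambda>v. (P (\<lambda>n. v (Suc n)) \<and> v 0 = s (\<lambda>n. v (Suc n))) \<or>
                 (\<not> P (\<lambda>n. v (Suc n)) \<and> v 0 = t (\<lambda>n. v (Suc n)))) =
    (\<lambda>v. v 0 = (if P (\<lambda>n. v (Suc n)) then s (\<lambda>n. v (Suc n)) else t (\<lambda>n. v (Suc n))))"
    by (rule ext) (simp split: if_split)
  ultimately show ?thesis unfolding ft_def by (simp only:)
qed

lemma ft_the1 [fo]: assumes "fo (\<lambda>v. P (\<lambda>n. v (Suc n)) (v 0))" shows "ft (\<lambda>v. the1 (P v))"
proof -
  let ?P = "\<lambda>v. P (\<lambda>n. v (Suc n))"
  let ?Q = "\<lambda>v x. ?P v x \<and> (\<forall>y. ?P v y \<longrightarrow> y = x)"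
  have 1: "fo (\<lambda>v. P (\<lambda>n. v (Suc (Suc n))) (v 0))"
    using fo_ren[OF assms, of "case_nat 0 (\<lambda>n. Suc (Suc n))"] by simp
  have 2: "fo (\<lambda>v. P (\<lambda>n. v (Suc (Suc (Suc n)))) (v 0))"
    using fo_ren[OF assms, of "case_nat 0 (\<lambda>n. Suc (Suc (Suc n)))"] by simp
  have "fo (\<lambda>v. (?Q v (v 0)) \<or> (\<not> (\<exists>x. ?Q v x) \<and> v 0 = undefined))"
    by (intro fo assms 1 2)
  moreover have "?Q v x \<or> (\<not> (\<exists>x. ?Q v x) \<and> x = undefined) \<longleftrightarrow> x = the1 (?P v)" for v x
  proof (cases "\<exists>!x. ?P v x")
    case True
    then obtain z where z: "?P v z" "\<And>y. ?P v y \<Longrightarrow> y = z" by blast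
    then have "the1 (?P v) = z" by (rule the1_eq)
    then show ?thesis using z by blast
  next
    case False
    then show ?thesis unfolding the1_def by auto
  qed
  ultimately show ?thesis unfolding ft_def by (simp only:)
qed

section \<open>Extensions of elements of the model, and Separation for definable sets\<close>

definition internal :: "'a set \<Rightarrow> bool" where
  "internal A \<longleftrightarrow> (\<exists>a. elts E a = A)"

lemma internal_elts [simp, intro]: "internal (elts E a)"
  unfolding internal_def by blast

lemma zf_axioms:
  shows zf_ext: "\<forall>A B. elts E A = elts E B \<longrightarrow> A = B"
    and zf_pair: "\<forall>x y. \<exists>P. elts E P = {x, y}"
    and zf_union: "\<forall>A. \<exists>U. elts E U = (\<Union>x \<in> elts E A. elts E x)"
    and zf_power: "\<forall>A. \<exists>P. elts E P = {X. elts E X \<subseteq> elts E A}"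
    and zf_infinity: "\<exists>I. is_inductive E I"
    and zf_sep: "\<forall>p v A. \<exists>B. elts E B = {x \<in> elts E A. sat E (case_nat x v) p}"
  by (insert zf, unfold ZF_def) (elim conjE, assumption)+

lemma ext: "elts E a = elts E b \<Longrightarrow> a = b"
  using zf_ext by simp

lemma elts_the_set: assumes "internal A" shows "elts E (the_set E A) = A"
proof -
  obtain a where a: "elts E a = A" using assms unfolding internal_def by blast
  show ?thesis unfolding the_set_def by (rule theI[of _ a]) (use a ext in auto)
qed

lemma internal_sep:
  assumes "internal A" "N \<subseteq> A" "fo (\<lambda>v. v 0 \<in> N)" shows "internal N"
proof -
  obtain a where a: "elts E a = A" using assms(1) unfolding internal_def by blast
  obtain p c where p: "\<And>v. (v 0 \<in> N) = sat E (merge v c) p" using assms(3) unfolding fo_def by blast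
  \<comment> \<open>The condition depends on variable 0 only, so all even positions may be sent to
    0. The parameters at odd positions become the variables 1, 2, ..., which the axiom schema reads
    from \<open>c\<close>.\<close>
  let ?p = "ren (\<lambda>n. if even n then 0 else Suc (n div 2)) p"
  obtain b where b: "elts E b = {x \<in> elts E a. sat E (case_nat x c) ?p}"
    using zf_sep by blast
  have "sat E (case_nat x c) ?p \<longleftrightarrow> x \<in> N" for x
  proof -
    have "(\<lambda>n. case_nat x c (if even n then 0 else Suc (n div 2))) = merge (\<lambda>_. x) c"
      by (auto simp: merge_def fun_eq_iff)
    then show ?thesis using p[of "\<lambda>_. x"] by (simp add: sat_ren)
  qed
  then show ?thesis using a b assms(2) unfolding internal_def by blast
qed

lemma fo_in_internal: "internal A \<Longrightarrow> ft s \<Longrightarrow> fo (\<lambda>v. s v \<in> A)"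
  using elts_the_set[of A] fo_elts[OF _ ft_const, of s "the_set E A"] by simp

lemma internal_filter: "internal A \<Longrightarrow> fo (\<lambda>v. P (v 0)) \<Longrightarrow> internal {x \<in> A. P x}"
  by (rule internal_sep[of A], assumption, blast, intro fo fo_in_internal)

lemma internal_doubleton: "internal {x, y}"
  using zf_pair unfolding internal_def by simp

lemma internal_Un: assumes "internal A" "internal B" shows "internal (A \<union> B)"
proof -
  obtain a b where ab: "elts E a = A" "elts E b = B" using assms unfolding internal_def by blast
  obtain p where p: "elts E p = {a, b}" using internal_doubleton unfolding internal_def by blast
  obtain u where "elts E u = (\<Union>x \<in> elts E p. elts E x)"
    using zf_union by blast
  then show ?thesis using ab p unfolding internal_def by auto
qed

lemma internal_empty [simp, intro]: "internal {}"
  by (rule internal_sep[OF internal_elts], simp, intro fo)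

lemma internal_Pow: "internal {X. elts E X \<subseteq> elts E a}"
  using zf_power unfolding internal_def by simp

lemma elts_pow: "elts E (pow E a) = {X. elts E X \<subseteq> elts E a}"
  unfolding pow_def by (rule elts_the_set[OF internal_Pow])

lemma elts_upair: "elts E (upair E x y) = {x, y}"
  unfolding upair_def by (rule elts_the_set[OF internal_doubleton])

lemma upair_eq: "upair E x y = upair E x' y' \<longleftrightarrow> {x, y} = {x', y'}"
  using ext elts_upair by metis

lemma pair_eq [simp]: "pair E x y = pair E x' y' \<longleftrightarrow> x = x' \<and> y = y'"
  unfolding pair_def upair_eq doubleton_eq_iff by auto

lemma ft_upair [fo]: assumes "ft s" "ft t" shows "ft (\<lambda>v. upair E (s v) (t v))"
proof -
  have "z = upair E x y \<longleftrightarrow> (\<forall>u. E u z \<longleftrightarrow> u = x \<or> u = y)" for x y z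
    using ext[of z "upair E x y"] elts_upair[of x y] unfolding elts_def set_eq_iff by auto
  moreover have "fo (\<lambda>v. \<forall>u. E u (v 0) \<longleftrightarrow> u = s (\<lambda>n. v (Suc n)) \<or> u = t (\<lambda>n. v (Suc n)))"
    by (intro fo ft_ren[OF assms(1), of "\<lambda>n. Suc (Suc n)"] ft_ren[OF assms(2), of "\<lambda>n. Suc (Suc n)"])
  ultimately show ?thesis unfolding ft_def by simp
qed

lemma ft_pair [fo]: "ft s \<Longrightarrow> ft t \<Longrightarrow> ft (\<lambda>v. pair E (s v) (t v))"
  unfolding pair_def by (intro fo)

lemma internal_cross: "internal {pair E x y | x y. x \<in> elts E a \<and> y \<in> elts E b}"
proof -
  obtain u where u: "elts E u = elts E a \<union> elts E b"
    using internal_Un internal_elts unfolding internal_def by metis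
  show ?thesis
  proof (rule internal_sep[OF internal_elts[of "pow E (pow E u)"]])
    show "{pair E x y | x y. x \<in> elts E a \<and> y \<in> elts E b} \<subseteq> elts E (pow E (pow E u))"
      by (auto simp: elts_pow pair_def elts_upair u)
  qed (intro fo)
qed

lemma elts_cross: "elts E (cross E a b) = {pair E x y | x y. x \<in> elts E a \<and> y \<in> elts E b}"
  unfolding cross_def by (rule elts_the_set[OF internal_cross])

lemma pair_in_cross [simp]: "pair E x y \<in> elts E (cross E a b) \<longleftrightarrow> x \<in> elts E a \<and> y \<in> elts E b"
  by (auto simp: elts_cross)

lemma fo_rel [fo]: "ft s \<Longrightarrow> ft t \<Longrightarrow> ft u \<Longrightarrow> fo (\<lambda>v. (s v, t v) \<in> rel E (u v))"
  unfolding rel_def by (simp, intro fo)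

lemma fo_converse [fo]: "fo (\<lambda>v. (t v, s v) \<in> R v) \<Longrightarrow> fo (\<lambda>v. (s v, t v) \<in> (R v)\<inverse>)"
  by simp

lemma fo_Collect2 [fo]: "fo (\<lambda>v. P v (s v) (t v)) \<Longrightarrow> fo (\<lambda>v. (s v, t v) \<in> {(x, y). P v x y})"
  by simp

text \<open>The class relations of the model: definable with parameters, but possibly without a
  code. By \<open>rel_relset\<close> a code exists as soon as the relation is bounded by two
  sets.\<close>

definition drel :: "('a \<times> 'a) set \<Rightarrow> bool" where
  "drel r \<longleftrightarrow> fo (\<lambda>v. (v 0, v 1) \<in> r)"

lemma fo_drel: "drel r \<Longrightarrow> ft s \<Longrightarrow> ft t \<Longrightarrow> fo (\<lambda>v. (s v, t v) \<in> r)"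
  unfolding drel_def by (rule fo_rel2[where R = "\<lambda>x y. (x, y) \<in> r"])

lemma drel_rel [simp, intro]: "drel (rel E a)"
  unfolding drel_def by (intro fo)

lemma drel_converse [simp]: "drel (r\<inverse>) \<longleftrightarrow> drel r"
  unfolding drel_def using fo_ren[of "\<lambda>v. (v 0, v 1) \<in> r" "\<lambda>n. 1 - n"]
    fo_ren[of "\<lambda>v. (v 1, v 0) \<in> r" "\<lambda>n. 1 - n"] by auto

lemma elts_relset:
  assumes "drel R" "R \<subseteq> elts E a \<times> elts E b"
  shows "elts E (relset E R) = {pair E x y | x y. (x, y) \<in> R}"
  unfolding relset_def
proof (rule elts_the_set, rule internal_sep[OF internal_cross])
  show "{pair E x y | x y. (x, y) \<in> R} \<subseteq> {pair E x y | x y. x \<in> elts E a \<and> y \<in> elts E b}"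
    using assms(2) by auto
qed (intro fo fo_drel[OF assms(1)])

lemma rel_relset: "drel R \<Longrightarrow> R \<subseteq> elts E a \<times> elts E b \<Longrightarrow> rel E (relset E R) = R"
  using elts_relset[of R a b] unfolding rel_def by auto

end

section \<open>Internal orders, similarities and comparison of well-orders\<close>

context zf_model begin

lemma fo_ren2: "fo (\<lambda>v. P (\<lambda>n. v (Suc n)) (v 0)) \<Longrightarrow> fo (\<lambda>v. P (\<lambda>n. v (Suc (f n))) (v 0))"
  using fo_ren[of "\<lambda>v. P (\<lambda>n. v (Suc n)) (v 0)" "case_nat 0 (\<lambda>n. Suc (f n))"] by simp

lemma code_rel:
  assumes "drel R" "R \<subseteq> A \<times> B" "internal A" "internal B" shows "\<exists>g. rel E g = R"
proof -
  obtain a b where "elts E a = A" "elts E b = B" using assms(3,4) unfolding internal_def by blast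
  then have "rel E (relset E R) = R" using rel_relset[OF assms(1), of a b] assms(2) by simp
  then show ?thesis by blast
qed

text \<open>Only subsets that are elements of the model are tested. This keeps the notion
  first-order, but the order may be ill-founded when seen from outside, so all inductions run
  through least elements of definable sets.\<close>

definition wo :: "('a \<times> 'a) set \<Rightarrow> 'a set \<Rightarrow> bool" where
  "wo r A \<longleftrightarrow> (\<forall>X. elts E X \<subseteq> A \<and> elts E X \<noteq> {} \<longrightarrow>
     (\<exists>m \<in> elts E X. \<forall>x \<in> elts E X. x \<noteq> m \<longrightarrow> (m, x) \<in> r))"

lemma nonemptyI: "x \<in> A \<Longrightarrow> A \<noteq> {}"
  by blast

lemma wo_min:
  "wo r A \<Longrightarrow> internal N \<Longrightarrow> N \<subseteq> A \<Longrightarrow> N \<noteq> {} \<Longrightarrow> \<exists>m \<in> N. \<forall>x \<in> N. x \<noteq> m \<longrightarrow> (m, x) \<in> r"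
  unfolding wo_def internal_def by blast

lemma woI:
  "(\<And>N. internal N \<Longrightarrow> N \<subseteq> A \<Longrightarrow> N \<noteq> {} \<Longrightarrow> \<exists>m \<in> N. \<forall>x \<in> N. x \<noteq> m \<longrightarrow> (m, x) \<in> r) \<Longrightarrow> wo r A"
  unfolding wo_def by blast

lemma wo_subset: "wo r A \<Longrightarrow> B \<subseteq> A \<Longrightarrow> wo r B"
  unfolding wo_def by blast

lemma fo_wo [fo]:
  assumes "drel r" "fo (\<lambda>v. v 0 \<in> A (\<lambda>n. v (Suc n)))" shows "fo (\<lambda>v. wo r (A v))"
  unfolding wo_def by (intro fo assms(1) fo_drel fo_ren2[OF assms(2)])

text \<open>Transitivity and irreflexivity hold for all of \<open>r\<close>, and only totality is
  confined to \<open>A\<close>. Hence a subset keeps the same relation, and restrictions of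
  \<open>r\<close> never have to be formed.\<close>

definition iord :: "'a set \<Rightarrow> ('a \<times> 'a) set \<Rightarrow> bool" where
  "iord A r \<longleftrightarrow> internal A \<and> drel r \<and> strict_linear_order_on A r"

lemma iordD:
  assumes "iord A r"
  shows "internal A" "drel r" "(x, x) \<notin> r" "(x, y) \<in> r \<Longrightarrow> (y, z) \<in> r \<Longrightarrow> (x, z) \<in> r"
    "(x, y) \<in> r \<Longrightarrow> (y, x) \<notin> r"
    "x \<in> A \<Longrightarrow> y \<in> A \<Longrightarrow> x \<noteq> y \<Longrightarrow> (x, y) \<notin> r \<Longrightarrow> (y, x) \<in> r"
  using assms unfolding iord_def strict_linear_order_on_def irrefl_def total_on_def
  by (auto dest: transD)

lemma iord_subset: "iord A r \<Longrightarrow> B \<subseteq> A \<Longrightarrow> internal B \<Longrightarrow> iord B r"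
  unfolding iord_def strict_linear_order_on_def total_on_def by blast

lemma iord_converse: "iord A r \<Longrightarrow> iord A (r\<inverse>)"
  unfolding iord_def strict_linear_order_on_def by simp

lemma wo_least:
  assumes "iord A r" "wo r A" "N \<subseteq> A" "fo (\<lambda>v. v 0 \<in> N)" "N \<noteq> {}"
  shows "\<exists>m \<in> N. (\<forall>x \<in> N. x \<noteq> m \<longrightarrow> (m, x) \<in> r) \<and> (\<forall>x. (x, m) \<in> r \<longrightarrow> x \<notin> N)"
proof -
  have "internal N" using internal_sep iordD(1) assms by blast
  then obtain m where "m \<in> N" "\<forall>x \<in> N. x \<noteq> m \<longrightarrow> (m, x) \<in> r" using wo_min[OF assms(2)] assms(3,5) by blast
  then show ?thesis using iordD[OF assms(1)] by metis
qed

lemma wo_least_filter: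
  assumes "iord A r" "wo r A" "fo (\<lambda>v. P (v 0))" "x \<in> A" "P x"
  shows "\<exists>m \<in> A. P m \<and> (\<forall>y \<in> A. P y \<longrightarrow> y \<noteq> m \<longrightarrow> (m, y) \<in> r) \<and> (\<forall>y \<in> A. (y, m) \<in> r \<longrightarrow> \<not> P y)"
proof -
  have "fo (\<lambda>v. v 0 \<in> {z \<in> A. P z})"
    by (intro fo fo_in_internal[OF iordD(1)[OF assms(1)]] assms(3))
  then have "\<exists>m \<in> {z \<in> A. P z}. (\<forall>y \<in> {z \<in> A. P z}. y \<noteq> m \<longrightarrow> (m, y) \<in> r) \<and>
      (\<forall>y. (y, m) \<in> r \<longrightarrow> y \<notin> {z \<in> A. P z})"
    by (rule wo_least[OF assms(1,2) Collect_restrict]) (use assms(4,5) in blast)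
  then show ?thesis by blast
qed

lemma wo_Un:
  assumes "iord T r" "A \<union> B \<subseteq> T" "fo (\<lambda>v. v 0 \<in> A)" "fo (\<lambda>v. v 0 \<in> B)" "wo r A" "wo r B"
  shows "wo r (A \<union> B)"
proof (rule woI)
  fix N assume N: "internal N" "N \<subseteq> A \<union> B" "N \<noteq> {}"
  have iA: "internal (N \<inter> A)" and iB: "internal (N \<inter> B)"
    by (rule internal_sep[OF N(1)], blast, intro fo assms fo_in_internal[OF N(1)])+
  consider "N \<inter> A = {}" | "N \<inter> B = {}" | "N \<inter> A \<noteq> {}" "N \<inter> B \<noteq> {}" by blast
  then show "\<exists>m \<in> N. \<forall>x \<in> N. x \<noteq> m \<longrightarrow> (m, x) \<in> r"
  proof cases
    case 1
    then have "N \<subseteq> B" using N(2) by blast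
    then show ?thesis using wo_min[OF assms(6) N(1) _ N(3)] by blast
  next
    case 2
    then have "N \<subseteq> A" using N(2) by blast
    then show ?thesis using wo_min[OF assms(5) N(1) _ N(3)] by blast
  next
    case 3
    obtain a where a: "a \<in> N \<inter> A" "\<forall>x \<in> N \<inter> A. x \<noteq> a \<longrightarrow> (a, x) \<in> r"
      using wo_min[OF assms(5) iA _ 3(1)] by blast
    obtain b where b: "b \<in> N \<inter> B" "\<forall>x \<in> N \<inter> B. x \<noteq> b \<longrightarrow> (b, x) \<in> r"
      using wo_min[OF assms(6) iB _ 3(2)] by blast
    have ab: "a \<in> T" "b \<in> T" using a(1) b(1) N(2) assms(2) by auto
    show ?thesis
    proof (cases "(b, a) \<in> r")
      case True
      have "(b, x) \<in> r" if "x \<in> N" "x \<noteq> b" for x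
      proof (cases "x \<in> B")
        case False
        then have "x = a \<or> (a, x) \<in> r" using that a(2) N(2) by auto
        then show ?thesis using True iordD(4)[OF assms(1)] by metis
      qed (use that b(2) in blast)
      then show ?thesis using b(1) by blast
    next
      case False
      have "a = b \<or> (a, b) \<in> r" using iordD(6)[OF assms(1) ab(2,1)] False by blast
      have "(a, x) \<in> r" if "x \<in> N" "x \<noteq> a" for x
      proof (cases "x \<in> A")
        case False
        then have "x = b \<or> (b, x) \<in> r" using that b(2) N(2) by auto
        then show ?thesis using \<open>a = b \<or> (a, b) \<in> r\<close> that(2) iordD(4)[OF assms(1)] by metis
      qed (use that a(2) in blast)
      then show ?thesis using a(1) by blast
    qed
  qed
qed

text \<open>Only the part of \<open>G\<close> inside \<open>A \<times> B\<close> counts. That it is functional and injective there follows from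
  linearity.\<close>

definition sim :: "('a \<times> 'a) set \<Rightarrow> 'a set \<Rightarrow> ('a \<times> 'a) set \<Rightarrow> 'a set \<Rightarrow> ('a \<times> 'a) set \<Rightarrow> bool" where
  "sim G A r B s \<longleftrightarrow> (\<forall>x \<in> A. \<exists>y \<in> B. (x, y) \<in> G) \<and> (\<forall>y \<in> B. \<exists>x \<in> A. (x, y) \<in> G) \<and>
     (\<forall>x \<in> A. \<forall>x' \<in> A. \<forall>y \<in> B. \<forall>y' \<in> B. (x, y) \<in> G \<longrightarrow> (x', y') \<in> G \<longrightarrow> ((x, x') \<in> r \<longleftrightarrow> (y, y') \<in> s))"

lemma simD:
  assumes "sim G A r B s"
  shows "x \<in> A \<Longrightarrow> \<exists>y \<in> B. (x, y) \<in> G" "y \<in> B \<Longrightarrow> \<exists>x \<in> A. (x, y) \<in> G"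
    "x \<in> A \<Longrightarrow> x' \<in> A \<Longrightarrow> y \<in> B \<Longrightarrow> y' \<in> B \<Longrightarrow> (x, y) \<in> G \<Longrightarrow> (x', y') \<in> G \<Longrightarrow> (x, x') \<in> r \<longleftrightarrow> (y, y') \<in> s"
  using assms unfolding sim_def by blast+

lemma simI:
  assumes "\<And>x. x \<in> A \<Longrightarrow> \<exists>y \<in> B. (x, y) \<in> G" "\<And>y. y \<in> B \<Longrightarrow> \<exists>x \<in> A. (x, y) \<in> G"
    "\<And>x x' y y'. x \<in> A \<Longrightarrow> x' \<in> A \<Longrightarrow> y \<in> B \<Longrightarrow> y' \<in> B \<Longrightarrow> (x, y) \<in> G \<Longrightarrow> (x', y') \<in> G \<Longrightarrow> (x, x') \<in> r \<longleftrightarrow> (y, y') \<in> s"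
  shows "sim G A r B s"
  using assms unfolding sim_def by blast

lemma sim_inj:
  assumes "sim G A r B s" "iord A r" "iord B s"
    "x \<in> A" "x' \<in> A" "y \<in> B" "y' \<in> B" "(x, y) \<in> G" "(x', y') \<in> G"
  shows "x = x' \<longleftrightarrow> y = y'"
  using simD(3)[OF assms(1,4,5,6,7,8,9)] simD(3)[OF assms(1,5,4,7,6,9,8)]
    iordD(3,6)[OF assms(2)] iordD(3,6)[OF assms(3)] assms(4-7) by metis

lemma sim_converse: "sim G A r B s \<Longrightarrow> sim (G\<inverse>) B s A r"
  unfolding sim_def by blast

lemma sim_reverse: "sim G A r B s \<Longrightarrow> sim G A (r\<inverse>) B (s\<inverse>)"
  unfolding sim_def by blast

lemma sim_compose:
  assumes "sim G A r B s" "sim H B s C t"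
  shows "sim {(x, z). \<exists>y \<in> B. (x, y) \<in> G \<and> (y, z) \<in> H} A r C t"
  using assms unfolding sim_def by (auto; metis)

lemma sim_restrict:
  assumes "sim G A r B s" "x \<in> A" "y \<in> B" "(x, y) \<in> G"
  shows "sim G {z \<in> A. (z, x) \<in> r} r {z \<in> B. (z, y) \<in> s} s"
  using assms unfolding sim_def by blast

lemma fo_sim [fo]:
  assumes "drel r" "drel s" "fo (\<lambda>v. v 0 \<in> A (\<lambda>n. v (Suc n)))" "fo (\<lambda>v. v 0 \<in> B (\<lambda>n. v (Suc n)))"
    "fo (\<lambda>v. (v (Suc 0), v 0) \<in> G (\<lambda>n. v (Suc (Suc n))))"
  shows "fo (\<lambda>v. sim (G v) (A v) r (B v) s)"
proof -
  have 1: "fo (\<lambda>v. (v (Suc k), v l) \<in> G (\<lambda>n. v (Suc (f n))))" for k l f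
    using fo_ren[OF assms(5), of "case_nat l (case_nat (Suc k) (\<lambda>n. Suc (f n)))"] by simp
  have 2: "fo (\<lambda>v. (v 0, v (Suc k)) \<in> G (\<lambda>n. v (Suc (f n))))" for k f
    using fo_ren[OF assms(5), of "case_nat (Suc k) (case_nat 0 (\<lambda>n. Suc (f n)))"] by simp
  show ?thesis
    unfolding sim_def
    by (intro fo assms(1,2) fo_drel fo_ren2[OF assms(3)] fo_ren2[OF assms(4)]
        assms(3,4) 1 2)
qed

text \<open>The point \<open>x'\<close> is mapped below itself. Take the least point that is mapped
  below itself: by monotonicity its image is mapped below itself as well, and it is smaller.\<close>

lemma no_shrink:
  assumes "iord A r" "wo r A" "x' \<in> A" "drel G" "sim G A r {z \<in> A. (z, x') \<in> r} r"
  shows False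
proof -
  let ?B = "{z \<in> A. (z, x') \<in> r}"
  define N where "N = {z \<in> A. \<exists>y \<in> ?B. (z, y) \<in> G \<and> (y, z) \<in> r}"
  note fi = fo fo_in_internal[OF iordD(1)[OF assms(1)]] fo_drel[OF iordD(2)[OF assms(1)]] fo_drel[OF assms(4)]
  have "x' \<in> N" using simD(1)[OF assms(5,3)] assms(3) unfolding N_def by blast
  moreover have "fo (\<lambda>v. v 0 \<in> N)" unfolding N_def by (intro fi)
  moreover have "N \<subseteq> A" unfolding N_def by blast
  ultimately obtain m where m: "m \<in> N" "\<forall>x. (x, m) \<in> r \<longrightarrow> x \<notin> N"
    using wo_least[OF assms(1,2), of N] by blast
  obtain y where y: "y \<in> ?B" "(m, y) \<in> G" "(y, m) \<in> r" using m(1) unfolding N_def by blast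
  obtain y' where y': "y' \<in> ?B" "(y, y') \<in> G" using simD(1)[OF assms(5), of y] y(1) by blast
  have "(y', y) \<in> r" using simD(3)[OF assms(5) _ _ y'(1) y(1) y'(2) y(2)] y m(1) unfolding N_def by blast
  then have "y \<in> N" using y y' unfolding N_def by blast
  then show False using m(2) y(3) by blast
qed

text \<open>The union of all isomorphisms between initial segments. Being definable from the two well-orders,
  it supplies isomorphisms for many pairs at once without choice.\<close>

definition cmp :: "'a set \<Rightarrow> ('a \<times> 'a) set \<Rightarrow> 'a set \<Rightarrow> ('a \<times> 'a) set \<Rightarrow> ('a \<times> 'a) set" where
  "cmp A r B s = {(x, y). x \<in> A \<and> y \<in> B \<and>
     (\<exists>g. sim (rel E g) {z \<in> A. (z, x) \<in> r} r {z \<in> B. (z, y) \<in> s} s)}"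

lemma fo_cmp [fo]:
  assumes "drel r" "drel s" "ft t" "ft u" "fo (\<lambda>v. v 0 \<in> A (\<lambda>n. v (Suc n)))" "fo (\<lambda>v. v 0 \<in> B (\<lambda>n. v (Suc n)))"
  shows "fo (\<lambda>v. (t v, u v) \<in> cmp (A v) r (B v) s)"
proof -
  have *: "fo (\<lambda>v. t v \<in> A v)" "fo (\<lambda>v. u v \<in> B v)"
    by (rule fo_subst[OF assms(5,3)], rule fo_subst[OF assms(6,4)])
  show ?thesis
    unfolding cmp_def
    by (intro fo assms(1,2) fo_drel * fo_ren2[OF assms(5)] fo_ren2[OF assms(6)]
      ft_ren[OF assms(3), of "\<lambda>n. Suc (Suc n)"] ft_ren[OF assms(4), of "\<lambda>n. Suc (Suc n)"])
qed

lemma drel_cmp: "internal A \<Longrightarrow> internal B \<Longrightarrow> drel r \<Longrightarrow> drel s \<Longrightarrow> drel (cmp A r B s)"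
  by (subst drel_def) (intro fo fo_in_internal)

text \<open>Because of this, the quantifier over codes \<open>g\<close> in \<open>cmp\<close> misses
  no definable similarity between sets.\<close>

lemma sim_code:
  assumes "sim G A r B s" "drel G" "internal A" "internal B" shows "\<exists>g. sim (rel E g) A r B s"
proof -
  have "drel (G \<inter> A \<times> B)"
    unfolding drel_def Int_iff mem_Times_iff fst_conv snd_conv
    by (intro fo fo_drel[OF assms(2)] fo_in_internal assms(3,4))
  then obtain g where "rel E g = G \<inter> A \<times> B" using code_rel[of "G \<inter> A \<times> B" A B] assms(3,4) by blast
  then have "sim (rel E g) A r B s" using assms(1) unfolding sim_def by auto
  then show ?thesis by blast
qed

lemma sim_code_converse: "sim (rel E g) A r B s \<Longrightarrow> internal A \<Longrightarrow> internal B \<Longrightarrow> \<exists>h. sim (rel E h) B s A r"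
  using sim_code[OF sim_converse] by simp

lemma internal_below: assumes "iord A r" shows "internal {z \<in> A. (z, x) \<in> r}"
  by (rule internal_filter[OF iordD(1)[OF assms]], intro fo fo_drel[OF iordD(2)[OF assms]])

lemma iord_below: assumes "iord A r" shows "iord {z \<in> A. (z, x) \<in> r} r"
  by (rule iord_subset[OF assms _ internal_below[OF assms]]) simp

lemma cmp_converse: assumes "iord A r" "iord B s" shows "cmp B s A r = (cmp A r B s)\<inverse>"
proof -
  note i = internal_below[OF assms(1)] internal_below[OF assms(2)]
  show ?thesis unfolding cmp_def using sim_code_converse[OF _ i] sim_code_converse[OF _ i(2,1)] by auto
qed

lemma sim_compose_code:
  assumes "sim (rel E g) A r B s" "sim (rel E h) B s C t" "internal A" "internal B" "internal C"
  shows "\<exists>k. sim (rel E k) A r C t"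
  by (rule sim_code[OF sim_compose[OF assms(1,2)] _ assms(3,5)], unfold drel_def, intro fo fo_in_internal[OF assms(4)])

lemma below_below:
  "iord A r \<Longrightarrow> (x', x) \<in> r \<Longrightarrow> {z \<in> {z \<in> A. (z, x) \<in> r}. (z, x') \<in> r} = {z \<in> A. (z, x') \<in> r}"
  using iordD(4) by blast

lemma cmpD:
  assumes "(x, y) \<in> cmp A r B s"
  shows "x \<in> A" "y \<in> B" "\<exists>g. sim (rel E g) {z \<in> A. (z, x) \<in> r} r {z \<in> B. (z, y) \<in> s} s"
  using assms unfolding cmp_def by auto

text \<open>Composing the two similarities would carry the segment below \<open>x\<close> onto its
  own proper initial segment below \<open>x'\<close>.\<close>

lemma cmp_not_less:
  assumes "iord A r" "iord B s" "wo r A" "(x, y) \<in> cmp A r B s" "(x', y) \<in> cmp A r B s"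
  shows "(x', x) \<notin> r"
proof
  assume less: "(x', x) \<in> r"
  let ?A = "{z \<in> A. (z, x) \<in> r}"
  obtain g h where gh: "sim (rel E g) ?A r {z \<in> B. (z, y) \<in> s} s"
    "sim (rel E h) {z \<in> A. (z, x') \<in> r} r {z \<in> B. (z, y) \<in> s} s"
    using cmpD(3)[OF assms(4)] cmpD(3)[OF assms(5)] by blast
  note i = internal_below[OF assms(1)] internal_below[OF assms(2)]
  obtain k where k: "sim (rel E k) {z \<in> B. (z, y) \<in> s} s {z \<in> A. (z, x') \<in> r} r"
    using sim_code_converse[OF gh(2) i] by blast
  obtain l where l: "sim (rel E l) ?A r {z \<in> A. (z, x') \<in> r} r"
    using sim_compose_code[OF gh(1) k i i(1)] by blast
  have "iord ?A r" by (rule iord_below[OF assms(1)])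
  moreover have "wo r ?A" by (rule wo_subset[OF assms(3)]) blast
  moreover have "x' \<in> ?A" using less cmpD(1)[OF assms(5)] by blast
  moreover have "sim (rel E l) ?A r {z \<in> ?A. (z, x') \<in> r} r"
    using l unfolding below_below[OF assms(1) less] .
  ultimately show False using no_shrink drel_rel by blast
qed

lemma cmp_unique:
  assumes "iord A r" "iord B s" "wo r A" "(x, y) \<in> cmp A r B s" "(x', y) \<in> cmp A r B s"
  shows "x = x'"
  using cmp_not_less[OF assms(1-3)] assms(4,5) cmpD(1) iordD(6)[OF assms(1)] by metis

lemma cmp_down:
  assumes "iord A r" "iord B s" "(x, y) \<in> cmp A r B s" "x' \<in> A" "(x', x) \<in> r"
  shows "\<exists>y' \<in> B. (x', y') \<in> cmp A r B s \<and> (y', y) \<in> s"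
proof -
  let ?A = "{z \<in> A. (z, x) \<in> r}" and ?B = "{z \<in> B. (z, y) \<in> s}"
  obtain g where g: "sim (rel E g) ?A r ?B s" using cmpD(3)[OF assms(3)] by blast
  have x': "x' \<in> ?A" using assms(4,5) by blast
  then obtain y' where y': "y' \<in> ?B" "(x', y') \<in> rel E g" using simD(1)[OF g] by blast
  from sim_restrict[OF g x' y'] have "sim (rel E g) {z \<in> A. (z, x') \<in> r} r {z \<in> B. (z, y') \<in> s} s"
    using below_below[OF assms(1,5)] below_below[OF assms(2)] y'(1) by simp
  then show ?thesis using y'(1) assms(4) unfolding cmp_def by blast
qed

lemma cmp_up:
  assumes "iord A r" "iord B s" "(x, y) \<in> cmp A r B s" "y' \<in> B" "(y', y) \<in> s"
  shows "\<exists>x' \<in> A. (x', y') \<in> cmp A r B s \<and> (x', x) \<in> r"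
  using cmp_down[OF assms(2,1), of y x y'] assms(3-5) cmp_converse[OF assms(1,2)] by simp

lemma cmp_mono:
  assumes "iord A r" "iord B s" "wo r A" "wo s B" "(x, y) \<in> cmp A r B s" "(x', y') \<in> cmp A r B s"
  shows "(x, x') \<in> r \<longleftrightarrow> (y, y') \<in> s"
proof
  assume "(x, x') \<in> r"
  then obtain y1 where y1: "(x, y1) \<in> cmp A r B s" "(y1, y') \<in> s"
    using cmp_down[OF assms(1,2,6)] cmpD(1)[OF assms(5)] by blast
  have "y1 = y" using cmp_unique[OF assms(2,1,4), of y1 x y] y1(1) assms(5) cmp_converse[OF assms(1,2)] by simp
  then show "(y, y') \<in> s" using y1 by simp
next
  assume "(y, y') \<in> s"
  then obtain x1 where x1: "(x1, y) \<in> cmp A r B s" "(x1, x') \<in> r"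
    using cmp_up[OF assms(1,2,6)] cmpD(2)[OF assms(5)] by blast
  have "x1 = x" using cmp_unique[OF assms(1-3) x1(1) assms(5)] .
  then show "(x, x') \<in> r" using x1 by simp
qed

text \<open>If points were left over on both sides, the comparison map itself would be a similarity
  between the segments below the least left-over points, which would thereby be related.\<close>

lemma cmp_total:
  assumes "iord A r" "iord B s" "wo r A" "wo s B"
  shows "A \<subseteq> Domain (cmp A r B s) \<or> B \<subseteq> Range (cmp A r B s)"
proof (rule ccontr)
  let ?R = "cmp A r B s"
  assume "\<not> (A \<subseteq> Domain ?R \<or> B \<subseteq> Range ?R)"
  then have ne: "A - Domain ?R \<noteq> {}" "B - Range ?R \<noteq> {}" by auto
  note fi = fo fo_in_internal[OF iordD(1)[OF assms(1)]] fo_in_internal[OF iordD(1)[OF assms(2)]]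
    iordD(2)[OF assms(1)] iordD(2)[OF assms(2)]
  have "fo (\<lambda>v. v 0 \<in> A - Domain ?R)" "fo (\<lambda>v. v 0 \<in> B - Range ?R)"
    unfolding Diff_iff Domain_iff Range_iff by (intro fi)+
  then obtain x y where x: "x \<in> A - Domain ?R" "\<forall>z. (z, x) \<in> r \<longrightarrow> z \<notin> A - Domain ?R"
    and y: "y \<in> B - Range ?R" "\<forall>z. (z, y) \<in> s \<longrightarrow> z \<notin> B - Range ?R"
    using wo_least[OF assms(1,3) Diff_subset _ ne(1)] wo_least[OF assms(2,4) Diff_subset _ ne(2)] by meson
  have "sim ?R {z \<in> A. (z, x) \<in> r} r {z \<in> B. (z, y) \<in> s} s"
  proof (rule simI)
    fix z assume z: "z \<in> {z \<in> A. (z, x) \<in> r}"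
    then obtain u where u: "(z, u) \<in> ?R" using x(2) by blast
    have "(u, y) \<in> s"
    proof (rule ccontr)
      assume "(u, y) \<notin> s"
      then have "u = y \<or> (y, u) \<in> s" using iordD(6)[OF assms(2)] cmpD(2)[OF u] y(1) by blast
      then have "y \<in> Range ?R" using u cmp_up[OF assms(1,2) u] y(1) by blast
      then show False using y(1) by blast
    qed
    then show "\<exists>u \<in> {z \<in> B. (z, y) \<in> s}. (z, u) \<in> ?R" using u cmpD(2)[OF u] by blast
  next
    fix u assume "u \<in> {z \<in> B. (z, y) \<in> s}"
    then obtain z where z: "(z, u) \<in> ?R" using y(2) by blast
    have "(z, x) \<in> r"
    proof (rule ccontr)
      assume "(z, x) \<notin> r"
      then have "z = x \<or> (x, z) \<in> r" using iordD(6)[OF assms(1)] cmpD(1)[OF z] x(1) by blast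
      then have "x \<in> Domain ?R" using z cmp_down[OF assms(1,2) z] x(1) by blast
      then show False using x(1) by blast
    qed
    then show "\<exists>z \<in> {z \<in> A. (z, x) \<in> r}. (z, u) \<in> ?R" using z cmpD(1)[OF z] by blast
  qed (rule cmp_mono[OF assms])
  moreover have "drel ?R" by (intro drel_cmp iordD(1,2)[OF assms(1)] iordD(1,2)[OF assms(2)])
  ultimately have "(x, y) \<in> ?R"
    using sim_code[OF _ _ internal_below[OF assms(1)] internal_below[OF assms(2)], of ?R x r y s] x(1) y(1)
    unfolding cmp_def by simp
  then show False using x(1) by blast
qed

text \<open>Comparison of the types of well-orders. The embedding is always the canonical map
  \<open>cmp\<close>, onto an initial segment, so embeddings for a whole family of pairs are given
  by one formula.\<close>

definition leq :: "'a set \<Rightarrow> ('a \<times> 'a) set \<Rightarrow> 'a set \<Rightarrow> bool" where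
  "leq A r B \<longleftrightarrow> A \<subseteq> Domain (cmp A r B r)"

lemma fo_leq [fo]:
  assumes "drel r" "fo (\<lambda>v. v 0 \<in> A (\<lambda>n. v (Suc n)))" "fo (\<lambda>v. v 0 \<in> B (\<lambda>n. v (Suc n)))"
  shows "fo (\<lambda>v. leq (A v) r (B v))"
  unfolding leq_def subset_iff Domain_iff
  by (intro fo assms fo_ren2[OF assms(2)] fo_ren2[OF assms(3)])

lemma not_leq:
  assumes "iord A r" "iord B r" "wo r A" "wo r B" "\<not> leq A r B"
  shows "\<exists>x \<in> A. \<exists>g. sim (rel E g) {z \<in> A. (z, x) \<in> r} r B r"
proof -
  let ?R = "cmp A r B r"
  have ran: "B \<subseteq> Range ?R" and ne: "A - Domain ?R \<noteq> {}"
    using cmp_total[OF assms(1-4)] assms(5) unfolding leq_def by auto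
  note fi = fo fo_in_internal[OF iordD(1)[OF assms(1)]] fo_in_internal[OF iordD(1)[OF assms(2)]]
    iordD(2)[OF assms(1)]
  have "fo (\<lambda>v. v 0 \<in> A - Domain ?R)" unfolding Diff_iff Domain_iff by (intro fi)
  then obtain x where x: "x \<in> A - Domain ?R" "\<forall>z. (z, x) \<in> r \<longrightarrow> z \<notin> A - Domain ?R"
    using wo_least[OF assms(1,3) Diff_subset _ ne] by meson
  have "sim ?R {z \<in> A. (z, x) \<in> r} r B r"
  proof (rule simI)
    fix z assume z: "z \<in> {z \<in> A. (z, x) \<in> r}"
    then obtain u where u: "(z, u) \<in> ?R" using x(2) by blast
    then show "\<exists>u \<in> B. (z, u) \<in> ?R" using cmpD(2)[OF u] by blast
  next
    fix u assume "u \<in> B"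
    then obtain z where z: "(z, u) \<in> ?R" using ran by blast
    have "(z, x) \<in> r"
    proof (rule ccontr)
      assume "(z, x) \<notin> r"
      then have "z = x \<or> (x, z) \<in> r" using iordD(6)[OF assms(1)] cmpD(1)[OF z] x(1) by blast
      then have "x \<in> Domain ?R" using z cmp_down[OF assms(1,2) z] x(1) by blast
      then show False using x(1) by blast
    qed
    then show "\<exists>z \<in> {z \<in> A. (z, x) \<in> r}. (z, u) \<in> ?R" using z cmpD(1)[OF z] by blast
  qed (rule cmp_mono[OF assms(1-4)])
  moreover have "drel ?R" by (intro drel_cmp iordD(1,2)[OF assms(1)] iordD(1,2)[OF assms(2)])
  ultimately show ?thesis
    using sim_code[OF _ _ internal_below[OF assms(1)] iordD(1)[OF assms(2)], of ?R x r r] x(1) by blast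
qed

text \<open>Fix one member \<open>W i\<close>. Every member that is shorter than \<open>W i\<close>
  is represented by a point of \<open>W i\<close>, namely the end of the initial segment similar to
  it. The least such point belongs to a member of least type.\<close>

lemma leq_min:
  assumes "iord T r" "\<And>i. i \<in> N \<Longrightarrow> W i \<subseteq> T \<and> wo r (W i)" "fo (\<lambda>v. v 0 \<in> W (v (Suc 0)))"
    "fo (\<lambda>v. v 0 \<in> N)" "N \<noteq> {}"
  shows "\<exists>i \<in> N. \<forall>j \<in> N. leq (W i) r (W j)"
proof (cases "\<exists>i \<in> N. \<forall>j \<in> N. leq (W i) r (W j)")
  case False
  obtain i where i: "i \<in> N" using assms(5) by blast
  have foW: "ft s \<Longrightarrow> ft t \<Longrightarrow> fo (\<lambda>v. s v \<in> W (t v))" for s t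
    by (rule fo_rel2[where R = "\<lambda>x y. x \<in> W y"]) (use assms(3) in simp)+
  have foN: "ft s \<Longrightarrow> fo (\<lambda>v. s v \<in> N)" for s
    by (rule fo_subst[where P = "\<lambda>v x. x \<in> N"]) (use assms(4) in simp)
  have io: "iord (W j) r" if "j \<in> N" for j
  proof (rule iord_subset[OF assms(1)])
    show "W j \<subseteq> T" using assms(2) that by blast
    show "internal (W j)"
      by (rule internal_sep[OF iordD(1)[OF assms(1)]]) (use assms(2) that in blast, intro foW fo)
  qed
  define M where "M = {x \<in> W i. \<exists>j \<in> N. \<exists>g. sim (rel E g) {z \<in> W i. (z, x) \<in> r} r (W j) r}"
  have foM: "fo (\<lambda>v. v 0 \<in> M)" unfolding M_def
    by (intro fo foW foN fo_drel iordD(2)[OF assms(1)])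
  have MW: "M \<subseteq> W i" unfolding M_def by blast
  obtain j where j: "j \<in> N" "\<not> leq (W i) r (W j)" using False i by blast
  have "M \<noteq> {}" using not_leq[OF io[OF i] io[OF j(1)]] assms(2) i j unfolding M_def by blast
  then obtain x where x: "x \<in> M" "\<forall>z. (z, x) \<in> r \<longrightarrow> z \<notin> M"
    using wo_least[OF io[OF i] _ MW foM] assms(2)[OF i] by blast
  obtain k g where k: "k \<in> N" "sim (rel E g) {z \<in> W i. (z, x) \<in> r} r (W k) r"
    using x(1) unfolding M_def by blast
  obtain l where l: "l \<in> N" "\<not> leq (W k) r (W l)" using False k(1) by blast
  obtain y h where y: "y \<in> W k" and h: "sim (rel E h) {z \<in> W k. (z, y) \<in> r} r (W l) r"
    using not_leq[OF io[OF k(1)] io[OF l(1)]] assms(2) k(1) l by blast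
  obtain x' where x': "x' \<in> {z \<in> W i. (z, x) \<in> r}" "(x', y) \<in> rel E g" using simD(2)[OF k(2) y] by blast
  from sim_restrict[OF k(2) x'(1) y x'(2)]
  have "sim (rel E g) {z \<in> W i. (z, x') \<in> r} r {z \<in> W k. (z, y) \<in> r} r"
    using below_below[OF io[OF i]] x'(1) by simp
  from sim_compose_code[OF this h internal_below[OF io[OF i]] internal_below[OF io[OF k(1)]] iordD(1)[OF io[OF l(1)]]]
  have "\<exists>h. sim (rel E h) {z \<in> W i. (z, x') \<in> r} r (W l) r" .
  then have "x' \<in> M" using x'(1) l(1) unfolding M_def by blast
  then show ?thesis using x(2) x'(1) by blast
qed blast

text \<open>Order type \<open>\<omega>\<close>, without mentioning the natural numbers of the model, which may be nonstandard.
  Finiteness of an interval always means that it is well-ordered in both directions.\<close>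

definition om :: "('a \<times> 'a) set \<Rightarrow> 'a set \<Rightarrow> bool" where
  "om r A \<longleftrightarrow> wo r A \<and> (\<forall>x \<in> A. \<exists>y \<in> A. (x, y) \<in> r) \<and> (\<forall>x \<in> A. wo (r\<inverse>) {z \<in> A. (z, x) \<in> r})"

lemma om_below_max:
  assumes "iord A r" "om r A" "N \<subseteq> A" "x \<in> A" "\<forall>z \<in> N. z = x \<or> (z, x) \<in> r" "fo (\<lambda>v. v 0 \<in> N)" "N \<noteq> {}"
  shows "\<exists>m \<in> N. \<forall>z \<in> N. z \<noteq> m \<longrightarrow> (z, m) \<in> r"
proof (cases "x \<in> N")
  case False
  let ?A = "{z \<in> A. (z, x) \<in> r}"
  have "iord ?A (r\<inverse>)" by (rule iord_converse[OF iord_below[OF assms(1)]])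
  moreover have "wo (r\<inverse>) ?A" using assms(2,4) unfolding om_def by blast
  moreover have "N \<subseteq> ?A" using False assms(3,5) by auto
  ultimately show ?thesis using wo_least[of ?A "r\<inverse>" N] assms(6,7) by auto
qed (use assms(5) in blast)

text \<open>If the comparison missed a point on one side, the part reached there would be bounded
  and would have a maximum. Its partner would then be the maximum of the other side, which is
  reached completely and has none.\<close>

lemma om_cmp:
  assumes "iord A r" "om r A" "B \<subseteq> A" "internal B" "\<forall>x \<in> A. \<exists>y \<in> B. (x, y) \<in> r"
  shows "sim (cmp A r B r) A r B r"
proof -
  let ?R = "cmp A r B r"
  have ioB: "iord B r" by (rule iord_subset[OF assms(1,3,4)])
  have woA: "wo r A" using assms(2) unfolding om_def by blast
  have woB: "wo r B" by (rule wo_subset[OF woA assms(3)])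
  note fi = fo fo_in_internal[OF iordD(1)[OF assms(1)]] fo_in_internal[OF assms(4)]
    iordD(2)[OF assms(1)]
  note mono = cmp_mono[OF assms(1) ioB woA woB]
  have dom: "A \<subseteq> Domain ?R"
  proof (rule ccontr)
    assume "\<not> A \<subseteq> Domain ?R"
    then obtain x where x: "x \<in> A" "x \<notin> Domain ?R" by blast
    then have ran: "B \<subseteq> Range ?R" using cmp_total[OF assms(1) ioB woA woB] by blast
    have less: "(z, x) \<in> r" if "z \<in> Domain ?R" for z
    proof (rule ccontr)
      assume *: "(z, x) \<notin> r"
      obtain u where u: "(z, u) \<in> ?R" using \<open>z \<in> Domain ?R\<close> by blast
      have "z = x \<or> (x, z) \<in> r" using * iordD(6)[OF assms(1)] cmpD(1)[OF u] x by blast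
      then show False using x that cmp_down[OF assms(1) ioB u] by blast
    qed
    have "Domain ?R \<noteq> {}" using ran assms(5) x(1) by blast
    moreover have "fo (\<lambda>v. v 0 \<in> Domain ?R)" unfolding Domain_iff by (intro fi)
    moreover have "Domain ?R \<subseteq> A" using cmpD(1) by blast
    ultimately obtain m where m: "m \<in> Domain ?R" "\<forall>z \<in> Domain ?R. z \<noteq> m \<longrightarrow> (z, m) \<in> r"
      using om_below_max[OF assms(1,2) _ x(1)] less by blast
    obtain u where u: "(m, u) \<in> ?R" using m(1) by blast
    obtain w where w: "w \<in> B" "(u, w) \<in> r" using assms(3,5) cmpD(2)[OF u] by blast
    obtain z where z: "(z, w) \<in> ?R" using ran w(1) by blast
    then have "(m, z) \<in> r" using mono[OF u z] w(2) by blast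
    then show False using m(2) DomainI[OF z] iordD(3,5)[OF assms(1)] by metis
  qed
  have ran: "B \<subseteq> Range ?R"
  proof (rule ccontr)
    assume "\<not> B \<subseteq> Range ?R"
    then obtain y where y: "y \<in> B" "y \<notin> Range ?R" by blast
    have less: "(u, y) \<in> r" if "u \<in> Range ?R" for u
    proof (rule ccontr)
      assume *: "(u, y) \<notin> r"
      obtain z where z: "(z, u) \<in> ?R" using \<open>u \<in> Range ?R\<close> by blast
      have "u = y \<or> (y, u) \<in> r" using * iordD(6)[OF ioB] cmpD(2)[OF z] y by blast
      then show False using y that cmp_up[OF assms(1) ioB z] by blast
    qed
    have "Range ?R \<noteq> {}" using dom y(1) assms(3) by blast
    moreover have "fo (\<lambda>v. v 0 \<in> Range ?R)" unfolding Range_iff by (intro fi)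
    moreover have "Range ?R \<subseteq> A" using cmpD(2) assms(3) by blast
    ultimately obtain m where m: "m \<in> Range ?R" "\<forall>z \<in> Range ?R. z \<noteq> m \<longrightarrow> (z, m) \<in> r"
      using om_below_max[OF assms(1,2), of "Range ?R" y] less y(1) assms(3) by blast
    obtain z where z: "(z, m) \<in> ?R" using m(1) by blast
    obtain z' where z': "z' \<in> A" "(z, z') \<in> r" using assms(2) cmpD(1)[OF z] unfolding om_def by blast
    obtain u where u: "(z', u) \<in> ?R" using dom z'(1) by blast
    then have "(m, u) \<in> r" using mono[OF z u] z'(2) by blast
    then show False using m(2) RangeI[OF u] iordD(3,5)[OF assms(1)] by metis
  qed
  show ?thesis
  proof (rule simI)
    show "\<exists>y \<in> B. (x, y) \<in> ?R" if "x \<in> A" for x using that dom cmpD(2) by (meson DomainE subsetD)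
    show "\<exists>x \<in> A. (x, y) \<in> ?R" if "y \<in> B" for y using that ran cmpD(1) by (meson RangeE subsetD)
  qed (rule mono)
qed

end

section \<open>Combs in the power set of an ordinal\<close>

locale branching = zf_model E for E :: "'a \<Rightarrow> 'a \<Rightarrow> bool" +
  fixes D :: "'a set" and od bit :: "('a \<times> 'a) set"
  assumes D: "iord D od" "wo od D" and bit: "drel bit"
begin

lemmas fod = fo_in_internal[OF iordD(1)[OF D(1)]] fo_drel[OF iordD(2)[OF D(1)]] fo_drel[OF bit]

text \<open>A point \<open>x\<close> stands for the subset of the ordinal \<open>D\<close> with \<open>b\<close> in it iff \<open>(b, x) \<in> bit\<close>. If \<open>\<Delta> x y\<close> is the
  least place where \<open>x\<close> and \<open>y\<close> differ, then \<open>ag x y b\<close> says \<open>\<Delta> x y \<ge> b\<close>, \<open>agle x y b\<close> says \<open>\<Delta> x y > b\<close>, and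
  \<open>Up x y z\<close> says \<open>\<Delta> x y < \<Delta> y z\<close>.\<close>

definition ag :: "'a \<Rightarrow> 'a \<Rightarrow> 'a \<Rightarrow> bool" where
  "ag x y b \<longleftrightarrow> (\<forall>c \<in> D. (c, b) \<in> od \<longrightarrow> ((c, x) \<in> bit \<longleftrightarrow> (c, y) \<in> bit))"

definition agle :: "'a \<Rightarrow> 'a \<Rightarrow> 'a \<Rightarrow> bool" where
  "agle x y b \<longleftrightarrow> (\<forall>c \<in> D. c = b \<or> (c, b) \<in> od \<longrightarrow> ((c, x) \<in> bit \<longleftrightarrow> (c, y) \<in> bit))"

definition Up :: "'a \<Rightarrow> 'a \<Rightarrow> 'a \<Rightarrow> bool" where
  "Up x y z \<longleftrightarrow> (\<exists>b \<in> D. ((b, x) \<in> bit) \<noteq> ((b, y) \<in> bit) \<and> agle y z b)"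

lemma od_cases: "b \<in> D \<Longrightarrow> c \<in> D \<Longrightarrow> b = c \<or> (b, c) \<in> od \<or> (c, b) \<in> od"
  using iordD(6)[OF D(1)] by blast

lemma Up_asym: "Up x y z \<Longrightarrow> \<not> Up z y x"
  unfolding Up_def agle_def using od_cases by metis

lemma fo_ag: "fo (\<lambda>v. ag (v 0) (v 1) (v 2))"
  unfolding ag_def by (intro fo fod)

lemma fo_agle: "fo (\<lambda>v. agle (v 0) (v 1) (v 2))"
  unfolding agle_def by (intro fo fod)

lemma fo_ag' [fo]: "ft s \<Longrightarrow> ft t \<Longrightarrow> ft u \<Longrightarrow> fo (\<lambda>v. ag (s v) (t v) (u v))"
  by (rule fo_rel3[where R = ag, OF fo_ag])

lemma fo_agle' [fo]: "ft s \<Longrightarrow> ft t \<Longrightarrow> ft u \<Longrightarrow> fo (\<lambda>v. agle (s v) (t v) (u v))"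
  by (rule fo_rel3[where R = agle, OF fo_agle])

lemma fo_Up [fo]: "ft s \<Longrightarrow> ft t \<Longrightarrow> ft u \<Longrightarrow> fo (\<lambda>v. Up (s v) (t v) (u v))"
  by (rule fo_rel3[where R = Up]) (unfold Up_def, intro fo fod)

lemma ag_sym: "ag x y b \<Longrightarrow> ag y x b" unfolding ag_def by blast
lemma agle_sym: "agle x y b \<Longrightarrow> agle y x b" unfolding agle_def by blast
lemma ag_trans: "ag x y b \<Longrightarrow> ag y z b \<Longrightarrow> ag x z b" unfolding ag_def by blast
lemma agle_trans: "agle x y b \<Longrightarrow> agle y z b \<Longrightarrow> agle x z b" unfolding agle_def by blast
lemma agle_iff: "b \<in> D \<Longrightarrow> agle x y b \<longleftrightarrow> ag x y b \<and> ((b, x) \<in> bit \<longleftrightarrow> (b, y) \<in> bit)"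
  unfolding agle_def ag_def by blast
lemma agle_less: "agle x y b \<Longrightarrow> (c, b) \<in> od \<Longrightarrow> c \<in> D \<Longrightarrow> agle x y c"
  unfolding agle_def using iordD(4)[OF D(1)] by metis
lemma ag_less: "ag x y b \<Longrightarrow> (c, b) \<in> od \<Longrightarrow> c \<in> D \<Longrightarrow> agle x y c"
  unfolding agle_def ag_def using iordD(4)[OF D(1)] by metis

definition unb :: "('a \<times> 'a) set \<Rightarrow> 'a set \<Rightarrow> 'a set \<Rightarrow> bool" where
  "unb r A N \<longleftrightarrow> (\<forall>x \<in> A. \<exists>y \<in> N. (x, y) \<in> r)"

lemma unb_mono: "unb r A M \<Longrightarrow> M \<subseteq> N \<Longrightarrow> unb r A N"
  unfolding unb_def by blast

text \<open>The node of \<open>x\<close> just above level \<open>b\<close> lies on the leftmost path of nodes that contain unboundedly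
  many points of \<open>A\<close>. All but boundedly many points leave this path below its end, and \<open>thin\<close> collects
  the left-to-right maxima of the level of leaving. This yields a comb without any recursion or choice.\<close>

definition on_path :: "('a \<times> 'a) set \<Rightarrow> 'a set \<Rightarrow> 'a \<Rightarrow> 'a \<Rightarrow> bool" where
  "on_path r A x b \<longleftrightarrow> b \<in> D \<and> unb r A {y \<in> A. agle x y b} \<and>
     (\<forall>c \<in> D. (c = b \<or> (c, b) \<in> od) \<and> (c, x) \<in> bit \<longrightarrow> \<not> unb r A {y \<in> A. ag x y c \<and> (c, y) \<notin> bit})"

text \<open>A point may stay on the path for all levels, so there need not be a level of leaving. By
  \<open>path_less\<close> the levels at which a point is on the path form an initial segment of
  \<open>D\<close>, and the segments of \<open>x\<close> and \<open>y\<close> are compared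
  instead.\<close>

definition survives :: "('a \<times> 'a) set \<Rightarrow> 'a set \<Rightarrow> 'a \<Rightarrow> 'a \<Rightarrow> bool" where
  "survives r A x y \<longleftrightarrow> (\<exists>b \<in> D. on_path r A y b \<and> \<not> on_path r A x b)"

definition nontop :: "('a \<times> 'a) set \<Rightarrow> 'a set \<Rightarrow> 'a \<Rightarrow> bool" where
  "nontop r A x \<longleftrightarrow> (\<exists>z \<in> A. survives r A x z)"

definition thin :: "('a \<times> 'a) set \<Rightarrow> 'a set \<Rightarrow> 'a set" where
  "thin r A = {x \<in> A. nontop r A x \<and> (\<forall>y \<in> A. (y, x) \<in> r \<and> nontop r A y \<longrightarrow> survives r A y x)}"

lemma fo_thin_aux:
  assumes "drel r" "fo (\<lambda>v. v 0 \<in> A (\<lambda>n. v (Suc n)))"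
  shows fo_path: "\<And>f k l. fo (\<lambda>v. on_path r (A (\<lambda>n. v (f n))) (v k) (v l))"
    and fo_survives: "\<And>f k l. fo (\<lambda>v. survives r (A (\<lambda>n. v (f n))) (v k) (v l))"
    and fo_nontop: "\<And>f k. fo (\<lambda>v. nontop r (A (\<lambda>n. v (f n))) (v k))"
    and fo_inA: "\<And>f k. fo (\<lambda>v. v k \<in> A (\<lambda>n. v (f n)))"
proof -
  show inA: "fo (\<lambda>v. v k \<in> A (\<lambda>n. v (f n)))" for f k
    using fo_ren[OF assms(2), of "case_nat k f"] by simp
  show on_path: "fo (\<lambda>v. on_path r (A (\<lambda>n. v (f n))) (v k) (v l))" for f k l
    unfolding on_path_def unb_def by (intro fo fod fo_drel[OF assms(1)] inA)
  show survives: "fo (\<lambda>v. survives r (A (\<lambda>n. v (f n))) (v k) (v l))" for f k l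
    unfolding survives_def by (intro fo fod on_path)
  show "fo (\<lambda>v. nontop r (A (\<lambda>n. v (f n))) (v k))" for f k
    unfolding nontop_def by (intro fo inA survives)
qed

lemma fo_thin [fo]:
  assumes "drel r" "ft t" "fo (\<lambda>v. v 0 \<in> A (\<lambda>n. v (Suc n)))"
  shows "fo (\<lambda>v. t v \<in> thin r (A v))"
proof (rule fo_subst[OF _ assms(2)])
  show "fo (\<lambda>v. v 0 \<in> thin r (A (\<lambda>n. v (Suc n))))"
    unfolding thin_def
    by (intro fo fo_inA[OF assms(1,3)] fo_nontop[OF assms(1,3)] fo_survives[OF assms(1,3)] fo_drel[OF assms(1)])
qed

lemma path_less: "on_path r A x b \<Longrightarrow> (c, b) \<in> od \<Longrightarrow> c \<in> D \<Longrightarrow> on_path r A x c"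
  unfolding on_path_def using agle_less iordD(4)[OF D(1)]
  by (auto elim!: unb_mono)

text \<open>At the first difference one of the points turns right, although the left branch contains
  the node of the other point and therefore unboundedly many points of \<open>A\<close>.\<close>

lemma path_agle: assumes "on_path r A x b" "on_path r A y b" shows "agle x y b"
proof (rule ccontr)
  assume neg: "\<not> agle x y b"
  let ?N = "{c \<in> D. (c = b \<or> (c, b) \<in> od) \<and> ((c, x) \<in> bit) \<noteq> ((c, y) \<in> bit)}"
  have "?N \<noteq> {}" using neg unfolding agle_def by blast
  moreover have "fo (\<lambda>v. v 0 \<in> ?N)" by (intro fo fod)
  moreover have "?N \<subseteq> D" by blast
  ultimately obtain c where c: "c \<in> ?N" "\<forall>d. (d, c) \<in> od \<longrightarrow> d \<notin> ?N"
    using wo_least[OF D] by meson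
  have ag: "ag x y c" unfolding ag_def using c iordD(4)[OF D(1)] by blast
  have *: False if "on_path r A x b" "on_path r A y b" "ag x y c" "(c, x) \<in> bit" "(c, y) \<notin> bit" for x y
  proof -
    have "unb r A {z \<in> A. agle y z b}" using that(2) unfolding on_path_def by blast
    moreover have "agle y z c" if "agle y z b" for z using that agle_less[OF that] c(1) by blast
    then have "{z \<in> A. agle y z b} \<subseteq> {z \<in> A. ag x z c \<and> (c, z) \<notin> bit}"
      using that(3,5) c(1) agle_iff[of c] ag_trans by blast
    ultimately have "unb r A {z \<in> A. ag x z c \<and> (c, z) \<notin> bit}" by (rule unb_mono)
    then show False using that(1,4) c(1) unfolding on_path_def by blast
  qed
  show False using *[OF assms(1,2) ag] *[OF assms(2,1) ag_sym[OF ag]] c(1) by blast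
qed

lemma path_cong: assumes "on_path r A x b" "agle x y b" shows "on_path r A y b"
proof -
  have b: "b \<in> D" using assms(1) unfolding on_path_def by blast
  have 1: "agle x z b = agle y z b" for z using agle_trans agle_sym assms(2) by blast
  have 2: "ag x z c = ag y z c" "((c, x) \<in> bit) = ((c, y) \<in> bit)" if "c \<in> D" "c = b \<or> (c, b) \<in> od" for c z
  proof -
    have "agle x y c" using that agle_less assms(2) by blast
    then show "ag x z c = ag y z c" "((c, x) \<in> bit) = ((c, y) \<in> bit)"
      using agle_iff[OF that(1)] ag_trans ag_sym by blast+
  qed
  show ?thesis using assms(1) 2 unfolding on_path_def 1 by auto
qed

lemma survives_asym: "survives r A x y \<Longrightarrow> \<not> survives r A y x"
  unfolding survives_def using od_cases path_less by metis

lemma survives_cotrans: "survives r A x z \<Longrightarrow> survives r A x y \<or> survives r A y z"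
  unfolding survives_def by blast

text \<open>Let \<open>y\<close> be on the path at level \<open>c\<close> and \<open>x\<close> not.
  Then \<open>x\<close> and \<open>y\<close> differ at or below \<open>c\<close>, since being on the
  path depends only on the node. As \<open>z\<close> outlasts \<open>y\<close>, it is on the path at
  \<open>c\<close> too and agrees with \<open>y\<close> up to there.\<close>

lemma survives_Up:
  assumes "survives r A x y" "survives r A y z" shows "Up x y z"
proof -
  obtain b where b: "b \<in> D" "on_path r A z b" "\<not> on_path r A y b" using assms(2) unfolding survives_def by blast
  obtain c where c: "c \<in> D" "on_path r A y c" "\<not> on_path r A x c" using assms(1) unfolding survives_def by blast
  have "\<not> agle y x c" using c path_cong by blast
  then obtain d where d: "d \<in> D" "d = c \<or> (d, c) \<in> od" "((d, x) \<in> bit) \<noteq> ((d, y) \<in> bit)"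
    unfolding agle_def by blast
  have "(c, b) \<in> od" using od_cases[OF b(1) c(1)] b c path_less by blast
  then have "on_path r A z c" using b c path_less by blast
  then have "agle y z c" using path_agle c(2) by blast
  then have "agle y z d" using d agle_less by blast
  then show ?thesis using d unfolding Up_def by blast
qed

context
  fixes A r
  assumes A: "iord A r" "om r A" "A \<noteq> {}"
    and inj: "\<And>x y. x \<in> A \<Longrightarrow> y \<in> A \<Longrightarrow> x \<noteq> y \<Longrightarrow> \<exists>b \<in> D. ((b, x) \<in> bit) \<noteq> ((b, y) \<in> bit)"
begin

lemma fo_in_A: "ft t \<Longrightarrow> fo (\<lambda>v. t v \<in> A)"
  by (rule fo_in_internal[OF iordD(1)[OF A(1)]])

lemma fo_path_A:
  assumes "ft s" "ft t" shows "fo (\<lambda>v. on_path r A (s v) (t v))"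
proof (rule fo_rel2[where R = "on_path r A", OF _ assms])
  show "fo (\<lambda>v. on_path r A (v 0) (v 1))"
    by (rule fo_path[OF iordD(2)[OF A(1)]]) (rule fo_in_A, rule ft_var)
qed

text \<open>Beyond a bound for \<open>N0\<close> all points of \<open>M\<close> lie in
  \<open>N1\<close>.\<close>

lemma unb_Un:
  assumes "unb r A M" "M \<subseteq> N0 \<union> N1" "\<not> unb r A N0" "M \<subseteq> A" shows "unb r A N1"
proof -
  obtain b where b: "b \<in> A" "\<And>y. y \<in> N0 \<Longrightarrow> (b, y) \<notin> r" using assms(3) unfolding unb_def by blast
  have "\<exists>y \<in> N1. (x, y) \<in> r" if x: "x \<in> A" for x
  proof -
    have "\<exists>c \<in> A. (c = x \<or> (x, c) \<in> r) \<and> (c = b \<or> (b, c) \<in> r)"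
      using iordD(6)[OF A(1) x b(1)] x b(1) by blast
    then obtain c where c: "c \<in> A" "c = x \<or> (x, c) \<in> r" "c = b \<or> (b, c) \<in> r" by blast
    obtain y where y: "y \<in> M" "(c, y) \<in> r" using assms(1) c(1) unfolding unb_def by blast
    then have "(b, y) \<in> r" "(x, y) \<in> r" using c iordD(4)[OF A(1)] by metis+
    then show ?thesis using y assms(2) b(2) by blast
  qed
  then show ?thesis unfolding unb_def by blast
qed

text \<open>If unboundedly many points stayed on the path to its end, then one of the two successors of the
  end node would prolong it.\<close>

lemma tops_bounded: "\<not> unb r A {x \<in> A. \<not> nontop r A x}"
proof
  let ?T = "{x \<in> A. \<not> nontop r A x}"
  assume unb: "unb r A ?T"
  show False
  proof -
    obtain t where t: "t \<in> ?T" using unb A(3) unfolding unb_def by blast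
    \<comment> \<open>No top outlasts another, so all of them are on the path at the same levels as
      \<open>t\<close>.\<close>
    have tops: "on_path r A x b = on_path r A t b" if "x \<in> ?T" for x b
    proof -
      have "\<not> survives r A x t" "\<not> survives r A t x" using that t unfolding nontop_def by blast+
      then show ?thesis unfolding survives_def on_path_def by blast
    qed
    let ?N = "{b \<in> D. \<not> on_path r A t b}"
    show False
    \<comment> \<open>If the tops never leave the path, they agree at every level and are equal by
      injectivity, so they cannot be unbounded.\<close>
    proof (cases "?N = {}")
      case True
      have "x = t" if x: "x \<in> ?T" for x
      proof (rule ccontr)
        assume "x \<noteq> t"
        then obtain b where b: "b \<in> D" "((b, x) \<in> bit) \<noteq> ((b, t) \<in> bit)" using inj[of x t] x t by blast
        then have "on_path r A x b" "on_path r A t b" using True tops[OF x] by blast+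
        then have "agle x t b" by (rule path_agle)
        then show False using b unfolding agle_def by blast
      qed
      moreover obtain y where "y \<in> ?T" "(t, y) \<in> r" using unb t unfolding unb_def by blast
      ultimately show False using iordD(3)[OF A(1)] by metis
    next
      case False
      have "fo (\<lambda>v. v 0 \<in> ?N)"
        by (intro fo fod fo_path_A)
      \<comment> \<open>The path of the tops ends at level \<open>b\<close>: all of them agree below
        it, and none of them is on the path at \<open>b\<close>.\<close>
      then obtain b where b: "b \<in> ?N" "\<forall>c. (c, b) \<in> od \<longrightarrow> c \<notin> ?N"
        using wo_least[OF D Collect_subset _ False] by meson
      have bD: "b \<in> D" using b(1) by blast
      have below: "on_path r A t c" if "c \<in> D" "(c, b) \<in> od" for c using b(2) that by blast
      have ag: "ag t x b" if x: "x \<in> ?T" for x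
        unfolding ag_def
      proof (intro ballI impI)
        fix c assume c: "c \<in> D" "(c, b) \<in> od"
        then have "agle t x c" using path_agle below tops[OF x] by blast
        then show "((c, t) \<in> bit) = ((c, x) \<in> bit)" using c agle_iff by blast
      qed
      let ?N0 = "{y \<in> A. ag t y b \<and> (b, y) \<notin> bit}" and ?N1 = "{y \<in> A. ag t y b \<and> (b, y) \<in> bit}"
      have on_path: "on_path r A y b" if y: "y \<in> A" "ag t y b" "unb r A {z \<in> A. agle y z b}"
        "(b, y) \<in> bit \<Longrightarrow> \<not> unb r A ?N0" for y
        unfolding on_path_def
      proof (intro conjI ballI impI y(3) bD)
        fix c assume c: "c \<in> D" "(c = b \<or> (c, b) \<in> od) \<and> (c, y) \<in> bit"
        have eq: "ag y z b = ag t z b" for z using y(2) ag_trans ag_sym by blast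
        show "\<not> unb r A {z \<in> A. ag y z c \<and> (c, z) \<notin> bit}"
        proof (cases "c = b")
          case True
          then show ?thesis using y(4) c eq by simp
        next
          case False
          then have "(c, b) \<in> od" using c by blast
          then have "agle t y c" "on_path r A t c" using ag_less y(2) below c(1) by blast+
          then have "on_path r A y c" using path_cong by blast
          then show ?thesis using c unfolding on_path_def by blast
        qed
      qed
      \<comment> \<open>A point of \<open>A\<close> on the path at level \<open>b\<close> would
        outlast the top \<open>t\<close>.\<close>
      have notop: False if y: "on_path r A y b" "y \<in> A" for y
        using y b(1) t unfolding nontop_def survives_def by blast
      \<comment> \<open>The left successor prolongs the path if it holds unboundedly many points.
        Otherwise the right one does, since all tops pass through the end node and only boundedly
        many of them can go left.\<close>
      have A0: "A \<noteq> {}" using t by blast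
      show False
      proof (cases "unb r A ?N0")
        case True
        then obtain y where y: "y \<in> ?N0" using A0 unfolding unb_def by blast
        then have "ag y z b = ag t z b" for z using ag_trans ag_sym by blast
        then have "?N0 \<subseteq> {z \<in> A. agle y z b}" using y agle_iff[OF bD] by auto
        then have "unb r A {z \<in> A. agle y z b}" using True unb_mono by blast
        then show False using on_path[of y] y notop by blast
      next
        case False
        have "?T \<subseteq> ?N0 \<union> ?N1" using ag by blast
        then have u: "unb r A ?N1" using unb_Un[OF unb _ False] by blast
        then obtain y where y: "y \<in> ?N1" using A0 unfolding unb_def by blast
        then have "ag y z b = ag t z b" for z using ag_trans ag_sym by blast
        then have "?N1 \<subseteq> {z \<in> A. agle y z b}" using y agle_iff[OF bD] by auto
        then have "unb r A {z \<in> A. agle y z b}" using u unb_mono by blast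
        then show False using on_path[of y] y notop False by blast
      qed
    qed
  qed
qed

text \<open>Some \<open>t\<close> is on the path at a level where \<open>y\<close> is not. The node
  of \<open>t\<close> there holds unboundedly many points, too many to be all tops, and each of them
  outlasts \<open>y\<close>.\<close>

lemma nontop_survives:
  assumes "y \<in> A" "nontop r A y" shows "\<exists>z \<in> A. nontop r A z \<and> survives r A y z"
proof -
  obtain t b where t: "t \<in> A" "b \<in> D" "on_path r A t b" "\<not> on_path r A y b"
    using assms(2) unfolding nontop_def survives_def by blast
  have "unb r A {z \<in> A. agle t z b}" using t(3) unfolding on_path_def by blast
  then obtain z where z: "z \<in> A" "agle t z b" "nontop r A z"
    using unb_Un[of "{z \<in> A. agle t z b}" "{x \<in> A. \<not> nontop r A x}" "{z \<in> A. agle t z b \<and> nontop r A z}"]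
      tops_bounded A(3) unfolding unb_def by blast
  then show ?thesis using path_cong[OF t(3)] t(2,4) unfolding survives_def by blast
qed

lemma fo_nontop_A: "ft s \<Longrightarrow> fo (\<lambda>v. nontop r A (s v))"
  unfolding nontop_def survives_def
  by (intro fo fod fo_path_A fo_in_A ft_ren[of s "\<lambda>n. Suc (Suc n)"])

lemma fo_survives_A: "ft s \<Longrightarrow> ft t \<Longrightarrow> fo (\<lambda>v. survives r A (s v) (t v))"
  unfolding survives_def
  by (intro fo fod fo_path_A fo_in_A ft_ren[of s Suc] ft_ren[of t Suc])

lemma thin_unbounded: "x \<in> A \<Longrightarrow> \<exists>y \<in> thin r A. (x, y) \<in> r"
proof (rule ccontr)
  assume x: "x \<in> A" and "\<not> (\<exists>y \<in> thin r A. (x, y) \<in> r)"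
  then have le: "\<forall>z \<in> thin r A. z = x \<or> (z, x) \<in> r"
    using iordD(6)[OF A(1)] unfolding thin_def by blast
  have wo: "wo r A" using A(2) unfolding om_def by blast
  have fothin: "fo (\<lambda>v. v 0 \<in> thin r A)"
    by (intro fo iordD(2)[OF A(1)] fo_in_A)
  \<comment> \<open>If points with \<open>P\<close> outlast all nontop points without
    \<open>P\<close>, the first nontop point with \<open>P\<close> beats everything before it and is
    a record. With the trivial \<open>P\<close> this yields a first record, with
    \<open>survives r A m\<close> one that outlasts \<open>m\<close>.\<close>
  have rcd: "\<exists>z \<in> thin r A. P z" if ex: "\<exists>z \<in> A. nontop r A z \<and> P z" and foP: "fo (\<lambda>v. P (v 0))"
    and sv: "\<And>y z. nontop r A y \<Longrightarrow> P z \<Longrightarrow> \<not> P y \<Longrightarrow> survives r A y z" for P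
  proof -
    have "fo (\<lambda>v. nontop r A (v 0) \<and> P (v 0))" by (intro fo foP fo_nontop_A)
    then obtain z where z: "z \<in> A" "nontop r A z \<and> P z" "\<forall>y \<in> A. (y, z) \<in> r \<longrightarrow> \<not> (nontop r A y \<and> P y)"
      using wo_least_filter[OF A(1) wo, of "\<lambda>z. nontop r A z \<and> P z"] ex by blast
    have "z \<in> thin r A" using z sv unfolding thin_def by blast
    then show ?thesis using z(2) by blast
  qed
  obtain z where "z \<in> A" "nontop r A z"
    using tops_bounded A(3) A(2) unfolding unb_def om_def by blast
  then have ne: "thin r A \<noteq> {}" using rcd[of "\<lambda>_. True", OF _ fo_const] by auto
  have "thin r A \<subseteq> A" unfolding thin_def by blast
  then obtain m where m: "m \<in> thin r A" "\<forall>z \<in> thin r A. z \<noteq> m \<longrightarrow> (z, m) \<in> r"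
    using om_below_max[OF A(1,2) _ x le fothin ne] by blast
  have mA: "m \<in> A" "nontop r A m" using m(1) unfolding thin_def by blast+
  have "\<exists>z \<in> thin r A. survives r A m z"
    by (rule rcd[OF _ fo_survives_A[OF ft_const ft_var]])
      (use nontop_survives[OF mA] survives_cotrans in blast)+
  then obtain z where z: "z \<in> thin r A" "survives r A m z" by blast
  have "z \<noteq> m" using z(2) survives_asym by blast
  then have "survives r A z m" using m z unfolding thin_def by blast
  then show False using z(2) survives_asym by blast
qed

lemma thin_Up: "x \<in> thin r A \<Longrightarrow> y \<in> thin r A \<Longrightarrow> z \<in> thin r A \<Longrightarrow> (x, y) \<in> r \<Longrightarrow> (y, z) \<in> r \<Longrightarrow> Up x y z"
  by (rule survives_Up[of r A]) (unfold thin_def, blast+)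

lemma internal_thin: "internal (thin r A)"
  by (rule internal_sep[OF iordD(1)[OF A(1)]]) (unfold thin_def, blast, intro fo fo_in_A fo_nontop_A fo_survives_A fo_drel[OF iordD(2)[OF A(1)]])

end

end

section \<open>Orbits\<close>

context zf_model begin

text \<open>Orbits as intersections of closed sets replace recursion along the natural numbers of the model.\<close>

definition orb :: "('a \<Rightarrow> 'a) \<Rightarrow> 'a \<Rightarrow> 'a set" where
  "orb n a = {u. \<forall>Z. E a Z \<and> (\<forall>z. E z Z \<longrightarrow> E (n z) Z) \<longrightarrow> E u Z}"

context
  fixes n :: "'a \<Rightarrow> 'a" and a :: 'a and U :: "'a set" and lt :: "('a \<times> 'a) set"
  assumes n: "ft (\<lambda>v. n (v 0))" "\<And>u. u \<in> U \<Longrightarrow> n u \<in> U" and U: "internal U" "a \<in> U"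
    and lt: "drel lt" "trans lt" "irrefl lt" "\<And>u. u \<in> U \<Longrightarrow> (u, n u) \<in> lt"
begin

lemma ft_n: assumes "ft t" shows "ft (\<lambda>v. n (t v))"
proof -
  have "fo (\<lambda>v. v (Suc 0) = n (v 0))"
    using fo_ren[OF n(1)[unfolded ft_def], of "\<lambda>n. Suc 0 - n"] by simp
  then show ?thesis
    unfolding ft_def
    using fo_subst[of "\<lambda>v x. v 0 = n x", OF _ ft_ren[OF assms, of Suc]] by simp
qed

lemma fo_orb: "ft t \<Longrightarrow> fo (\<lambda>v. t v \<in> orb n a)"
  unfolding orb_def by (intro fo ft_n ft_ren[of t Suc])

lemma orb_start: "a \<in> orb n a"
  unfolding orb_def by blast

lemma orb_step: "u \<in> orb n a \<Longrightarrow> n u \<in> orb n a"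
  unfolding orb_def by blast

text \<open>Induction is limited to definable \<open>P\<close>: only then do the points with
  \<open>P\<close> form one of the closed sets of the model whose intersection is the orbit.\<close>

lemma orb_induct:
  assumes "u \<in> orb n a" "fo (\<lambda>v. P (v 0))" "P a" "\<And>u. u \<in> orb n a \<Longrightarrow> u \<in> U \<Longrightarrow> P u \<Longrightarrow> P (n u)"
  shows "P u"
proof -
  have "internal {u \<in> U. u \<in> orb n a \<and> P u}"
    by (rule internal_filter[OF U(1)]) (intro fo fo_orb assms(2))
  then obtain Z where Z: "elts E Z = {u \<in> U. u \<in> orb n a \<and> P u}" unfolding internal_def by blast
  then have iff: "E x Z \<longleftrightarrow> x \<in> U \<and> x \<in> orb n a \<and> P x" for x unfolding elts_def by blast
  have "E a Z" unfolding iff using U(2) orb_start assms(3) by simp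
  moreover have "E z Z \<longrightarrow> E (n z) Z" for z
    unfolding iff using n(2) orb_step[of z] assms(4)[of z] by simp
  ultimately have "E u Z" using assms(1) unfolding orb_def by simp
  then show ?thesis unfolding iff by simp
qed

lemma orb_subset: "orb n a \<subseteq> U"
proof
  fix u assume u: "u \<in> orb n a"
  show "u \<in> U"
    by (rule orb_induct[OF u]) (intro fo fo_in_internal U(1), rule U(2), rule n(2))
qed

lemma internal_orb: "internal (orb n a)"
  by (rule internal_sep[OF U(1) orb_subset]) (intro fo_orb fo)

lemma orb_least: "u \<in> orb n a \<Longrightarrow> u = a \<or> (a, u) \<in> lt"
proof (erule orb_induct)
  show "fo (\<lambda>v. v 0 = a \<or> (a, v 0) \<in> lt)" by (intro fo fo_drel lt(1))
  show "n u = a \<or> (a, n u) \<in> lt" if "u \<in> U" "u = a \<or> (a, u) \<in> lt" for u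
    using that lt(2,4) by (metis transD)
qed simp

text \<open>The comparison argument known from the Bourbaki-Witt theorem: every point is comparable
  with \<open>c\<close> provided that no step jumps over \<open>c\<close>. A second induction, in
  \<open>orb_step_le\<close>, shows that no step ever jumps.\<close>

lemma orb_chain_aux:
  assumes "c \<in> orb n a" and c: "\<And>u. u \<in> orb n a \<Longrightarrow> (u, c) \<in> lt \<Longrightarrow> n u = c \<or> (n u, c) \<in> lt"
    and "u \<in> orb n a"
  shows "u = c \<or> (u, c) \<in> lt \<or> n c = u \<or> (n c, u) \<in> lt"
  using assms(3)
proof (rule orb_induct)
  show "fo (\<lambda>v. v 0 = c \<or> (v 0, c) \<in> lt \<or> n c = v 0 \<or> (n c, v 0) \<in> lt)"
    by (intro fo fo_drel lt(1))
  show "a = c \<or> (a, c) \<in> lt \<or> n c = a \<or> (n c, a) \<in> lt" using orb_least[OF assms(1)] by blast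
  show "n u = c \<or> (n u, c) \<in> lt \<or> n c = n u \<or> (n c, n u) \<in> lt"
    if "u \<in> orb n a" "u \<in> U" "u = c \<or> (u, c) \<in> lt \<or> n c = u \<or> (n c, u) \<in> lt" for u
    using that c lt(2,4) by (metis transD)
qed

lemma orb_step_le:
  assumes "c \<in> orb n a" "u \<in> orb n a" "(u, c) \<in> lt" shows "n u = c \<or> (n u, c) \<in> lt"
proof -
  have "\<forall>u \<in> orb n a. (u, c) \<in> lt \<longrightarrow> n u = c \<or> (n u, c) \<in> lt"
    using assms(1)
  proof (rule orb_induct)
    show "fo (\<lambda>v. \<forall>u \<in> orb n a. (u, v 0) \<in> lt \<longrightarrow> n u = v 0 \<or> (n u, v 0) \<in> lt)"
      by (intro fo fo_drel lt(1) fo_orb ft_n)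
    show "\<forall>u \<in> orb n a. (u, a) \<in> lt \<longrightarrow> n u = a \<or> (n u, a) \<in> lt"
      using orb_least lt(2,3) by (metis irrefl_def transD)
  next
    fix c assume c: "c \<in> orb n a" "c \<in> U" "\<forall>u \<in> orb n a. (u, c) \<in> lt \<longrightarrow> n u = c \<or> (n u, c) \<in> lt"
    show "\<forall>u \<in> orb n a. (u, n c) \<in> lt \<longrightarrow> n u = n c \<or> (n u, n c) \<in> lt"
    proof (intro ballI impI)
      fix u assume u: "u \<in> orb n a" "(u, n c) \<in> lt"
      consider "u = c" | "(u, c) \<in> lt" | "n c = u \<or> (n c, u) \<in> lt"
        using orb_chain_aux[OF c(1) _ u(1)] c(3) by blast
      then show "n u = n c \<or> (n u, n c) \<in> lt"
      proof cases
        case 2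
        then show ?thesis using c u lt(2,4) by (metis transD)
      next
        case 3
        then show ?thesis using u lt(2,3) by (metis transD irrefl_def)
      qed simp
    qed
  qed
  then show ?thesis using assms by blast
qed

lemma orb_chain:
  assumes "c \<in> orb n a" "u \<in> orb n a" shows "u = c \<or> (u, c) \<in> lt \<or> (c, u) \<in> lt"
  using orb_chain_aux[OF assms(1) _ assms(2)] orb_step_le[OF assms(1)] lt(2,4) orb_subset assms(1)
  by (metis transD subsetD)

lemma orb_om:
  assumes io: "iord U lt" shows "om lt (orb n a)"
  unfolding om_def
proof (intro conjI ballI)
  have ioO: "iord (orb n a) lt" by (rule iord_subset[OF io orb_subset internal_orb])
  show "wo lt (orb n a)"
  proof (rule woI)
    fix N assume N: "internal N" "N \<subseteq> orb n a" "N \<noteq> {}"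
    show "\<exists>m \<in> N. \<forall>x \<in> N. x \<noteq> m \<longrightarrow> (m, x) \<in> lt"
    proof (rule ccontr)
      assume none: "\<not> (\<exists>m \<in> N. \<forall>x \<in> N. x \<noteq> m \<longrightarrow> (m, x) \<in> lt)"
      \<comment> \<open>Without a minimum, \<open>N\<close> recedes above every orbit point: the
        next point lies weakly below all of \<open>N\<close> and, not being a minimum, outside of
        it. So the elements of \<open>N\<close> would lie below themselves.\<close>
      have "\<forall>z \<in> N. (u, z) \<in> lt" if "u \<in> orb n a" for u
        using that
      proof (rule orb_induct)
        show "fo (\<lambda>v. \<forall>z \<in> N. (v 0, z) \<in> lt)" by (intro fo fo_in_internal N(1) fo_drel lt(1))
        have "a \<notin> N" using none orb_least N(2) by blast
        then show "\<forall>z \<in> N. (a, z) \<in> lt" using orb_least N(2) by blast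
        fix u assume u: "u \<in> orb n a" "u \<in> U" "\<forall>z \<in> N. (u, z) \<in> lt"
        then have *: "n u = z \<or> (n u, z) \<in> lt" if "z \<in> N" for z using orb_step_le that N(2) by blast
        then have "n u \<notin> N" using none by blast
        then show "\<forall>z \<in> N. (n u, z) \<in> lt" using * by blast
      qed
      then show False using N(2,3) iordD(3)[OF io] by blast
    qed
  qed
  show "\<exists>y \<in> orb n a. (x, y) \<in> lt" if "x \<in> orb n a" for x
    using that orb_step lt(4) orb_subset by blast
  show "wo (lt\<inverse>) {z \<in> orb n a. (z, x) \<in> lt}" if "x \<in> orb n a" for x
    using that
  proof (rule orb_induct)
    show "fo (\<lambda>v. wo (lt\<inverse>) {z \<in> orb n a. (z, v 0) \<in> lt})"
      by (intro fo fo_orb fo_drel lt(1) drel_converse[THEN iffD2])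
    have e: "{z \<in> orb n a. (z, a) \<in> lt} = {}" using orb_least iordD(3,5)[OF io] by blast
    show "wo (lt\<inverse>) {z \<in> orb n a. (z, a) \<in> lt}" unfolding e wo_def by blast
  next
    fix u assume u: "u \<in> orb n a" "wo (lt\<inverse>) {z \<in> orb n a. (z, u) \<in> lt}"
    have "{z \<in> orb n a. (z, n u) \<in> lt} \<subseteq> {z \<in> orb n a. (z, u) \<in> lt} \<union> {u}"
      using orb_chain_aux[OF u(1) orb_step_le[OF u(1)]] iordD(3,5)[OF io] by blast
    moreover have "wo (lt\<inverse>) ({z \<in> orb n a. (z, u) \<in> lt} \<union> {u})"
    proof (rule wo_Un[OF iord_converse[OF ioO] _ _ _ u(2)])
      show "fo (\<lambda>v. v 0 \<in> {z \<in> orb n a. (z, u) \<in> lt})" by (intro fo fo_orb fo_drel lt(1))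
      show "fo (\<lambda>v. v 0 \<in> {u})" by (intro fo)
      show "wo (lt\<inverse>) {u}" unfolding wo_def by blast
    qed (use u(1) in blast)
    ultimately show "wo (lt\<inverse>) {z \<in> orb n a. (z, n u) \<in> lt}" by (rule wo_subset[rotated])
  qed
qed

end

end

section \<open>Blocks\<close>

context zf_model begin

definition le :: "('a \<times> 'a) set \<Rightarrow> 'a \<Rightarrow> 'a \<Rightarrow> bool" where
  "le r x y \<longleftrightarrow> x = y \<or> (x, y) \<in> r"

lemma fo_le [fo]: "drel r \<Longrightarrow> ft s \<Longrightarrow> ft t \<Longrightarrow> fo (\<lambda>v. le r (s v) (t v))"
  unfolding le_def by (intro fo fo_drel)

lemma le_refl [simp]: "le r x x"
  unfolding le_def by simp

lemma le_converse [simp]: "le (r\<inverse>) x y = le r y x"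
  unfolding le_def by auto

lemma iord_le:
  assumes "iord A r"
  shows "le r x y \<Longrightarrow> le r y z \<Longrightarrow> le r x z" "(x, y) \<in> r \<Longrightarrow> le r x y"
    "le r x y \<Longrightarrow> (y, z) \<in> r \<Longrightarrow> (x, z) \<in> r" "(x, y) \<in> r \<Longrightarrow> le r y z \<Longrightarrow> (x, z) \<in> r"
    "x \<in> A \<Longrightarrow> y \<in> A \<Longrightarrow> \<not> le r x y \<Longrightarrow> (y, x) \<in> r" "x \<in> A \<Longrightarrow> y \<in> A \<Longrightarrow> (x, y) \<notin> r \<Longrightarrow> le r y x"
    "(x, y) \<in> r \<Longrightarrow> \<not> le r y x" "le r x y \<Longrightarrow> le r y x \<Longrightarrow> x = y"
  using iordD(3-6)[OF assms] unfolding le_def by metis+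

definition seg :: "('a \<times> 'a) set \<Rightarrow> 'a set \<Rightarrow> 'a \<Rightarrow> 'a \<Rightarrow> 'a set" where
  "seg r X x y = {z \<in> X. le r x z \<and> le r z y}"

lemma seg_converse [simp]: "seg (r\<inverse>) X x y = seg r X y x"
  unfolding seg_def by auto

text \<open>A set with \<open>Qs r\<close> witnesses \<open>\<omega>\<^sup>*\<omega>\<close>, and one with \<open>Qs (r\<inverse>)\<close> witnesses \<open>\<omega>\<omega>\<^sup>*\<close>. Unlike an embedding, the
  property passes to nonempty final segments for trivial reasons.\<close>

definition Qs :: "('a \<times> 'a) set \<Rightarrow> 'a set \<Rightarrow> bool" where
  "Qs r Z \<longleftrightarrow> Z \<noteq> {} \<and> (\<forall>z \<in> Z. \<exists>u \<in> Z. (z, u) \<in> r \<and> \<not> wo r {y \<in> Z. (z, y) \<in> r \<and> (y, u) \<in> r})"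

definition hasQ :: "('a \<times> 'a) set \<Rightarrow> 'a set \<Rightarrow> bool" where
  "hasQ r A \<longleftrightarrow> (\<exists>Z. elts E Z \<subseteq> A \<and> Qs r (elts E Z))"

lemma hasQI: "internal Z \<Longrightarrow> Z \<subseteq> A \<Longrightarrow> Qs r Z \<Longrightarrow> hasQ r A"
  unfolding hasQ_def internal_def by blast

lemma hasQ_mono: "hasQ r A \<Longrightarrow> A \<subseteq> B \<Longrightarrow> hasQ r B"
  unfolding hasQ_def by blast

lemma fo_Qs [fo]:
  assumes "drel r" "fo (\<lambda>v. v 0 \<in> A (\<lambda>n. v (Suc n)))" shows "fo (\<lambda>v. Qs r (A v))"
  unfolding Qs_def by (intro fo assms fo_drel fo_ren2[OF assms(2)])

lemma fo_hasQ [fo]: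
  assumes "drel r" "fo (\<lambda>v. v 0 \<in> A (\<lambda>n. v (Suc n)))" shows "fo (\<lambda>v. hasQ r (A v))"
  unfolding hasQ_def by (intro fo assms fo_ren2[OF assms(2)])

lemma wo_singleton: "wo r {x}"
  unfolding wo_def by blast

text \<open>The finite condensation: \<open>cls r X x\<close> is the class of \<open>x\<close>, and \<open>infc\<close> says that the class is infinite.\<close>

definition btw :: "('a \<times> 'a) set \<Rightarrow> 'a set \<Rightarrow> 'a \<Rightarrow> 'a \<Rightarrow> 'a set" where
  "btw r X x y = {z \<in> X. le r x z \<and> le r z y \<or> le r y z \<and> le r z x}"

definition fin :: "('a \<times> 'a) set \<Rightarrow> 'a set \<Rightarrow> 'a \<Rightarrow> 'a \<Rightarrow> bool" where
  "fin r X x y \<longleftrightarrow> wo r (btw r X x y) \<and> wo (r\<inverse>) (btw r X x y)"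

definition cls :: "('a \<times> 'a) set \<Rightarrow> 'a set \<Rightarrow> 'a \<Rightarrow> 'a set" where
  "cls r X x = {y \<in> X. fin r X x y}"

definition infc :: "('a \<times> 'a) set \<Rightarrow> 'a set \<Rightarrow> 'a \<Rightarrow> bool" where
  "infc r X x \<longleftrightarrow> (\<forall>z \<in> cls r X x. \<exists>y \<in> cls r X x. (y, z) \<in> r) \<or> (\<forall>z \<in> cls r X x. \<exists>y \<in> cls r X x. (z, y) \<in> r)"

lemma fin_converse [simp]: "fin (r\<inverse>) X x y = fin r X x y"
  unfolding fin_def btw_def by (simp add: conj_commute disj_commute)

lemma cls_converse [simp]: "cls (r\<inverse>) X x = cls r X x"
  unfolding cls_def by simp

lemma infc_converse [simp]: "infc (r\<inverse>) X x = infc r X x"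
  unfolding infc_def by (auto simp: disj_commute)

end

text \<open>Here \<open>H\<close> stands for the homogeneous set. The well-order \<open>w\<close>
  has nothing to do with the order \<open>r\<close>; it selects representatives and centres
  definably. The traces on \<open>D\<close> given by \<open>bit\<close> separate the points of
  \<open>H\<close>.\<close>

locale lin = branching E D od bit for E :: "'a \<Rightarrow> 'a \<Rightarrow> bool" and D od bit +
  fixes H :: "'a set" and r w :: "('a \<times> 'a) set"
  assumes H: "iord H r" and w: "iord H w" "wo w H"
    and inj: "\<And>x y. x \<in> H \<Longrightarrow> y \<in> H \<Longrightarrow> x \<noteq> y \<Longrightarrow> \<exists>b \<in> D. ((b, x) \<in> bit) \<noteq> ((b, y) \<in> bit)"
begin

lemma dr: "drel r" "drel (r\<inverse>)" "drel w"
  using iordD(2)[OF H] iordD(2)[OF w(1)] by simp_all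

lemmas fiH = dr fo_in_internal[OF iordD(1)[OF H]] fo_drel[OF dr(1)] fo_drel[OF dr(3)]

lemmas rD = iordD(3-6)[OF H] iord_le[OF H]

lemma fo_seg [fo]: "ft s \<Longrightarrow> ft t \<Longrightarrow> ft u \<Longrightarrow> fo (\<lambda>v. s v \<in> seg r H (t v) (u v))"
  unfolding seg_def by (intro fo fiH)

end

text \<open>Reversing \<open>r\<close> affects neither \<open>w\<close> nor the traces on
  \<open>D\<close>. Mirror images of results are obtained by instantiating them with this
  fact.\<close>

lemma (in lin) lin_converse: "lin E D od bit H (r\<inverse>) w"
  by unfold_locales (use iord_converse[OF H] w inj in blast)+

text \<open>A convex set that contains a witness of \<open>\<omega>\<^sup>*\<omega>\<close> although none of its bounded parts contains a witness
  of \<open>\<omega>\<^sup>*\<omega>\<close> or \<open>\<omega>\<omega>\<^sup>*\<close>. It has cofinality \<open>\<omega>\<close>: each interval from \<open>x\<close> to \<open>nx x\<close> is a well-order \<open>Aw x\<close> followed by a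
  reverse well-order \<open>Dn x\<close> without minimum, and the orbit of \<open>nx\<close> is cofinal.\<close>

locale block = lin E D od bit H r w for E :: "'a \<Rightarrow> 'a \<Rightarrow> bool" and D od bit H r w +
  fixes K :: "'a set"
  assumes K: "K \<subseteq> H" "internal K" "K \<noteq> {}" and Kconv: "\<And>x y. x \<in> K \<Longrightarrow> y \<in> K \<Longrightarrow> seg r H x y \<subseteq> K"
    and noQ: "\<And>x y. x \<in> K \<Longrightarrow> y \<in> K \<Longrightarrow> \<not> hasQ r (seg r H x y)"
      "\<And>x y. x \<in> K \<Longrightarrow> y \<in> K \<Longrightarrow> \<not> hasQ (r\<inverse>) (seg r H x y)"
    and unwo: "\<And>x. x \<in> K \<Longrightarrow> \<exists>y \<in> K. le r x y \<and> \<not> wo r (seg r H x y)"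
begin

definition Aw :: "'a \<Rightarrow> 'a set" where "Aw x = {z \<in> K. le r x z \<and> wo r (seg r H x z)}"
definition Er :: "'a \<Rightarrow> 'a set" where "Er x = {z \<in> K. le r x z \<and> \<not> wo r (seg r H x z)}"
definition Bn :: "'a \<Rightarrow> 'a set" where "Bn x = {z \<in> Er x. wo (r\<inverse>) {y \<in> Er x. le r y z}}"
text \<open>Any point of \<open>Bn x\<close> would serve as the end of the piece that begins at
  \<open>x\<close>. Taking the \<open>w\<close>-least one makes \<open>nx\<close> a definable
  function, which can then be iterated.\<close>

definition nx :: "'a \<Rightarrow> 'a" where "nx x = the1 (\<lambda>z. z \<in> Bn x \<and> (\<forall>y \<in> Bn x. y \<noteq> z \<longrightarrow> (z, y) \<in> w))"
definition Dn :: "'a \<Rightarrow> 'a set" where "Dn x = {y \<in> Er x. (y, nx x) \<in> r}"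

lemma foK: "ft s \<Longrightarrow> fo (\<lambda>v. s v \<in> K)"
  by (rule fo_in_internal[OF K(2)])

lemma fo_Aw [fo]: "ft s \<Longrightarrow> ft t \<Longrightarrow> fo (\<lambda>v. s v \<in> Aw (t v))"
  by (rule fo_rel2[where R = "\<lambda>x y. x \<in> Aw y"]) (unfold Aw_def, intro fo fiH foK)

lemma fo_Er [fo]: "ft s \<Longrightarrow> ft t \<Longrightarrow> fo (\<lambda>v. s v \<in> Er (t v))"
  by (rule fo_rel2[where R = "\<lambda>x y. x \<in> Er y"]) (unfold Er_def, intro fo fiH foK)

lemma fo_Bn [fo]: "ft s \<Longrightarrow> ft t \<Longrightarrow> fo (\<lambda>v. s v \<in> Bn (t v))"
  by (rule fo_rel2[where R = "\<lambda>x y. x \<in> Bn y"]) (unfold Bn_def, intro fo fiH)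

lemma ft_nx0: "ft (\<lambda>v. nx (v 0))"
  unfolding nx_def by (intro fo fiH)

lemma fo_Dn [fo]: "ft s \<Longrightarrow> ft t \<Longrightarrow> fo (\<lambda>v. s v \<in> Dn (t v))"
  by (rule fo_rel2[where R = "\<lambda>x y. x \<in> Dn y"]) (unfold Dn_def nx_def, intro fo fiH)

lemma KH: "x \<in> K \<Longrightarrow> x \<in> H" using K(1) by blast

lemma sub: "Aw x \<subseteq> K" "Er x \<subseteq> K" "Bn x \<subseteq> Er x" "Dn x \<subseteq> Er x"
  unfolding Aw_def Er_def Bn_def Dn_def by auto

lemma parts_K: "y \<in> Aw x \<Longrightarrow> y \<in> K" "y \<in> Er x \<Longrightarrow> y \<in> K" "y \<in> Bn x \<Longrightarrow> y \<in> K" "y \<in> Dn x \<Longrightarrow> y \<in> K"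
  unfolding Aw_def Er_def Bn_def Dn_def by auto

lemmas parts_H = parts_K[THEN KH]

lemma internal_parts: "internal (Aw x)" "internal (Er x)" "internal (Bn x)" "internal (Dn x)"
  by (rule internal_sep[OF K(2)], use sub in blast, intro fo)+

lemma Aw_wo: "wo r (Aw x)"
proof (rule woI)
  fix N assume N: "internal N" "N \<subseteq> Aw x" "N \<noteq> {}"
  then obtain z where z: "z \<in> N" by blast
  let ?N = "{y \<in> N. le r y z}"
  have "wo r (seg r H x z)" using z N(2) unfolding Aw_def by blast
  moreover have "internal ?N" by (rule internal_filter[OF N(1)]) (intro fo fiH)
  moreover have "?N \<subseteq> seg r H x z" using N(2) K(1) unfolding seg_def Aw_def by blast
  moreover have "?N \<noteq> {}" using z by auto
  ultimately obtain m where m: "m \<in> ?N" "\<forall>y \<in> ?N. y \<noteq> m \<longrightarrow> (m, y) \<in> r" using wo_min by blast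
  have "(m, y) \<in> r" if y: "y \<in> N" "y \<noteq> m" for y
  proof (cases "le r y z")
    case False
    then have "(z, y) \<in> r" using rD(9) y(1) z N(2) sub(1) KH by blast
    then show ?thesis using rD(7)[OF _ \<open>(z, y) \<in> r\<close>] m(1) by blast
  qed (use m(2) y in blast)
  then show "\<exists>m \<in> N. \<forall>y \<in> N. y \<noteq> m \<longrightarrow> (m, y) \<in> r" using m(1) by blast
qed

lemma Aw_less_Er: assumes "z \<in> Aw x" "e \<in> Er x" shows "(z, e) \<in> r"
proof (rule ccontr)
  assume "(z, e) \<notin> r"
  moreover have "z \<in> H" "e \<in> H" using assms sub KH by blast+
  ultimately have "le r e z" by (rule rD(10)[rotated 2])
  then have "seg r H x e \<subseteq> seg r H x z" unfolding seg_def using rD(5)[OF _ \<open>le r e z\<close>] by blast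
  then have "wo r (seg r H x e)" using assms(1) wo_subset[of r "seg r H x z"] unfolding Aw_def by blast
  then show False using assms(2) unfolding Er_def by blast
qed

lemma Aw_Er: "x \<in> K \<Longrightarrow> z \<in> K \<Longrightarrow> le r x z \<Longrightarrow> z \<in> Aw x \<or> z \<in> Er x"
  unfolding Aw_def Er_def by blast

lemma Aw_self: "x \<in> K \<Longrightarrow> x \<in> Aw x"
proof -
  assume x: "x \<in> K"
  have "seg r H x x \<subseteq> {x}" unfolding seg_def using rD(12) by blast
  then have "wo r (seg r H x x)" by (rule wo_subset[OF wo_singleton])
  then show "x \<in> Aw x" using x unfolding Aw_def by simp
qed

text \<open>Up to a minimum \<open>e\<close> there would be only \<open>Aw x\<close> and the point
  \<open>e\<close>, and this union is well-ordered, contrary to the definition of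
  \<open>Er x\<close>.\<close>

lemma Er_no_min: assumes "x \<in> K" "e \<in> Er x" shows "\<exists>e' \<in> Er x. (e', e) \<in> r"
proof (rule ccontr)
  assume neg: "\<not> (\<exists>e' \<in> Er x. (e', e) \<in> r)"
  have eK: "e \<in> K" using assms sub by blast
  have "seg r H x e \<subseteq> Aw x \<union> {e}"
  proof
    fix z assume z: "z \<in> seg r H x e"
    then have "z \<in> K" using Kconv assms(1) eK by blast
    then show "z \<in> Aw x \<union> {e}" using z Aw_Er[OF assms(1)] neg unfolding seg_def le_def by blast
  qed
  moreover have "wo r (Aw x \<union> {e})"
  proof (rule wo_Un[OF H])
    show "Aw x \<union> {e} \<subseteq> H" using sub(1) K(1) eK by blast
    show "fo (\<lambda>v. v 0 \<in> Aw x)" "fo (\<lambda>v. v 0 \<in> {e})" by (intro fo)+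
  qed (rule Aw_wo, rule wo_singleton)
  ultimately have "wo r (seg r H x e)" by (rule wo_subset[rotated])
  then show False using assms(2) unfolding Er_def by blast
qed

lemma not_wo_no_min:
  assumes "internal N" "N \<noteq> {}" "\<And>x. x \<in> N \<Longrightarrow> \<exists>y \<in> N. (y, x) \<in> r" "N \<subseteq> M"
  shows "\<not> wo r M"
proof
  assume "wo r M"
  then obtain m where m: "m \<in> N" "\<forall>x \<in> N. x \<noteq> m \<longrightarrow> (m, x) \<in> r" using wo_min assms by blast
  obtain y where "y \<in> N" "(y, m) \<in> r" using assms(3) m(1) by blast
  then show False using m(2) rD(1,3) by metis
qed

text \<open>If no initial part of \<open>Er x\<close> were reverse well-ordered, every initial part
  would contain a set without maximum. As \<open>Er x\<close> has no minimum, such sets occur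
  arbitrarily far down, and the part of \<open>Er x\<close> below \<open>y\<close> would be a
  bounded witness of \<open>\<omega>\<omega>\<^sup>*\<close>.\<close>

lemma Bn_nonempty: assumes x: "x \<in> K" shows "Bn x \<noteq> {}"
proof
  assume empty: "Bn x = {}"
  obtain y where y: "y \<in> Er x" using unwo[OF x] unfolding Er_def by blast
  let ?Z = "{z \<in> Er x. le r z y}"
  have "Qs (r\<inverse>) ?Z"
    unfolding Qs_def
  proof (intro conjI ballI)
    show "?Z \<noteq> {}" using y le_refl by blast
    fix z assume z: "z \<in> ?Z"
    then obtain z1 where z1: "z1 \<in> Er x" "(z1, z) \<in> r" using Er_no_min[OF x] by blast
    then have "\<not> wo (r\<inverse>) {y \<in> Er x. le r y z1}" using empty unfolding Bn_def by blast
    then obtain N where N: "elts E N \<subseteq> {y \<in> Er x. le r y z1}" "elts E N \<noteq> {}"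
      "\<not> (\<exists>m \<in> elts E N. \<forall>x \<in> elts E N. x \<noteq> m \<longrightarrow> (m, x) \<in> r\<inverse>)"
      unfolding wo_def by blast
    obtain u where u: "u \<in> elts E N" using N(2) by blast
    have le1: "y \<in> Er x" "le r y z1" if "y \<in> elts E N" for y using N(1) that by blast+
    have nomax: "\<exists>y \<in> elts E N. (m, y) \<in> r" if m: "m \<in> elts E N" for m
    proof -
      obtain y where y: "y \<in> elts E N" "y \<noteq> m" "(y, m) \<notin> r" using N(3) m by blast
      have "y \<in> H" "m \<in> H" using parts_H(2)[OF le1(1)] m y(1) by simp_all
      then show ?thesis using rD(4) y by blast
    qed
    have "le r z1 z" using z1(2) by (rule rD(6))
    moreover have "le r z y" using z by simp
    ultimately have "le r z1 y" by (rule rD(5))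
    then have uz: "u \<in> ?Z" "(u, z) \<in> r" "u \<in> Er x"
      using le1[OF u] rD(7)[OF _ z1(2)] rD(5)[OF _ \<open>le r z1 y\<close>] by simp_all
    \<comment> \<open>The point \<open>u\<close> of \<open>N\<close> ends the interval that is to be
      shown bad. The elements of \<open>N\<close> above \<open>u\<close> lie inside this interval
      and still have no maximum.\<close>
    let ?N = "{y \<in> elts E N. (u, y) \<in> r}"
    let ?M = "{y \<in> ?Z. (z, y) \<in> r\<inverse> \<and> (y, u) \<in> r\<inverse>}"
    have iN: "internal ?N" by (rule internal_filter[OF internal_elts]) (intro fo fiH)
    have "?N \<subseteq> {y \<in> ?Z. (y, z) \<in> r \<and> (u, y) \<in> r}"
      using le1 rD(7)[OF _ z1(2)] rD(5)[OF _ \<open>le r z1 y\<close>] by simp blast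
    then have NM: "?N \<subseteq> ?M" by simp
    have "\<not> wo (r\<inverse>) ?M"
    proof
      assume "wo (r\<inverse>) ?M"
      moreover have "?N \<noteq> {}" using nomax[OF u] by blast
      ultimately obtain m where m: "m \<in> ?N" "\<forall>x \<in> ?N. x \<noteq> m \<longrightarrow> (m, x) \<in> r\<inverse>"
        using wo_min[OF _ iN NM] by meson
      then obtain y where y: "y \<in> elts E N" "(m, y) \<in> r" using nomax by blast
      then have "(u, y) \<in> r" using m(1) rD(2)[OF _ y(2)] by blast
      then have "y \<in> ?N" using y(1) by blast
      moreover have "y \<noteq> m" using y(2) rD(1) by blast
      ultimately have "(y, m) \<in> r" using m(2) by blast
      then show False using y(2) rD(3) by blast
    qed
    moreover have "(z, u) \<in> r\<inverse>" using uz(2) by simp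
    ultimately show "\<exists>u \<in> ?Z. (z, u) \<in> r\<inverse> \<and> \<not> wo (r\<inverse>) {y \<in> ?Z. (z, y) \<in> r\<inverse> \<and> (y, u) \<in> r\<inverse>}"
      using uz(1) by blast
  qed
  moreover have "internal ?Z" by (rule internal_filter[OF internal_parts(2)]) (intro fo fiH)
  moreover have "?Z \<subseteq> seg r H x y" using sub KH unfolding seg_def Er_def by blast
  moreover have "y \<in> K" using y sub by blast
  ultimately show False using noQ(2)[OF x, of y] hasQI[of ?Z "seg r H x y" "r\<inverse>"] by simp
qed

lemma nx: assumes "x \<in> K" shows "nx x \<in> Bn x"
proof -
  have 1: "Bn x \<subseteq> H" using parts_H(3) by (rule subsetI)
  have 2: "fo (\<lambda>v. v 0 \<in> Bn x)" by (intro fo)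
  obtain m where m: "m \<in> Bn x" "\<forall>y \<in> Bn x. y \<noteq> m \<longrightarrow> (m, y) \<in> w"
    using wo_least[OF w 1 2 Bn_nonempty[OF assms]] by blast
  have "nx x = m" unfolding nx_def
  proof (rule the1_eq)
    fix y assume y: "y \<in> Bn x \<and> (\<forall>z \<in> Bn x. z \<noteq> y \<longrightarrow> (y, z) \<in> w)"
    show "y = m"
    proof (rule ccontr)
      assume "y \<noteq> m"
      then have "(m, y) \<in> w" "(y, m) \<in> w" using y m by metis+
      then show False using iordD(5)[OF w(1)] by blast
    qed
  qed (use m in blast)
  then show ?thesis using m(1) by simp
qed

lemma nx_Er: "x \<in> K \<Longrightarrow> nx x \<in> Er x"
  using nx sub(3) by blast

lemma nxK: "x \<in> K \<Longrightarrow> nx x \<in> K"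
  by (rule parts_K(2)[OF nx_Er])

lemma nx_less: "x \<in> K \<Longrightarrow> (x, nx x) \<in> r"
  by (rule Aw_less_Er[OF Aw_self nx_Er])

lemma Dn_no_min: "x \<in> K \<Longrightarrow> y \<in> Dn x \<Longrightarrow> \<exists>z \<in> Dn x. (z, y) \<in> r"
  using Er_no_min[of x y] rD(2)[of _ y "nx x"] unfolding Dn_def by blast

lemma Dn_nonempty: "x \<in> K \<Longrightarrow> Dn x \<noteq> {}"
  using Er_no_min[OF _ nx_Er, of x] unfolding Dn_def by blast

lemma Dn_rwo: assumes "x \<in> K" shows "wo (r\<inverse>) (Dn x)"
proof -
  have "wo (r\<inverse>) {y \<in> Er x. le r y (nx x)}" using nx[OF assms] unfolding Bn_def by blast
  then show ?thesis by (rule wo_subset) (auto simp: Dn_def le_def)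
qed

lemma Dn_greater: "x \<in> K \<Longrightarrow> y \<in> Dn x \<Longrightarrow> (x, y) \<in> r"
  by (rule Aw_less_Er[OF Aw_self]) (use sub(4) in blast)+

lemma Aw_less_nx: "x \<in> K \<Longrightarrow> y \<in> Aw x \<Longrightarrow> (y, nx x) \<in> r"
  by (rule Aw_less_Er[OF _ nx_Er])

lemma Aw_less_Dn: "y \<in> Aw x \<Longrightarrow> z \<in> Dn x \<Longrightarrow> (y, z) \<in> r"
  by (rule Aw_less_Er) (use sub(4) in blast)+

lemma Dn_less_nx: "y \<in> Dn x \<Longrightarrow> (y, nx x) \<in> r"
  unfolding Dn_def by blast

lemma parts: "x \<in> K \<Longrightarrow> z \<in> K \<Longrightarrow> le r x z \<Longrightarrow> (z, nx x) \<in> r \<Longrightarrow> z \<in> Aw x \<or> z \<in> Dn x"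
  using Aw_Er unfolding Dn_def by blast

end

lemma (in zf_model) iord_max:
  "iord A r \<Longrightarrow> x \<in> A \<Longrightarrow> y \<in> A \<Longrightarrow> \<exists>z \<in> A. (z = x \<or> z = y) \<and> le r x z \<and> le r y z"
  using iord_le(5,2)[of A r] le_refl by metis

section \<open>Iterating \<open>nx\<close>: cofinality and recurrence of the pieces\<close>

locale block_orbit = block E D od bit H r w K
  for E :: "'a \<Rightarrow> 'a \<Rightarrow> bool" and D od bit H r w K +
  fixes x0 :: 'a
  assumes x0: "x0 \<in> K"
begin

abbreviation "I \<equiv> orb nx x0"

lemma orbit_facts:
  shows I_start: "x0 \<in> I" and I_step: "\<And>i. i \<in> I \<Longrightarrow> nx i \<in> I" and I_K: "\<And>i. i \<in> I \<Longrightarrow> i \<in> K"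
    and I_least: "\<And>i. i \<in> I \<Longrightarrow> le r x0 i"
    and I_chain: "\<And>i j. i \<in> I \<Longrightarrow> j \<in> I \<Longrightarrow> (i, j) \<in> r \<Longrightarrow> le r (nx i) j"
    and I_internal: "internal I" and I_om: "om r I"
    and I_induct: "\<And>u P. u \<in> I \<Longrightarrow> fo (\<lambda>v. P (v 0)) \<Longrightarrow> P x0 \<Longrightarrow> (\<And>u. u \<in> I \<Longrightarrow> u \<in> K \<Longrightarrow> P u \<Longrightarrow> P (nx u)) \<Longrightarrow> P u"
    and fo_I: "\<And>t. ft t \<Longrightarrow> fo (\<lambda>v. t v \<in> I)"
    and ft_nx: "\<And>t. ft t \<Longrightarrow> ft (\<lambda>v. nx (t v))"
proof -
  have tr: "trans r" "irrefl r" using H unfolding iord_def strict_linear_order_on_def by blast+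
  note a = ft_nx0 nxK K(2) x0 dr(1) tr nx_less
  show "x0 \<in> I" by (rule orb_start[where lt = r, OF a])
  show "nx i \<in> I" if "i \<in> I" for i by (rule orb_step[where lt = r, OF a that])
  show "i \<in> K" if "i \<in> I" for i using orb_subset[where lt = r, OF a] that by (rule subsetD)
  show "le r x0 i" if "i \<in> I" for i using orb_least[where lt = r, OF a that] unfolding le_def by metis
  show "le r (nx i) j" if "i \<in> I" "j \<in> I" "(i, j) \<in> r" for i j
    using orb_step_le[where lt = r, OF a that(2,1,3)] unfolding le_def .
  show "internal I" by (rule internal_orb[where lt = r, OF a])
  show "om r I" by (rule orb_om[where lt = r, OF a iord_subset[OF H K(1,2)]])
  show "P u" if "u \<in> I" "fo (\<lambda>v. P (v 0))" "P x0" "\<And>u. u \<in> I \<Longrightarrow> u \<in> K \<Longrightarrow> P u \<Longrightarrow> P (nx u)" for u P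
    by (rule orb_induct[where lt = r, OF a that])
  show "fo (\<lambda>v. t v \<in> I)" if "ft t" for t by (rule fo_orb[where lt = r, OF a that])
  show "ft (\<lambda>v. nx (t v))" if "ft t" for t by (rule ft_n[where lt = r, OF a that])
qed

lemma I_H: "i \<in> I \<Longrightarrow> i \<in> H" by (rule KH[OF I_K])

lemma I_iord: "iord I r"
  by (rule iord_subset[OF H _ I_internal]) (rule subsetI, rule I_H)

lemma I_nx_less: "i \<in> I \<Longrightarrow> (i, nx i) \<in> r" by (rule nx_less[OF I_K])

text \<open>Each step of the orbit passes a set \<open>Dn\<close> without minimum. So the points
  below the orbit are a witness of \<open>\<omega>\<^sup>*\<omega>\<close>, which would be bounded
  if \<open>y\<close> bounded the orbit.\<close>

lemma I_cofinal: assumes y: "y \<in> K" shows "\<exists>i \<in> I. (y, i) \<in> r"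
proof (rule ccontr)
  assume "\<not> (\<exists>i \<in> I. (y, i) \<in> r)"
  then have bound: "le r i y" if "i \<in> I" for i using rD(10)[OF KH[OF y] I_H[OF that]] that by metis
  let ?Z = "{z \<in> K. le r x0 z \<and> (\<exists>i \<in> I. le r z i)}"
  have "Qs r ?Z"
    unfolding Qs_def
  proof (intro conjI ballI)
    have "x0 \<in> ?Z" using x0 bexI[of "le r x0" x0, OF le_refl I_start] by simp
    then show "?Z \<noteq> {}" by (metis empty_iff)
    fix z assume "z \<in> ?Z"
    then obtain i where z: "z \<in> K" "le r x0 z" "i \<in> I" "le r z i" by simp metis
    \<comment> \<open>Two steps are taken because \<open>z\<close> may lie inside the piece ending
      at \<open>nx i\<close>. The set \<open>Dn\<close> of the following piece is entirely above
      \<open>z\<close>.\<close>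
    let ?i = "nx i" let ?j = "nx (nx i)"
    have iI: "?i \<in> I" "?j \<in> I" using I_step z(3) by simp_all
    have iK: "?i \<in> K" "?j \<in> K" using iI I_K by simp_all
    have zi: "(z, ?i) \<in> r" by (rule rD(7)[OF z(4) I_nx_less[OF z(3)]])
    have zj: "(z, ?j) \<in> r" by (rule rD(2)[OF zi I_nx_less[OF iI(1)]])
    have sub: "Dn ?i \<subseteq> {y \<in> ?Z. (z, y) \<in> r \<and> (y, ?j) \<in> r}"
    proof
      fix y assume y: "y \<in> Dn ?i"
      have 1: "(?i, y) \<in> r" by (rule Dn_greater[OF iK(1) y])
      have 2: "(y, ?j) \<in> r" by (rule Dn_less_nx[OF y])
      have 3: "(z, y) \<in> r" by (rule rD(2)[OF zi 1])
      have 4: "le r x0 y" by (rule rD(6)[OF rD(7)[OF z(2) 3]])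
      show "y \<in> {y \<in> ?Z. (z, y) \<in> r \<and> (y, ?j) \<in> r}"
        using 2 3 4 parts_K(4)[OF y] iI(2) rD(6)[OF 2] by auto
    qed
    have "\<not> wo r {y \<in> ?Z. (z, y) \<in> r \<and> (y, ?j) \<in> r}"
      by (rule not_wo_no_min[OF internal_parts(4) Dn_nonempty[OF iK(1)] Dn_no_min[OF iK(1)] sub])
    moreover have "?j \<in> ?Z" using iK(2) I_least[OF iI(2)] bexI[of "le r ?j" ?j, OF le_refl iI(2)] by simp
    ultimately show "\<exists>u \<in> ?Z. (z, u) \<in> r \<and> \<not> wo r {y \<in> ?Z. (z, y) \<in> r \<and> (y, u) \<in> r}"
      using zj by (intro bexI[of _ ?j] conjI)
  qed
  moreover have "internal ?Z" by (rule internal_filter[OF K(2)]) (intro fo fiH fo_I)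
  moreover have "?Z \<subseteq> seg r H x0 y"
  proof
    fix z assume "z \<in> ?Z"
    then obtain i where "z \<in> K" "le r x0 z" "i \<in> I" "le r z i" by simp metis
    then show "z \<in> seg r H x0 y" using rD(5)[OF _ bound] KH unfolding seg_def by simp
  qed
  ultimately show False using noQ(1)[OF x0 y] hasQI by metis
qed

lemma I_index: assumes z: "z \<in> K" "le r x0 z" shows "\<exists>i \<in> I. le r i z \<and> (z, nx i) \<in> r"
proof -
  obtain j where j: "j \<in> I" "(z, j) \<in> r" using I_cofinal[OF z(1)] by metis
  let ?N = "{i \<in> I. le r i z}"
  have 1: "?N \<subseteq> I" by (rule Collect_restrict)
  have 2: "\<forall>i \<in> ?N. i = j \<or> (i, j) \<in> r" using rD(7)[OF _ j(2)] by simp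
  have 3: "fo (\<lambda>v. v 0 \<in> ?N)" by (intro fo fiH fo_I)
  have "x0 \<in> ?N" using z(2) I_start by simp
  then have 4: "?N \<noteq> {}" by (metis empty_iff)
  obtain i where i: "i \<in> ?N" "\<forall>k \<in> ?N. k \<noteq> i \<longrightarrow> (k, i) \<in> r"
    using om_below_max[OF I_iord I_om 1 j(1) 2 3 4] by (elim bexE)
  have iI: "i \<in> I" "le r i z" using i(1) by simp_all
  have "(z, nx i) \<in> r"
  proof (rule ccontr)
    assume "(z, nx i) \<notin> r"
    then have "le r (nx i) z" by (rule rD(10)[OF KH[OF z(1)] I_H[OF I_step[OF iI(1)]]])
    then have "nx i \<in> ?N" using I_step[OF iI(1)] by simp
    then show False using i(2) I_nx_less[OF iI(1)] rD(1,3) by metis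
  qed
  then show ?thesis using iI by metis
qed

text \<open>The well-ordered part is matched with an initial segment and the reverse well-ordered
  part with a final segment, so the piece \<open>i\<close> embeds in the piece \<open>j\<close> part
  by part.\<close>

definition fits :: "'a \<Rightarrow> 'a \<Rightarrow> bool" where
  "fits i j \<longleftrightarrow> leq (Aw i) r (Aw j) \<and> leq (Dn i) (r\<inverse>) (Dn j)"

lemma fo_fits: "ft s \<Longrightarrow> ft t \<Longrightarrow> fo (\<lambda>v. fits (s v) (t v))"
  by (rule fo_rel2[where R = fits]) (unfold fits_def, intro fo fiH)

lemma I_unbounded: "i \<in> I \<Longrightarrow> j \<in> I \<Longrightarrow> \<exists>k \<in> I. (i, k) \<in> r \<and> (j, k) \<in> r"
  using iord_max[OF I_iord, of i j] I_step I_nx_less rD(7) by metis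

text \<open>Ordinals cannot decrease forever. So from some index on, every pair \<open>Aw i\<close>, \<open>Dn i\<close> embeds in
  unboundedly many later pairs.\<close>

lemma recurrent: "\<exists>b \<in> I. \<forall>i \<in> I. (b, i) \<in> r \<longrightarrow> (\<forall>c \<in> I. \<exists>j \<in> I. (c, j) \<in> r \<and> fits i j)"
proof (rule ccontr)
  \<comment> \<open>The bad indices, which fit only boundedly many others. They are assumed to be
    unbounded.\<close>
  define Bd where "Bd = {i \<in> I. \<exists>c \<in> I. \<forall>j \<in> I. (c, j) \<in> r \<longrightarrow> \<not> fits i j}"
  assume "\<not> ?thesis"
  then have unb: "\<exists>i \<in> Bd. (b, i) \<in> r" if "b \<in> I" for b using that unfolding Bd_def by blast
  have foBd: "ft s \<Longrightarrow> fo (\<lambda>v. s v \<in> Bd)" for s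
    by (rule fo_subst[where P = "\<lambda>v x. x \<in> Bd"]) (unfold Bd_def, intro fo fiH fo_I fo_fits)
  have BdI: "i \<in> I" if "i \<in> Bd" for i using that unfolding Bd_def by simp
  \<comment> \<open>The bad indices whose well-ordered part is shortest among all later bad ones.
    They are still unbounded, and a member of \<open>S\<close> with shortest \<open>Dn\<close> fits
    every later member of \<open>S\<close>, although it is bad.\<close>
  define S where "S = {i \<in> Bd. \<forall>j \<in> Bd. (i, j) \<in> r \<longrightarrow> leq (Aw i) r (Aw j)}"
  have foS: "fo (\<lambda>v. v 0 \<in> S)" unfolding S_def by (intro fo fiH foBd)
  have SBd: "i \<in> Bd" if "i \<in> S" for i using that unfolding S_def by simp
  have A: "Aw i \<subseteq> H \<and> wo r (Aw i)" for i using parts_H(1) Aw_wo by blast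
  have D: "Dn i \<subseteq> H \<and> wo (r\<inverse>) (Dn i)" if "i \<in> S" for i
    using parts_H(4) Dn_rwo[OF I_K[OF BdI[OF SBd[OF that]]]] by blast
  have Sunb: "\<exists>i \<in> S. (b, i) \<in> r" if b: "b \<in> I" for b
  proof -
    let ?N = "{i \<in> Bd. (b, i) \<in> r}"
    have ne: "?N \<noteq> {}" using unb[OF b] by auto
    have foN: "fo (\<lambda>v. v 0 \<in> ?N)" by (intro fo fiH foBd)
    have foA: "fo (\<lambda>v. v 0 \<in> Aw (v (Suc 0)))" by (intro fo)
    obtain i where i: "i \<in> ?N" "\<forall>j \<in> ?N. leq (Aw i) r (Aw j)"
      using leq_min[of H r ?N Aw, OF H A foA foN ne] by (elim bexE)
    have "leq (Aw i) r (Aw j)" if "j \<in> Bd" "(i, j) \<in> r" for j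
    proof -
      have "(b, j) \<in> r" using rD(2)[OF _ that(2)] i(1) by simp
      then show ?thesis using i(2) that(1) by simp
    qed
    then have "i \<in> S" using i(1) unfolding S_def by simp
    then show ?thesis using i(1) by auto
  qed
  have ne: "S \<noteq> {}" using Sunb[OF I_start] by auto
  have foD: "fo (\<lambda>v. v 0 \<in> Dn (v (Suc 0)))" by (intro fo)
  have "\<exists>i \<in> S. \<forall>j \<in> S. leq (Dn i) (r\<inverse>) (Dn j)"
    by (rule leq_min[OF iord_converse[OF H] D foD foS ne])
  then obtain i where i: "i \<in> S" "\<forall>j \<in> S. leq (Dn i) (r\<inverse>) (Dn j)" by (elim bexE)
  obtain c where c: "c \<in> I" "\<forall>j \<in> I. (c, j) \<in> r \<longrightarrow> \<not> fits i j"
    using SBd[OF i(1)] unfolding Bd_def by auto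
  obtain k where k: "k \<in> I" "(c, k) \<in> r" "(i, k) \<in> r"
    using I_unbounded[OF c(1) BdI[OF SBd[OF i(1)]]] by metis
  obtain j where j: "j \<in> S" "(k, j) \<in> r" using Sunb[OF k(1)] by metis
  have "(i, j) \<in> r" "(c, j) \<in> r" using rD(2)[OF k(3) j(2)] rD(2)[OF k(2) j(2)] by simp_all
  moreover have "leq (Aw i) r (Aw j)" using i(1) SBd[OF j(1)] calculation(1) unfolding S_def by simp
  ultimately have "fits i j" using i(2) j(1) unfolding fits_def by simp
  then show False using c(2) \<open>(c, j) \<in> r\<close> BdI[OF SBd[OF j(1)]] by simp
qed

end

context zf_model begin

definition fst_of :: "'a \<Rightarrow> 'a" where "fst_of u = the1 (\<lambda>x. \<exists>y. u = pair E x y)"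
definition snd_of :: "'a \<Rightarrow> 'a" where "snd_of u = the1 (\<lambda>y. \<exists>x. u = pair E x y)"

lemma fst_of_pair [simp]: "fst_of (pair E x y) = x"
  unfolding fst_of_def by (rule the1_eq) auto

lemma snd_of_pair [simp]: "snd_of (pair E x y) = y"
  unfolding snd_of_def by (rule the1_eq) auto

lemma ft_fst_of [fo]: "ft t \<Longrightarrow> ft (\<lambda>v. fst_of (t v))"
  unfolding fst_of_def by (intro fo ft_ren[of t "\<lambda>n. Suc (Suc n)"])

lemma ft_snd_of [fo]: "ft t \<Longrightarrow> ft (\<lambda>v. snd_of (t v))"
  unfolding snd_of_def by (intro fo ft_ren[of t "\<lambda>n. Suc (Suc n)"])

lemma fo_finite: "finite A \<Longrightarrow> ft t \<Longrightarrow> fo (\<lambda>v. t v \<in> A)"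
proof (induction A rule: finite_induct)
  case (insert x A)
  then show ?case by (intro fo)
qed (intro fo)

lemma fo_finite_rel: "finite R \<Longrightarrow> ft s \<Longrightarrow> ft t \<Longrightarrow> fo (\<lambda>v. (s v, t v) \<in> R)"
proof (induction R rule: finite_induct)
  case empty
  show ?case unfolding empty_iff by (rule fo_const)
next
  case (insert x R)
  obtain a b where x: "x = (a, b)" by (cases x)
  show ?case unfolding insert_iff x prod.inject by (intro fo insert)
qed

lemma wo_finite: assumes "iord H r" shows "finite A \<Longrightarrow> A \<subseteq> H \<Longrightarrow> wo r A"
proof (induction A rule: finite_induct)
  case empty
  show ?case unfolding wo_def by blast
next
  case (insert x A)
  have "wo r ({x} \<union> A)"
  proof (rule wo_Un[OF assms])
    show "{x} \<union> A \<subseteq> H" using insert by simp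
    show "fo (\<lambda>v. v 0 \<in> {x})" by (intro fo)
    show "fo (\<lambda>v. v 0 \<in> A)" by (intro fo_finite insert fo)
    show "wo r A" using insert by simp
  qed (rule wo_singleton)
  then show ?case by simp
qed

end

section \<open>Finite distances and combs inside the reverse well-ordered parts\<close>

context block begin

lemma Dn_convex:
  assumes "x \<in> K" "y \<in> Dn x" "z \<in> Dn x" "le r y u" "le r u z" "u \<in> H" shows "u \<in> Dn x"
proof -
  have "u \<in> seg r H y z" using assms(4-6) unfolding seg_def by simp
  then have uK: "u \<in> K" using Kconv[OF parts_K(4)[OF assms(2)] parts_K(4)[OF assms(3)]] by (rule subsetD[rotated])
  have less: "(u, nx x) \<in> r" by (rule rD(7)[OF assms(5) Dn_less_nx[OF assms(3)]])
  have xu: "(x, u) \<in> r" by (rule rD(8)[OF Dn_greater[OF assms(1,2)] assms(4)])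
  show ?thesis
  proof (rule ccontr)
    assume "u \<notin> Dn x"
    then have "u \<in> Aw x" using parts[OF assms(1) uK rD(6)[OF xu] less] by simp
    then have "(u, y) \<in> r" using assms(2) by (rule Aw_less_Dn)
    then show False using assms(4) rD(11) by simp
  qed
qed

lemma Dn_max:
  assumes "x \<in> K" "fo (\<lambda>v. P (v 0))" "y \<in> Dn x" "P y"
  shows "\<exists>m \<in> Dn x. P m \<and> (\<forall>u \<in> Dn x. P u \<longrightarrow> le r u m)"
proof -
  have "iord (Dn x) (r\<inverse>)"
    by (rule iord_converse[OF iord_subset[OF H _ internal_parts(4)]]) (rule subsetI, rule parts_H(4))
  from wo_least_filter[OF this Dn_rwo[OF assms(1)] assms(2,3,4)]
  show ?thesis unfolding le_def by (metis converse_iff)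
qed

lemma Dn_greatest: "x \<in> K \<Longrightarrow> \<exists>m \<in> Dn x. \<forall>u \<in> Dn x. le r u m"
  using Dn_max[of x "\<lambda>_. True", OF _ fo_const] Dn_nonempty[of x] by (metis ex_in_conv)

lemma Dn_pred:
  assumes "x \<in> K" "y \<in> Dn x"
  shows "\<exists>m \<in> Dn x. (m, y) \<in> r \<and> (\<forall>u \<in> Dn x. (u, y) \<in> r \<longrightarrow> le r u m)"
proof -
  obtain z where z: "z \<in> Dn x" "(z, y) \<in> r" using Dn_no_min[OF assms] by metis
  have "fo (\<lambda>v. (v 0, y) \<in> r)" by (intro fo fiH)
  from Dn_max[OF assms(1) this z] show ?thesis .
qed

lemma Dn_seg_pred:
  assumes "x \<in> K" "y \<in> Dn x" "z \<in> Dn x" "m \<in> Dn x" "(m, y) \<in> r"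
    "\<forall>u \<in> Dn x. (u, y) \<in> r \<longrightarrow> le r u m"
  shows "seg r H m z \<subseteq> {m} \<union> seg r H y z"
proof
  fix u assume u: "u \<in> seg r H m z"
  then have u': "u \<in> H" "le r m u" "le r u z" unfolding seg_def by simp_all
  have uD: "u \<in> Dn x" by (rule Dn_convex[OF assms(1,4,3) u'(2,3,1)])
  show "u \<in> {m} \<union> seg r H y z"
  proof (cases "(u, y) \<in> r")
    case True
    then have "le r u m" using assms(6) uD by simp
    then show ?thesis using rD(12) u'(2) by simp
  next
    case False
    then have "le r y u" by (rule rD(10)[OF u'(1) parts_H(4)[OF assms(2)]])
    then show ?thesis using u' unfolding seg_def by simp
  qed
qed

text \<open>The recursion and the choice take place in HOL, so \<open>d\<close> need not belong to
  the model. This is harmless because only finite sets of its values are used there.\<close>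

lemma Dn_chain:
  assumes x: "x \<in> K"
  shows "\<exists>d :: nat \<Rightarrow> 'a. (\<forall>n. d n \<in> Dn x) \<and> (\<forall>u \<in> Dn x. le r u (d 0)) \<and>
    (\<forall>n. (d (Suc n), d n) \<in> r \<and> (\<forall>u \<in> Dn x. (u, d n) \<in> r \<longrightarrow> le r u (d (Suc n))))"
proof -
  obtain g where g: "g \<in> Dn x" "\<forall>u \<in> Dn x. le r u g" using Dn_greatest[OF x] by metis
  define d where "d = rec_nat g (\<lambda>_ y. SOME m. m \<in> Dn x \<and> (m, y) \<in> r \<and> (\<forall>u \<in> Dn x. (u, y) \<in> r \<longrightarrow> le r u m))"
  have step: "d (Suc n) \<in> Dn x \<and> (d (Suc n), d n) \<in> r \<and> (\<forall>u \<in> Dn x. (u, d n) \<in> r \<longrightarrow> le r u (d (Suc n)))"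
    if "d n \<in> Dn x" for n
    using someI_ex[OF Dn_pred[OF x that, unfolded Bex_def]] unfolding d_def by simp
  have d: "d n \<in> Dn x" for n
  proof (induction n)
    case 0
    show ?case using g(1) unfolding d_def by simp
  next
    case (Suc n)
    then show ?case using step by simp
  qed
  moreover have "\<forall>u \<in> Dn x. le r u (d 0)" using g(2) unfolding d_def by simp
  ultimately show ?thesis using step by metis
qed

lemma Dn_chain_seg:
  assumes x: "x \<in> K" and d: "\<And>n. d n \<in> Dn x" "\<And>n. (d (Suc n), d n) \<in> r"
    "\<And>n u. u \<in> Dn x \<Longrightarrow> (u, d n) \<in> r \<Longrightarrow> le r u (d (Suc n))" and "m \<le> n"
  shows "seg r H (d n) (d m) \<subseteq> d ` {m..n}"
  using \<open>m \<le> n\<close>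
proof (induction n rule: dec_induct)
  case base
  show ?case unfolding seg_def using rD(12) by auto
next
  case (step n)
  have "seg r H (d (Suc n)) (d m) \<subseteq> {d (Suc n)} \<union> seg r H (d n) (d m)"
    using Dn_seg_pred[OF x d(1) d(1) d(1) d(2)] d(3) by simp
  also have "\<dots> \<subseteq> {d (Suc n)} \<union> d ` {m..n}" using step.IH by (rule Un_mono[OF subset_refl])
  also have "\<dots> = d ` {m..Suc n}" using step by (simp add: atLeastAtMostSuc_conv)
  finally show ?case .
qed

lemma chain_le:
  assumes "\<And>n. (d (Suc n), d n) \<in> r" "m \<le> n" shows "le r (d n) (d m)"
  using assms(2)
proof (induction n rule: dec_induct)
  case (step n)
  then show ?case using rD(5)[OF rD(6)[OF assms(1)[of n]]] by simp
qed simp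

lemma chain_fin:
  assumes x: "x \<in> K" and d: "\<And>n. d n \<in> Dn x" "\<And>n. (d (Suc n), d n) \<in> r"
    "\<And>n u. u \<in> Dn x \<Longrightarrow> (u, d n) \<in> r \<Longrightarrow> le r u (d (Suc n))" and "m \<le> n"
  shows "fin r H (d n) (d m)"
proof -
  have "btw r H (d n) (d m) = seg r H (d n) (d m)"
    using chain_le[of d, OF d(2) \<open>m \<le> n\<close>] rD(5,12) unfolding btw_def seg_def by (auto; metis)
  then have sub: "btw r H (d n) (d m) \<subseteq> d ` {m..n}"
    using Dn_chain_seg[of x d, OF x d \<open>m \<le> n\<close>] by simp
  have "finite (d ` {m..n})" "d ` {m..n} \<subseteq> H" using parts_H(4)[OF d(1)] by auto
  then show ?thesis unfolding fin_def
    using wo_subset[OF wo_finite[OF H] sub] wo_subset[OF wo_finite[OF iord_converse[OF H]] sub] by simp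
qed

text \<open>If \<open>z\<close> lay outside \<open>Dn x\<close>, it would lie below all of it by
  convexity, and the interval would contain the part of \<open>Dn x\<close> up to \<open>y\<close>,
  which has no minimum.\<close>

lemma seg_no_min:
  assumes x: "x \<in> K" and y: "y \<in> Dn x" and z: "z \<in> H" "(z, y) \<in> r" "wo r (seg r H z y)"
  shows "z \<in> Dn x"
proof (rule ccontr)
  assume zD: "z \<notin> Dn x"
  let ?N = "{u \<in> Dn x. le r u y}"
  have "\<not> wo r (seg r H z y)"
  proof (rule not_wo_no_min)
    show "internal ?N" by (rule internal_filter[OF internal_parts(4)]) (intro fo fiH)
    have "y \<in> ?N" using y by simp
    then show "?N \<noteq> {}" by (metis empty_iff)
    show "\<exists>v \<in> ?N. (v, u) \<in> r" if u: "u \<in> ?N" for u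
    proof -
      obtain v where v: "v \<in> Dn x" "(v, u) \<in> r" using Dn_no_min[OF x, of u] u by auto
      then have "le r v y" using rD(5)[OF rD(6)[OF v(2)], of y] u by simp
      then show ?thesis using v by auto
    qed
    show "?N \<subseteq> seg r H z y"
    proof
      fix u assume u: "u \<in> ?N"
      have "le r z u"
      proof (rule ccontr)
        assume "\<not> le r z u"
        have uD: "u \<in> Dn x" using u by simp
        have "(u, z) \<in> r" by (rule rD(9)[OF z(1) parts_H(4)[OF uD] \<open>\<not> le r z u\<close>])
        then have "z \<in> Dn x" using Dn_convex[OF x uD y rD(6) rD(6)[OF z(2)] z(1)] by simp
        then show False using zD by simp
      qed
      then show "u \<in> seg r H z y" using u parts_H(4)[of u x] unfolding seg_def by simp
    qed
  qed
  then show False using z(3) by simp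
qed

text \<open>The class has no minimum. Below a point at or above \<open>d n\<close> there is
  \<open>d (Suc n)\<close>. A point below \<open>d n\<close> in the class still lies in
  \<open>Dn x\<close>, and its predecessor there is again at finite distance.\<close>

lemma chain_infc:
  assumes x: "x \<in> K" and d: "\<And>n. d n \<in> Dn x" "\<And>n. (d (Suc n), d n) \<in> r"
    "\<And>n u. u \<in> Dn x \<Longrightarrow> (u, d n) \<in> r \<Longrightarrow> le r u (d (Suc n))"
  shows "infc r H (d n)"
proof -
  have "\<exists>y \<in> cls r H (d n). (y, z) \<in> r" if z: "z \<in> cls r H (d n)" for z
  proof (cases "(z, d n) \<in> r")
    case False
    have zH: "z \<in> H" using z unfolding cls_def by simp
    have dH: "d k \<in> H" for k by (rule parts_H(4)[OF d(1)])
    have "le r (d n) z" by (rule rD(10)[OF zH dH False])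
    then have "(d (Suc n), z) \<in> r" by (rule rD(8)[OF d(2)])
    moreover have "fin r H (d (Suc n)) (d n)" by (rule chain_fin[of x d, OF x d]) simp_all
    then have "fin r H (d n) (d (Suc n))" unfolding fin_def btw_def by (simp add: disj_commute)
    ultimately show ?thesis using dH unfolding cls_def by auto
  next
    case True
    have zH: "z \<in> H" and zf: "fin r H (d n) z" using z unfolding cls_def by simp_all
    have "seg r H z (d n) \<subseteq> btw r H (d n) z" unfolding seg_def btw_def by auto
    then have w1: "wo r (seg r H z (d n))" "wo (r\<inverse>) (seg r H z (d n))"
      using zf wo_subset unfolding fin_def by metis+
    have zD: "z \<in> Dn x" by (rule seg_no_min[OF x d(1) zH True w1(1)])
    obtain y where y: "y \<in> Dn x" "(y, z) \<in> r" "\<forall>u \<in> Dn x. (u, z) \<in> r \<longrightarrow> le r u y"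
      using Dn_pred[OF x zD] by metis
    have sub: "seg r H y (d n) \<subseteq> {y} \<union> seg r H z (d n)" by (rule Dn_seg_pred[OF x zD d(1) y])
    have "(y, d n) \<in> r" by (rule rD(2)[OF y(2) True])
    then have "\<not> le r (d n) y" by (rule rD(11))
    then have b: "btw r H (d n) y \<subseteq> seg r H y (d n)"
      using rD(5)[of "d n" _ y] unfolding seg_def btw_def by auto
    have H1: "{y} \<union> seg r H z (d n) \<subseteq> H" using parts_H(4)[OF y(1)] unfolding seg_def by auto
    have f: "fo (\<lambda>v. v 0 \<in> {y})" "fo (\<lambda>v. v 0 \<in> seg r H z (d n))" by (intro fo)+
    have "wo r ({y} \<union> seg r H z (d n))" by (rule wo_Un[OF H H1 f wo_singleton w1(1)])
    moreover have "wo (r\<inverse>) ({y} \<union> seg r H z (d n))"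
      by (rule wo_Un[OF iord_converse[OF H] H1 f wo_singleton w1(2)])
    ultimately have "fin r H (d n) y" unfolding fin_def using wo_subset[OF _ subset_trans[OF b sub]] by simp
    then show ?thesis using y(1,2) parts_H(4) unfolding cls_def by auto
  qed
  then show ?thesis unfolding infc_def by simp
qed

text \<open>The points of \<open>Dn x\<close> at finite distance from its maximum \<open>g\<close>
  have type \<omega> when read downwards. Three members of the comb in this set are taken.\<close>

lemma Dn_pattern:
  assumes x: "x \<in> K"
  shows "\<exists>a \<in> Dn x. \<exists>b \<in> Dn x. \<exists>c \<in> Dn x. (a, b) \<in> r \<and> (b, c) \<in> r \<and> Up c b a"
proof -
  obtain g where g: "g \<in> Dn x" "\<forall>u \<in> Dn x. le r u g" using Dn_greatest[OF x] by metis
  let ?F = "{z \<in> Dn x. wo r (seg r H z g)}"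
  have FD: "z \<in> Dn x" if "z \<in> ?F" for z using that by simp
  have FH: "?F \<subseteq> H" by (rule subsetI) (rule parts_H(4)[OF FD])
  have iF: "internal ?F" by (rule internal_filter[OF internal_parts(4)]) (intro fo fiH)
  have io: "iord ?F (r\<inverse>)" by (rule iord_converse[OF iord_subset[OF H FH iF]])
  have "seg r H g g \<subseteq> {g}" unfolding seg_def using rD(12) by auto
  then have gF: "g \<in> ?F" using g(1) wo_subset[OF wo_singleton] by simp
  have om: "om (r\<inverse>) ?F"
    unfolding om_def
  proof (intro conjI ballI)
    show "wo (r\<inverse>) ?F" by (rule wo_subset[OF Dn_rwo[OF x]]) (rule Collect_restrict)
    fix z assume z: "z \<in> ?F"
    obtain y where y: "y \<in> Dn x" "(y, z) \<in> r" "\<forall>u \<in> Dn x. (u, z) \<in> r \<longrightarrow> le r u y"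
      using Dn_pred[OF x FD[OF z]] by metis
    have sub: "seg r H y g \<subseteq> {y} \<union> seg r H z g" by (rule Dn_seg_pred[OF x FD[OF z] g(1) y])
    have H1: "{y} \<union> seg r H z g \<subseteq> H" using parts_H(4)[OF y(1)] unfolding seg_def by auto
    have f: "fo (\<lambda>v. v 0 \<in> {y})" "fo (\<lambda>v. v 0 \<in> seg r H z g)" by (intro fo)+
    have wz: "wo r (seg r H z g)" using z by simp
    have "wo r (seg r H y g)" by (rule wo_subset[OF wo_Un[OF H H1 f wo_singleton wz] sub])
    then show "\<exists>y \<in> ?F. (z, y) \<in> r\<inverse>" using y(1,2) by auto
    have "{u \<in> ?F. (u, z) \<in> r\<inverse>} \<subseteq> seg r H z g"
      using FH rD(6)[of z] g(2) unfolding seg_def by auto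
    then show "wo ((r\<inverse>)\<inverse>) {u \<in> ?F. (u, z) \<in> r\<inverse>}" using wo_subset[OF wz] by simp
  qed
  have inj': "\<exists>b \<in> D. ((b, x) \<in> bit) \<noteq> ((b, y) \<in> bit)" if "x \<in> ?F" "y \<in> ?F" "x \<noteq> y" for x y
    by (rule inj[OF subsetD[OF FH that(1)] subsetD[OF FH that(2)] that(3)])
  have ne: "?F \<noteq> {}" using gF by (rule nonemptyI)
  have th: "\<exists>y \<in> thin (r\<inverse>) ?F. (z, y) \<in> r\<inverse>" if "z \<in> ?F" for z
    by (rule thin_unbounded[OF io om ne inj' that])
  have TF: "z \<in> ?F" if "z \<in> thin (r\<inverse>) ?F" for z using that unfolding thin_def by simp
  obtain c where c: "c \<in> thin (r\<inverse>) ?F" using th[OF gF] by (elim bexE)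
  obtain b where b: "b \<in> thin (r\<inverse>) ?F" "(c, b) \<in> r\<inverse>" using th[OF TF[OF c]] by (elim bexE)
  obtain a where a: "a \<in> thin (r\<inverse>) ?F" "(b, a) \<in> r\<inverse>" using th[OF TF[OF b(1)]] by (elim bexE)
  have "Up c b a" by (rule thin_Up[OF io om ne inj' c b(1) a(1) b(2) a(2)])
  then show ?thesis using a(2) b(2) FD[OF TF[OF a(1)]] FD[OF TF[OF b(1)]] FD[OF TF[OF c]] by (auto intro!: bexI)
qed

end

context zf_model begin

definition mono_rel :: "('a \<times> 'a) set \<Rightarrow> ('a \<times> 'a) set \<Rightarrow> bool" where
  "mono_rel r G \<longleftrightarrow> (\<forall>x y x' y'. (x, y) \<in> G \<longrightarrow> (x', y') \<in> G \<longrightarrow> ((x, x') \<in> r \<longleftrightarrow> (y, y') \<in> r))"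

lemma mono_relD: "mono_rel r G \<Longrightarrow> (x, y) \<in> G \<Longrightarrow> (x', y') \<in> G \<Longrightarrow> (x, x') \<in> r \<longleftrightarrow> (y, y') \<in> r"
  unfolding mono_rel_def by simp

lemma mono_rel_Un:
  assumes H: "iord H r" and "mono_rel r F" "mono_rel r G"
    and less: "\<And>x y x' y'. (x, y) \<in> F \<Longrightarrow> (x', y') \<in> G \<Longrightarrow> (x, x') \<in> r \<and> (y, y') \<in> r"
  shows "mono_rel r (F \<union> G)"
  unfolding mono_rel_def
proof (intro allI impI)
  fix x y x' y' assume a: "(x, y) \<in> F \<union> G" "(x', y') \<in> F \<union> G"
  consider "(x, y) \<in> F" "(x', y') \<in> F" | "(x, y) \<in> G" "(x', y') \<in> G"
    | "(x, y) \<in> F" "(x', y') \<in> G" | "(x, y) \<in> G" "(x', y') \<in> F" using a by auto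
  then show "(x, x') \<in> r \<longleftrightarrow> (y, y') \<in> r"
  proof cases
    case 4
    then show ?thesis using less[OF 4(2,1)] iordD(5)[OF H] by metis
  qed (use assms(2,3) mono_relD less in metis)+
qed

lemma internal_pairs:
  assumes "internal A" "internal B" shows "internal {pair E x y | x y. x \<in> A \<and> y \<in> B}"
proof -
  obtain a b where "elts E a = A" "elts E b = B" using assms unfolding internal_def by metis
  then show ?thesis using internal_cross[of a b] by simp
qed

end

section \<open>Shifting the tail of a block beyond a given index\<close>

context block_orbit begin

lemma J_K: "z \<in> Aw i \<union> Dn i \<Longrightarrow> z \<in> K" using parts_K by auto

lemma J_bounds: assumes "i \<in> I" "z \<in> Aw i \<union> Dn i" shows "le r i z" "(z, nx i) \<in> r"
  using assms Aw_less_nx[OF I_K] Dn_less_nx rD(6)[OF Dn_greater[OF I_K]] unfolding Aw_def by auto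

lemma J_less:
  assumes "i \<in> I" "j \<in> I" "(i, j) \<in> r" "z \<in> Aw i \<union> Dn i" "z' \<in> Aw j \<union> Dn j" shows "(z, z') \<in> r"
  using rD(8)[OF J_bounds(2)[OF assms(1,4)] rD(5)[OF I_chain[OF assms(1-3)] J_bounds(1)[OF assms(2,5)]]] .

lemma J_total: assumes "z \<in> K" "le r x0 z" shows "\<exists>i \<in> I. z \<in> Aw i \<union> Dn i \<and> le r i z \<and> (z, nx i) \<in> r"
proof -
  obtain i where i: "i \<in> I" "le r i z" "(z, nx i) \<in> r" using I_index[OF assms] by metis
  then show ?thesis using parts[OF I_K[OF i(1)] assms(1)] by auto
qed

context
  fixes p j0
  assumes p: "p \<in> I" and j0: "j0 \<in> I"
    and rec: "\<And>i c. i \<in> I \<Longrightarrow> le r (nx p) i \<Longrightarrow> c \<in> I \<Longrightarrow> \<exists>j \<in> I. (c, j) \<in> r \<and> fits i j"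
begin

text \<open>Recurrence gives only the existence of a fitting index beyond \<open>y\<close>. The
  first one is taken, as the orbit is well-ordered.\<close>

definition next_fit :: "'a \<Rightarrow> 'a \<Rightarrow> 'a" where
  "next_fit i y = the1 (\<lambda>j. j \<in> I \<and> ((y, j) \<in> r \<and> fits i j) \<and> (\<forall>k \<in> I. (y, k) \<in> r \<and> fits i k \<longrightarrow> le r j k))"

text \<open>Recursion is replaced by an orbit of pairs: the first coordinate runs through the
  indices, and the second records the image chosen last, which the next image has to exceed.\<close>

definition index_step :: "'a \<Rightarrow> 'a" where "index_step u = pair E (nx (fst_of u)) (next_fit (nx (fst_of u)) (snd_of u))"

definition start :: 'a where "start = pair E (nx p) (next_fit (nx p) j0)"

definition index_map :: "('a \<times> 'a) set" where "index_map = {(i, f). pair E i f \<in> orb index_step start}"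

lemma next_fit:
  assumes "i \<in> I" "le r (nx p) i" "y \<in> I"
  shows "next_fit i y \<in> I" "(y, next_fit i y) \<in> r" "fits i (next_fit i y)"
proof -
  have wo: "wo r I" using I_om unfolding om_def by simp
  have f: "fo (\<lambda>v. (y, v 0) \<in> r \<and> fits i (v 0))" by (intro fo fiH fo_fits)
  obtain j where j: "j \<in> I" "(y, j) \<in> r \<and> fits i j" using rec[OF assms] by metis
  obtain m where m: "m \<in> I" "(y, m) \<in> r \<and> fits i m"
    "\<forall>k \<in> I. (y, k) \<in> r \<and> fits i k \<longrightarrow> k \<noteq> m \<longrightarrow> (m, k) \<in> r"
    using wo_least_filter[OF I_iord wo f j] by (elim bexE conjE) simp
  have m': "\<forall>k \<in> I. (y, k) \<in> r \<and> fits i k \<longrightarrow> le r m k" using m(3) unfolding le_def by metis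
  have "next_fit i y = m" unfolding next_fit_def
  proof (rule the1_eq)
    fix k assume k: "k \<in> I \<and> ((y, k) \<in> r \<and> fits i k) \<and> (\<forall>l \<in> I. (y, l) \<in> r \<and> fits i l \<longrightarrow> le r k l)"
    show "k = m" by (rule rD(12)) (use k m m' in metis)+
  qed (intro conjI m m')
  then show "next_fit i y \<in> I" "(y, next_fit i y) \<in> r" "fits i (next_fit i y)" using m by simp_all
qed

definition index_dom :: "'a set" where "index_dom = {pair E i y | i y. i \<in> {i \<in> I. le r (nx p) i} \<and> y \<in> I}"
text \<open>An increase in both coordinates is required. Comparability of any two points of the
  orbit in this relation then says that the index map is a strictly increasing function.\<close>

definition index_less :: "('a \<times> 'a) set" where "index_less = {(u, u'). (fst_of u, fst_of u') \<in> r \<and> (snd_of u, snd_of u') \<in> r}"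

lemma index_dom_cases: assumes "u \<in> index_dom" obtains i y where "u = pair E i y" "i \<in> I" "le r (nx p) i" "y \<in> I"
  using assms unfolding index_dom_def by auto

lemma index_domI: "i \<in> I \<Longrightarrow> le r (nx p) i \<Longrightarrow> y \<in> I \<Longrightarrow> pair E i y \<in> index_dom"
  unfolding index_dom_def by auto

lemma le_nx: "i \<in> I \<Longrightarrow> le r (nx p) i \<Longrightarrow> le r (nx p) (nx i)"
  using rD(6)[OF rD(7)[OF _ I_nx_less]] by simp

lemma index_facts:
  "ft (\<lambda>v. index_step (v 0))" "\<And>u. u \<in> index_dom \<Longrightarrow> index_step u \<in> index_dom" "internal index_dom" "start \<in> index_dom"
  "drel index_less" "trans index_less" "irrefl index_less" "\<And>u. u \<in> index_dom \<Longrightarrow> (u, index_step u) \<in> index_less"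
proof -
  show "ft (\<lambda>v. index_step (v 0))" unfolding index_step_def next_fit_def by (intro fo fiH fo_fits fo_I ft_nx)
  show "drel index_less" unfolding drel_def index_less_def by (intro fo fiH)
  show "trans index_less" unfolding index_less_def trans_def using rD(2) by simp metis
  show "irrefl index_less" unfolding index_less_def irrefl_def using rD(1) by simp
  show "internal index_dom" unfolding index_dom_def
    by (intro internal_pairs I_internal internal_filter[OF I_internal] fo fiH)
  show "start \<in> index_dom" unfolding start_def
    by (rule index_domI[OF I_step[OF p] le_refl next_fit(1)[OF I_step[OF p] le_refl j0]])
  fix u assume "u \<in> index_dom"
  then obtain i y where u: "u = pair E i y" "i \<in> I" "le r (nx p) i" "y \<in> I" by (rule index_dom_cases)
  note g = next_fit[OF I_step[OF u(2)] le_nx[OF u(2,3)] u(4)]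
  show "index_step u \<in> index_dom" unfolding index_step_def u(1) fst_of_pair snd_of_pair
    by (rule index_domI[OF I_step[OF u(2)] le_nx[OF u(2,3)] g(1)])
  show "(u, index_step u) \<in> index_less" unfolding index_step_def u(1) index_less_def using g(2) I_nx_less[OF u(2)] by simp
qed

lemma index_orbit:
  shows "start \<in> orb index_step start" "u \<in> orb index_step start \<Longrightarrow> index_step u \<in> orb index_step start"
    "c \<in> orb index_step start \<Longrightarrow> u \<in> orb index_step start \<Longrightarrow> u = c \<or> (u, c) \<in> index_less \<or> (c, u) \<in> index_less"
    "orb index_step start \<subseteq> index_dom" "ft t \<Longrightarrow> fo (\<lambda>v. t v \<in> orb index_step start)"
  by (rule orb_start[where n = index_step and a = start and U = index_dom and lt = index_less, OF index_facts] orb_step[where n = index_step and a = start and U = index_dom and lt = index_less, OF index_facts] orb_chain[where n = index_step and a = start and U = index_dom and lt = index_less, OF index_facts]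
    orb_subset[where n = index_step and a = start and U = index_dom and lt = index_less, OF index_facts] fo_orb[where n = index_step and a = start and U = index_dom and lt = index_less, OF index_facts]; assumption)+

lemma index_induct:
  assumes "u \<in> orb index_step start" "fo (\<lambda>v. P (v 0))" "P start"
    "\<And>u. u \<in> orb index_step start \<Longrightarrow> u \<in> index_dom \<Longrightarrow> P u \<Longrightarrow> P (index_step u)"
  shows "P u"
  by (rule orb_induct[where n = index_step and a = start and U = index_dom and lt = index_less, OF index_facts]) (assumption | rule assms)+

lemma drel_index_map: "drel index_map" unfolding drel_def index_map_def by (intro fo index_orbit)

lemma index_map: assumes "(i, f) \<in> index_map" shows "i \<in> I" "le r (nx p) i" "f \<in> I"
proof -
  have "pair E i f \<in> index_dom" using assms index_orbit(4) unfolding index_map_def by auto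
  then show "i \<in> I" "le r (nx p) i" "f \<in> I" unfolding index_dom_def by auto
qed

lemma index_map_fits: assumes "(i, f) \<in> index_map" shows "(j0, f) \<in> r" "fits i f"
proof -
  have "pair E i f \<in> orb index_step start" using assms unfolding index_map_def by simp
  then have "(j0, snd_of (pair E i f)) \<in> r \<and> fits (fst_of (pair E i f)) (snd_of (pair E i f))"
  proof (rule index_induct)
    show "fo (\<lambda>v. (j0, snd_of (v 0)) \<in> r \<and> fits (fst_of (v 0)) (snd_of (v 0)))" by (intro fo fiH fo_fits)
    show "(j0, snd_of start) \<in> r \<and> fits (fst_of start) (snd_of start)"
      unfolding start_def using next_fit[OF I_step[OF p] le_refl j0] by simp
    fix u assume a: "u \<in> index_dom" "(j0, snd_of u) \<in> r \<and> fits (fst_of u) (snd_of u)"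
    obtain i y where u: "u = pair E i y" "i \<in> I" "le r (nx p) i" "y \<in> I" using a(1) by (rule index_dom_cases)
    note g = next_fit[OF I_step[OF u(2)] le_nx[OF u(2,3)] u(4)]
    show "(j0, snd_of (index_step u)) \<in> r \<and> fits (fst_of (index_step u)) (snd_of (index_step u))"
      unfolding index_step_def u(1) using g rD(2)[of j0 y] a(2) u(1) by simp
  qed
  then show "(j0, f) \<in> r" "fits i f" by simp_all
qed

lemma index_map_total: assumes "i \<in> I" shows "le r (nx p) i \<Longrightarrow> \<exists>f. (i, f) \<in> index_map"
proof -
  have st: "(nx p, next_fit (nx p) j0) \<in> index_map" using index_orbit(1) unfolding index_map_def start_def by simp
  have "le r (nx p) i \<longrightarrow> (\<exists>f. (i, f) \<in> index_map)"
    using assms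
  proof (rule I_induct)
    show "fo (\<lambda>v. le r (nx p) (v 0) \<longrightarrow> (\<exists>f. (v 0, f) \<in> index_map))" by (intro fo fiH fo_drel drel_index_map)
    show "le r (nx p) x0 \<longrightarrow> (\<exists>f. (x0, f) \<in> index_map)"
      using rD(12)[OF I_least[OF I_step[OF p]]] st by metis
    fix u assume u: "u \<in> I" "le r (nx p) u \<longrightarrow> (\<exists>f. (u, f) \<in> index_map)"
    show "le r (nx p) (nx u) \<longrightarrow> (\<exists>f. (nx u, f) \<in> index_map)"
    proof
      assume l: "le r (nx p) (nx u)"
      show "\<exists>f. (nx u, f) \<in> index_map"
      proof (cases "le r (nx p) u")
        case True
        then obtain f where "pair E u f \<in> orb index_step start" using u(2) unfolding index_map_def by auto
        then have "index_step (pair E u f) \<in> orb index_step start" by (rule index_orbit(2))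
        then show ?thesis unfolding index_map_def index_step_def by auto
      next
        case False
        then have "(u, nx p) \<in> r" by (rule rD(9)[OF I_H[OF I_step[OF p]] I_H[OF u(1)]])
        then have "le r (nx u) (nx p)" by (rule I_chain[OF u(1) I_step[OF p]])
        then show ?thesis using rD(12)[OF l] st by metis
      qed
    qed
  qed
  then show "le r (nx p) i \<Longrightarrow> \<exists>f. (i, f) \<in> index_map" by simp
qed

lemma index_map_mono:
  assumes "(i, f) \<in> index_map" "(i', f') \<in> index_map"
  shows "(i = i' \<and> f = f') \<or> ((i, i') \<in> r \<and> (f, f') \<in> r) \<or> ((i', i) \<in> r \<and> (f', f) \<in> r)"
  using index_orbit(3)[of "pair E i f" "pair E i' f'"] assms unfolding index_map_def index_less_def by auto

text \<open>Each pair of matched pieces has its comparison maps without further choices, so the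
  embeddings of all pieces combine into one definable relation.\<close>

definition tail_map :: "('a \<times> 'a) set" where
  "tail_map = {(z, y). \<exists>i f. (i, f) \<in> index_map \<and>
    ((z, y) \<in> cmp (Aw i) r (Aw f) r \<or> (z, y) \<in> cmp (Dn i) (r\<inverse>) (Dn f) (r\<inverse>))}"

lemma drel_tail_map: "drel tail_map"
  unfolding drel_def tail_map_def by (intro fo fiH fo_drel[OF drel_index_map])

lemma tail_map_parts:
  assumes "(z, y) \<in> tail_map"
  obtains i f where "(i, f) \<in> index_map" "z \<in> Aw i \<union> Dn i" "y \<in> Aw f \<union> Dn f"
    "(z, y) \<in> cmp (Aw i) r (Aw f) r \<or> (z, y) \<in> cmp (Dn i) (r\<inverse>) (Dn f) (r\<inverse>)"
  using assms cmpD(1,2) unfolding tail_map_def by auto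

lemma tail_map_bounds:
  assumes "(z, y) \<in> tail_map" shows "z \<in> K" "le r (nx p) z" "y \<in> K" "(j0, y) \<in> r"
proof -
  obtain i f where P: "(i, f) \<in> index_map" and zy: "z \<in> Aw i \<union> Dn i" "y \<in> Aw f \<union> Dn f"
    using assms by (rule tail_map_parts)
  show "z \<in> K" "y \<in> K" using J_K zy by simp_all
  show "le r (nx p) z" by (rule rD(5)[OF index_map(2)[OF P] J_bounds(1)[OF index_map(1)[OF P] zy(1)]])
  show "(j0, y) \<in> r" by (rule rD(8)[OF index_map_fits(1)[OF P] J_bounds(1)[OF index_map(3)[OF P] zy(2)]])
qed

lemma tail_map_total: assumes "z \<in> K" "le r (nx p) z" shows "\<exists>y. (z, y) \<in> tail_map"
proof -
  have "le r x0 z" by (rule rD(5)[OF I_least[OF I_step[OF p]] assms(2)])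
  then obtain i where i: "i \<in> I" "z \<in> Aw i \<union> Dn i" "(z, nx i) \<in> r" using J_total[OF assms(1)] by metis
  have "le r (nx p) i"
  proof (rule ccontr)
    assume "\<not> le r (nx p) i"
    then have "(i, nx p) \<in> r" by (rule rD(9)[OF I_H[OF I_step[OF p]] I_H[OF i(1)]])
    then have "le r (nx i) (nx p)" by (rule I_chain[OF i(1) I_step[OF p]])
    then have "le r (nx i) z" using assms(2) by (rule rD(5))
    then show False using i(3) rD(11) by simp
  qed
  then obtain f where f: "(i, f) \<in> index_map" using index_map_total[OF i(1)] by metis
  have "fits i f" by (rule index_map_fits(2)[OF f])
  then have "(\<exists>y. (z, y) \<in> cmp (Aw i) r (Aw f) r) \<or> (\<exists>y. (z, y) \<in> cmp (Dn i) (r\<inverse>) (Dn f) (r\<inverse>))"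
    using i(2) unfolding fits_def leq_def by auto
  then show ?thesis using f unfolding tail_map_def by auto
qed

lemma iord_parts: "iord (Aw i) r" "iord (Dn i) (r\<inverse>)"
  by (rule iord_subset[OF H _ internal_parts(1)], rule subsetI, rule parts_H(1), assumption)
    (rule iord_converse[OF iord_subset[OF H _ internal_parts(4)]], rule subsetI, rule parts_H(4))

lemma tail_map_mono: "mono_rel r tail_map"
  unfolding mono_rel_def
proof (intro allI impI)
  fix z y z' y' assume a: "(z, y) \<in> tail_map" "(z', y') \<in> tail_map"
  obtain i f where 1: "(i, f) \<in> index_map" "z \<in> Aw i \<union> Dn i" "y \<in> Aw f \<union> Dn f"
    "(z, y) \<in> cmp (Aw i) r (Aw f) r \<or> (z, y) \<in> cmp (Dn i) (r\<inverse>) (Dn f) (r\<inverse>)"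
    using a(1) by (rule tail_map_parts)
  obtain i' f' where 2: "(i', f') \<in> index_map" "z' \<in> Aw i' \<union> Dn i'" "y' \<in> Aw f' \<union> Dn f'"
    "(z', y') \<in> cmp (Aw i') r (Aw f') r \<or> (z', y') \<in> cmp (Dn i') (r\<inverse>) (Dn f') (r\<inverse>)"
    using a(2) by (rule tail_map_parts)
  note P = index_map(1)[OF 1(1)] index_map(3)[OF 1(1)] index_map(1)[OF 2(1)] index_map(3)[OF 2(1)]
  consider "i = i'" "f = f'" | "(i, i') \<in> r" "(f, f') \<in> r" | "(i', i) \<in> r" "(f', f) \<in> r"
    using index_map_mono[OF 1(1) 2(1)] by metis
  then show "(z, z') \<in> r \<longleftrightarrow> (y, y') \<in> r"
  proof cases
    case 2
    then show ?thesis using J_less[OF P(1,3) 2(1)] J_less[OF P(2,4) 2(2)] \<open>z \<in> Aw i \<union> Dn i\<close>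
        \<open>y \<in> Aw f \<union> Dn f\<close> \<open>z' \<in> Aw i' \<union> Dn i'\<close> \<open>y' \<in> Aw f' \<union> Dn f'\<close> by simp
  next
    case 3
    have "(z', z) \<in> r" "(y', y) \<in> r" using J_less[OF P(3,1) 3(1)] J_less[OF P(4,2) 3(2)] 1(2,3) 2(2,3) by simp_all
    then show ?thesis using rD(3) by metis
  next
    case 3: 1
    have D: "wo (r\<inverse>) (Dn i)" "wo (r\<inverse>) (Dn f)" using Dn_rwo[OF I_K] P by simp_all
    note c = 1(4) 2(4)[folded 3]
    consider "(z, y) \<in> cmp (Aw i) r (Aw f) r" "(z', y') \<in> cmp (Aw i) r (Aw f) r"
      | "(z, y) \<in> cmp (Dn i) (r\<inverse>) (Dn f) (r\<inverse>)" "(z', y') \<in> cmp (Dn i) (r\<inverse>) (Dn f) (r\<inverse>)"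
      | "(z, y) \<in> cmp (Aw i) r (Aw f) r" "(z', y') \<in> cmp (Dn i) (r\<inverse>) (Dn f) (r\<inverse>)"
      | "(z, y) \<in> cmp (Dn i) (r\<inverse>) (Dn f) (r\<inverse>)" "(z', y') \<in> cmp (Aw i) r (Aw f) r"
      using c by metis
    then show ?thesis
    proof cases
      case 1
      show ?thesis by (rule cmp_mono[OF iord_parts(1) iord_parts(1) Aw_wo Aw_wo 1])
    next
      case 2
      show ?thesis using cmp_mono[OF iord_parts(2) iord_parts(2) D 2(2,1)] by simp
    next
      case 3
      show ?thesis using Aw_less_Dn[OF cmpD(1)[OF 3(1)] cmpD(1)[OF 3(2)]]
          Aw_less_Dn[OF cmpD(2)[OF 3(1)] cmpD(2)[OF 3(2)]] by simp
    next
      case 4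
      show ?thesis using Aw_less_Dn[OF cmpD(1)[OF 4(2)] cmpD(1)[OF 4(1)]]
          Aw_less_Dn[OF cmpD(2)[OF 4(2)] cmpD(2)[OF 4(1)]] rD(3) by metis
    qed
  qed
qed

end

end

section \<open>Self-embeddings that create a bad class\<close>

context zf_model begin

lemma chain_less:
  assumes "iord H r" "\<And>k. Suc k < n \<Longrightarrow> (s k, s (Suc k)) \<in> r" shows "k < l \<Longrightarrow> l < n \<Longrightarrow> (s k, s l) \<in> r"
proof (induction l)
  case (Suc l)
  have step: "(s l, s (Suc l)) \<in> r" by (rule assms(2)[OF Suc(3)])
  show ?case
  proof (cases "k = l")
    case False
    then have "(s k, s l) \<in> r" using Suc by simp
    then show ?thesis by (rule iordD(4)[OF assms(1) _ step])
  qed (use step in simp)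
qed simp

lemma mono_chain:
  assumes "iord H r" "\<And>k. Suc k < n \<Longrightarrow> (s k, s (Suc k)) \<in> r" "\<And>k. Suc k < n \<Longrightarrow> (t k, t (Suc k)) \<in> r"
  shows "mono_rel r ((\<lambda>k. (s k, t k)) ` {..<n})"
  unfolding mono_rel_def
proof (intro allI impI)
  fix x y x' y' assume a: "(x, y) \<in> (\<lambda>k. (s k, t k)) ` {..<n}" "(x', y') \<in> (\<lambda>k. (s k, t k)) ` {..<n}"
  obtain k l where kl: "k < n" "l < n" "x = s k" "y = t k" "x' = s l" "y' = t l" using a by auto
  note c = chain_less[of H r n, OF assms(1)]
  have s: "i < j \<Longrightarrow> j < n \<Longrightarrow> (s i, s j) \<in> r" for i j by (rule c) (rule assms(2))
  have t: "i < j \<Longrightarrow> j < n \<Longrightarrow> (t i, t j) \<in> r" for i j by (rule c) (rule assms(3))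
  show "(x, x') \<in> r \<longleftrightarrow> (y, y') \<in> r"
    using s[of k l] t[of k l] s[of l k] t[of l k] kl iordD(3,5)[OF assms(1)]
    by (metis linorder_neqE_nat)
qed

end

context lin begin

text \<open>The images of six consecutive points of an infinite class form a comb growing to the right,
  followed by one growing to the left. No choice of a centre can make the class of the image nice.\<close>

definition bad_embedding :: "('a \<times> 'a) set \<Rightarrow> (nat \<Rightarrow> 'a) \<Rightarrow> (nat \<Rightarrow> 'a) \<Rightarrow> bool" where
  "bad_embedding G m p \<longleftrightarrow> drel G \<and> mono_rel r G \<and> G \<subseteq> H \<times> H \<and> H \<subseteq> Domain G \<and>
     (\<forall>k<6. (m k, p k) \<in> G \<and> m k \<in> cls r H (m 0)) \<and> (\<forall>k<5. (m k, m (Suc k)) \<in> r) \<and>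
     infc r H (m 0) \<and> Up (p 0) (p 1) (p 2) \<and> Up (p 5) (p 4) (p 3)"

end

context block_orbit begin

lemma I_pattern:
  assumes "i \<in> I"
  shows "\<exists>a \<in> I. \<exists>b \<in> I. \<exists>c \<in> I. (i, a) \<in> r \<and> (a, b) \<in> r \<and> (b, c) \<in> r \<and> Up a b c"
proof -
  have inj': "\<exists>b \<in> D. ((b, x) \<in> bit) \<noteq> ((b, y) \<in> bit)" if "x \<in> I" "y \<in> I" "x \<noteq> y" for x y
    by (rule inj[OF I_H[OF that(1)] I_H[OF that(2)] that(3)])
  have ne: "I \<noteq> {}" using I_start by (rule nonemptyI)
  have th: "\<exists>y \<in> thin r I. (z, y) \<in> r" if "z \<in> I" for z
    by (rule thin_unbounded[OF I_iord I_om ne inj' that])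
  have TI: "z \<in> I" if "z \<in> thin r I" for z using that unfolding thin_def by simp
  obtain a where a: "a \<in> thin r I" "(i, a) \<in> r" using th[OF assms] by (elim bexE)
  obtain b where b: "b \<in> thin r I" "(a, b) \<in> r" using th[OF TI[OF a(1)]] by (elim bexE)
  obtain c where c: "c \<in> thin r I" "(b, c) \<in> r" using th[OF TI[OF b(1)]] by (elim bexE)
  have "Up a b c" by (rule thin_Up[OF I_iord I_om ne inj' a(1) b(1) c(1) b(2) c(2)])
  then show ?thesis using TI[OF a(1)] TI[OF b(1)] TI[OF c(1)] a(2) b(2) c(2) by (intro bexI conjI)
qed

lemma above_K:
  assumes "z \<in> H" "z \<notin> K" "k \<in> K" "(k, z) \<in> r" "k' \<in> K" shows "(k', z) \<in> r"
proof (rule ccontr)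
  assume "(k', z) \<notin> r"
  then have "le r z k'" by (rule rD(10)[OF KH[OF assms(5)] assms(1)])
  then have "z \<in> seg r H k k'" using assms(1) rD(6)[OF assms(4)] unfolding seg_def by simp
  then show False using Kconv[OF assms(3,5)] assms(2) by auto
qed

text \<open>The map is the identity to the left of \<open>m 0\<close>. The six greatest points of
  \<open>Dn b\<close> go into the gap: onto three orbit points beyond \<open>nx b\<close> that grow
  right, followed by three points of \<open>Dn q2\<close> that grow left. What remains of
  \<open>K\<close>, from \<open>nx b\<close> on, is shifted beyond \<open>nx q2\<close>, and
  everything above \<open>K\<close> stays fixed.\<close>

lemma bad_embedding: "\<exists>G m p. bad_embedding G m p"
proof -
  obtain b where b: "b \<in> I"
    and rec0: "\<forall>i \<in> I. (b, i) \<in> r \<longrightarrow> (\<forall>c \<in> I. \<exists>j \<in> I. (c, j) \<in> r \<and> fits i j)"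
    using recurrent by (elim bexE)
  let ?i = "nx b"
  have i: "?i \<in> I" by (rule I_step[OF b])
  have rec: "\<exists>j \<in> I. (c, j) \<in> r \<and> fits i j" if "i \<in> I" "le r ?i i" "c \<in> I" for i c
    using rec0 rD(8)[OF I_nx_less[OF b] that(2)] that(1,3) by simp
  obtain d where d: "\<forall>n. d n \<in> Dn b" "\<forall>u \<in> Dn b. le r u (d 0)"
    "\<forall>n. (d (Suc n), d n) \<in> r \<and> (\<forall>u \<in> Dn b. (u, d n) \<in> r \<longrightarrow> le r u (d (Suc n)))"
    using Dn_chain[OF I_K[OF b]] by (elim exE conjE)
  have d': "\<And>n. d n \<in> Dn b" "\<And>n. (d (Suc n), d n) \<in> r"
    "\<And>n u. u \<in> Dn b \<Longrightarrow> (u, d n) \<in> r \<Longrightarrow> le r u (d (Suc n))"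
    using d by simp_all
  have dH: "d n \<in> H" for n by (rule parts_H(4)[OF d'(1)])
  have di: "(d n, ?i) \<in> r" for n by (rule Dn_less_nx[OF d'(1)])
  obtain q0 q1 q2 where q: "q0 \<in> I" "q1 \<in> I" "q2 \<in> I" "(?i, q0) \<in> r" "(q0, q1) \<in> r" "(q1, q2) \<in> r" "Up q0 q1 q2"
    using I_pattern[OF i] by (elim bexE conjE)
  obtain a3 a4 a5 where a: "a3 \<in> Dn q2" "a4 \<in> Dn q2" "a5 \<in> Dn q2" "(a3, a4) \<in> r" "(a4, a5) \<in> r" "Up a5 a4 a3"
    using Dn_pattern[OF I_K[OF q(3)]] by (elim bexE conjE)
  let ?j = "nx q2"
  have j: "?j \<in> I" by (rule I_step[OF q(3)])
  \<comment> \<open>The sequence \<open>d\<close> descends from the maximum of \<open>Dn b\<close>,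
    so its first six terms are listed backwards. For larger \<open>k\<close> the subtraction is cut
    off at \<open>d 0\<close>, which keeps the bounds \<open>mi\<close> and \<open>m0le\<close> true
    for all \<open>k\<close>.\<close>
  define m where "m = (\<lambda>k. d (5 - k))"
  define p where "p = (\<lambda>k. [q0, q1, q2, a3, a4, a5] ! k)"
  have less6: "k < 6 \<longleftrightarrow> k = 0 \<or> k = 1 \<or> k = 2 \<or> k = 3 \<or> k = 4 \<or> k = 5" for k :: nat by auto
  have less5: "Suc k < 6 \<longleftrightarrow> k = 0 \<or> k = 1 \<or> k = 2 \<or> k = 3 \<or> k = 4" for k :: nat by auto
  have pv: "p 0 = q0" "p 1 = q1" "p 2 = q2" "p 3 = a3" "p 4 = a4" "p 5 = a5" "p (Suc 0) = q1"
    unfolding p_def by simp_all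
  have pS: "p (Suc 1) = q2" "p (Suc 2) = a3" "p (Suc 3) = a4" "p (Suc 4) = a5" unfolding p_def by simp_all
  have pstep: "(p k, p (Suc k)) \<in> r" if k: "Suc k < 6" for k
    using k[unfolded less5] q(5,6) a(4,5) Dn_greater[OF I_K[OF q(3)] a(1)] pv pS by (elim disjE) simp_all
  have pbound: "(?i, p k) \<in> r \<and> (p k, ?j) \<in> r \<and> p k \<in> K" if k: "k < 6" for k
  proof -
    have iq: "(?i, q1) \<in> r" by (rule rD(2)[OF q(4,5)])
    have iq2: "(?i, q2) \<in> r" by (rule rD(2)[OF iq q(6)])
    have qj: "(q2, ?j) \<in> r" by (rule I_nx_less[OF q(3)])
    have q1j: "(q1, ?j) \<in> r" by (rule rD(2)[OF q(6) qj])
    have q0j: "(q0, ?j) \<in> r" by (rule rD(2)[OF q(5) q1j])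
    have aj: "(x, ?j) \<in> r" "(?i, x) \<in> r" if "x \<in> Dn q2" for x
      using Dn_less_nx[OF that] rD(2)[OF iq2 Dn_greater[OF I_K[OF q(3)] that]] by simp_all
    show ?thesis using k[unfolded less6] pv iq iq2 qj q1j q0j aj[OF a(1)] aj[OF a(2)] aj[OF a(3)] q(4)
        I_K[OF q(1)] I_K[OF q(2)] I_K[OF q(3)] parts_K(4)[OF a(1)] parts_K(4)[OF a(2)] parts_K(4)[OF a(3)]
      by (elim disjE) simp_all
  qed
  have mstep: "(m k, m (Suc k)) \<in> r" if "Suc k < 6" for k
  proof -
    have "Suc (5 - Suc k) = 5 - k" using that by simp
    then show ?thesis unfolding m_def using d'(2)[of "5 - Suc k"] by metis
  qed
  have m0: "m 0 = d 5" unfolding m_def by simp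
  have mi: "(m k, ?i) \<in> r" for k unfolding m_def by (rule di)
  have m0le: "le r (m 0) (m k)" for k
    unfolding m_def by (rule chain_le[of d]) (rule d'(2), simp)
  let ?G0 = "{(z, y). z \<in> H \<and> y = z \<and> (z, m 0) \<in> r}"
  let ?M = "(\<lambda>k. (m k, p k)) ` {..<6}"
  let ?T = "tail_map b ?j"
  let ?G3 = "{(z, y). z \<in> H \<and> y = z \<and> z \<notin> K \<and> (?i, z) \<in> r}"
  have T: "drel ?T" "mono_rel r ?T"
    by (rule drel_tail_map[OF b j rec], assumption+) (rule tail_map_mono[OF b j rec], assumption+)
  have Tb: "z \<in> K" "le r ?i z" "y \<in> K" "(?j, y) \<in> r" if "(z, y) \<in> ?T" for z y
    using tail_map_bounds[OF b j rec that] by simp_all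
  have Tt: "\<exists>y. (z, y) \<in> ?T" if "z \<in> K" "le r ?i z" for z
    using tail_map_total[OF b j rec that] by simp
  have i0K: "?i \<in> K" by (rule I_K[OF i])
  have mj: "(m 0, ?j) \<in> r" using rD(2)[OF mi rD(2)[of ?i "p 0" ?j]] pbound[of 0] by simp
  have mono0: "mono_rel r ?G0" "mono_rel r ?G3" unfolding mono_rel_def by simp_all
  have monoM: "mono_rel r ?M" by (rule mono_chain[OF H]) (rule mstep pstep, assumption)+
  have mono1: "mono_rel r (?G0 \<union> ?M)"
  proof (rule mono_rel_Un[OF H mono0(1) monoM])
    fix x y x' y' assume s: "(x, y) \<in> ?G0" "(x', y') \<in> ?M"
    obtain k where k: "k < 6" "x' = m k" "y' = p k" using s(2) by auto
    have xm: "(x, m 0) \<in> r" "y = x" using s(1) by auto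
    have "(x, m k) \<in> r" by (rule rD(8)[OF xm(1) m0le])
    moreover have "(x, p k) \<in> r" using rD(2)[OF rD(2)[OF xm(1) mi]] pbound[OF k(1)] by simp
    ultimately show "(x, x') \<in> r \<and> (y, y') \<in> r" using k xm by simp
  qed
  have mono2: "mono_rel r (?G0 \<union> ?M \<union> ?T)"
  proof (rule mono_rel_Un[OF H mono1 T(2)])
    fix x y x' y' assume s: "(x, y) \<in> ?G0 \<union> ?M" "(x', y') \<in> ?T"
    have "(x, ?i) \<in> r \<and> (y, ?j) \<in> r"
    proof (cases "(x, y) \<in> ?G0")
      case True
      then have xm: "(x, m 0) \<in> r" "y = x" by auto
      then show ?thesis using rD(2)[OF xm(1) mi] rD(2)[OF xm(1) mj] by simp
    next
      case False
      then obtain k where k: "k < 6" "x = m k" "y = p k" using s(1) by auto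
      then show ?thesis using mi pbound[OF k(1)] by simp
    qed
    then show "(x, x') \<in> r \<and> (y, y') \<in> r" using Tb[OF s(2)] rD(8) rD(2) by metis
  qed
  have mono3: "mono_rel r (?G0 \<union> ?M \<union> ?T \<union> ?G3)"
  proof (rule mono_rel_Un[OF H mono2 mono0(2)])
    fix x y x' y' assume s: "(x, y) \<in> ?G0 \<union> ?M \<union> ?T" "(x', y') \<in> ?G3"
    have x': "x' \<in> H" "x' \<notin> K" "(?i, x') \<in> r" "y' = x'" using s(2) by auto
    note ab = above_K[OF x'(1,2) i0K x'(3)]
    consider "(x, y) \<in> ?G0" | "(x, y) \<in> ?M" | "(x, y) \<in> ?T" using s(1) by blast
    then show "(x, x') \<in> r \<and> (y, y') \<in> r"
    proof cases
      case 1
      then have xm: "(x, m 0) \<in> r" "y = x" by auto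
      then show ?thesis using rD(2)[OF rD(2)[OF xm(1) mi] x'(3)] x'(4) by simp
    next
      case 2
      then obtain k where k: "k < 6" "x = m k" "y = p k" by auto
      then show ?thesis using rD(2)[OF mi x'(3)] ab pbound[OF k(1)] x'(4) by simp
    next
      case 3
      then show ?thesis using Tb[OF 3] ab x'(4) by simp
    qed
  qed
  let ?G = "?G0 \<union> ?M \<union> ?T \<union> ?G3"
  have foG: "drel ?G"
    unfolding drel_def Un_iff by (intro fo fiH foK fo_drel[OF T(1)] fo_finite_rel finite_imageI finite_lessThan)
  have mH: "m k \<in> H" for k unfolding m_def by (rule dH)
  have sub: "?G \<subseteq> H \<times> H"
    using mH pbound KH Tb(1,3) by auto
  have dom: "H \<subseteq> Domain ?G"
  proof
    fix z assume z: "z \<in> H"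
    consider "(z, m 0) \<in> r" | "le r (m 0) z" "(z, ?i) \<in> r" | "le r ?i z" "z \<in> K" | "le r ?i z" "z \<notin> K"
      using rD(10)[OF z mH] rD(10)[OF z I_H[OF i]] by metis
    then show "z \<in> Domain ?G"
    proof cases
      case 1
      then show ?thesis using z by auto
    next
      case 2
      have mK: "m 0 \<in> K" using parts_K(4)[OF d'(1)] unfolding m_def by simp
      have zK: "z \<in> K" using Kconv[OF mK i0K] z 2(1) rD(6)[OF 2(2)] unfolding seg_def by auto
      have bm: "(b, m 0) \<in> r" unfolding m_def by (rule Dn_greater[OF I_K[OF b] d'(1)])
      have "le r b z" by (rule rD(6)[OF rD(8)[OF bm 2(1)]])
      then have "z \<in> Aw b \<or> z \<in> Dn b" using parts[OF I_K[OF b] zK _ 2(2)] by simp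
      moreover have "z \<notin> Aw b"
      proof
        assume "z \<in> Aw b"
        then have "(z, m 0) \<in> r" unfolding m_def by (rule Aw_less_Dn[OF _ d'(1)])
        then show False using 2(1) rD(11) by simp
      qed
      ultimately have "z \<in> Dn b" by simp
      \<comment> \<open>The domain has no hole between \<open>m 0\<close> and \<open>nx b\<close>:
        consecutive terms of \<open>d\<close> are neighbours, so the only points there are the six
        that were treated.\<close>
      then have "z \<in> seg r H (d 5) (d 0)" using d(2) z 2(1) m0 unfolding seg_def by simp
      then have "z \<in> d ` {0..5}" using Dn_chain_seg[of b d 0 5, OF I_K[OF b] d'] by auto
      then obtain n where n: "n \<le> 5" "z = d n" by auto
      then have "z = m (5 - n)" unfolding m_def by simp
      then have "(z, p (5 - n)) \<in> ?M" by auto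
      then show ?thesis by auto
    next
      case 3
      then show ?thesis using Tt by auto
    next
      case 4
      then have "(?i, z) \<in> r" using i0K unfolding le_def by auto
      then show ?thesis using z 4(2) by auto
    qed
  qed
  have fin: "m k \<in> cls r H (m 0)" for k
  proof -
    have "fin r H (d 5) (d (5 - k))" by (rule chain_fin[of b d, OF I_K[OF b] d']) simp_all
    then show ?thesis unfolding cls_def m0 using mH by (simp add: m_def)
  qed
  have inf: "infc r H (m 0)" unfolding m0 by (rule chain_infc[of b d, OF I_K[OF b] d'])
  have up: "Up (p 0) (p 1) (p 2)" "Up (p 5) (p 4) (p 3)" unfolding pv using q(7) a(6) by simp_all
  have inG: "(m k, p k) \<in> ?G" if "k < 6" for k using that by auto
  have "bad_embedding ?G m p"
    unfolding bad_embedding_def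
    by (intro conjI foG mono3 sub dom inf up) (use inG fin mstep in simp_all)
  then show ?thesis by blast
qed

end

section \<open>The finite condensation\<close>

context zf_model begin

lemma sim_wo:
  assumes "sim G A r B s" "drel G" "iord A r" "iord B s" "wo r A" shows "wo s B"
proof (rule woI)
  fix N assume N: "internal N" "N \<subseteq> B" "N \<noteq> {}"
  let ?N = "{x \<in> A. \<exists>y \<in> N. (x, y) \<in> G}"
  have f: "fo (\<lambda>v. v 0 \<in> ?N)"
    by (intro fo fo_in_internal[OF iordD(1)[OF assms(3)]] fo_in_internal[OF N(1)] fo_drel[OF assms(2)])
  obtain y where y: "y \<in> N" using N(3) by auto
  then obtain x where "x \<in> A" "(x, y) \<in> G" using simD(2)[OF assms(1), of y] N(2) by auto
  then have "x \<in> ?N" using y by auto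
  then have ne: "?N \<noteq> {}" by (rule nonemptyI)
  obtain m where m: "m \<in> ?N" "\<forall>x \<in> ?N. x \<noteq> m \<longrightarrow> (m, x) \<in> r"
    using wo_least[OF assms(3,5) Collect_restrict f ne] by (elim bexE conjE)
  obtain y where y: "y \<in> N" "(m, y) \<in> G" using m(1) by auto
  have "(y, z) \<in> s" if z: "z \<in> N" "z \<noteq> y" for z
  proof -
    obtain x where x: "x \<in> A" "(x, z) \<in> G" using simD(2)[OF assms(1), of z] N(2) z(1) by auto
    have mA: "m \<in> A" "y \<in> B" "z \<in> B" using m(1) N(2) y(1) z(1) by auto
    have "x \<noteq> m" using sim_inj[OF assms(1,3,4) x(1) mA(1,3,2) x(2) y(2)] z(2) by simp
    then have "(m, x) \<in> r" using m(2) x z(1) by auto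
    then show ?thesis using simD(3)[OF assms(1) mA(1) x(1) mA(2,3) y(2) x(2)] by simp
  qed
  then show "\<exists>m \<in> N. \<forall>x \<in> N. x \<noteq> m \<longrightarrow> (m, x) \<in> s" using y(1) by auto
qed

lemma internal_btw: "iord X r \<Longrightarrow> internal (btw r X x y)"
  unfolding btw_def by (rule internal_filter[OF iordD(1)], assumption) (intro fo iordD(2))

lemma sim_le:
  assumes "sim G A r B s" "iord A r" "iord B s" "x \<in> A" "x' \<in> A" "y \<in> B" "y' \<in> B" "(x, y) \<in> G" "(x', y') \<in> G"
  shows "le r x x' \<longleftrightarrow> le s y y'"
  using simD(3)[OF assms(1,4-9)] sim_inj[OF assms] unfolding le_def by simp

lemma sim_btw:
  assumes "sim G A r B s" "iord A r" "iord B s" "x \<in> A" "x' \<in> A" "y \<in> B" "y' \<in> B" "(x, y) \<in> G" "(x', y') \<in> G"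
  shows "sim G (btw r A x x') r (btw s B y y') s"
proof (rule simI)
  note sl = sim_le[OF assms(1-3)]
  show "\<exists>v \<in> btw s B y y'. (u, v) \<in> G" if u: "u \<in> btw r A x x'" for u
  proof -
    have uA: "u \<in> A" using u unfolding btw_def by simp
    obtain v where v: "v \<in> B" "(u, v) \<in> G" using simD(1)[OF assms(1) uA] by (elim bexE)
    show ?thesis using u v sl[OF assms(4) uA assms(6) v(1) assms(8) v(2)] sl[OF uA assms(4) v(1) assms(6) v(2) assms(8)]
        sl[OF assms(5) uA assms(7) v(1) assms(9) v(2)] sl[OF uA assms(5) v(1) assms(7) v(2) assms(9)]
      unfolding btw_def by auto
  qed
  show "\<exists>u \<in> btw r A x x'. (u, v) \<in> G" if v: "v \<in> btw s B y y'" for v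
  proof -
    have vB: "v \<in> B" using v unfolding btw_def by simp
    obtain u where u: "u \<in> A" "(u, v) \<in> G" using simD(2)[OF assms(1) vB] by (elim bexE)
    show ?thesis using u v sl[OF assms(4) u(1) assms(6) vB assms(8) u(2)] sl[OF u(1) assms(4) vB assms(6) u(2) assms(8)]
        sl[OF assms(5) u(1) assms(7) vB assms(9) u(2)] sl[OF u(1) assms(5) vB assms(7) u(2) assms(9)]
      unfolding btw_def by auto
  qed
qed (rule simD(3)[OF assms(1)]; simp add: btw_def)

lemma sim_fin:
  assumes "sim G A r B s" "iord A r" "iord B s" "drel G"
    "x \<in> A" "x' \<in> A" "y \<in> B" "y' \<in> B" "(x, y) \<in> G" "(x', y') \<in> G"
  shows "fin r A x x' \<longleftrightarrow> fin s B y y'"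
proof -
  let ?A = "btw r A x x'" and ?B = "btw s B y y'"
  have s: "sim G ?A r ?B s" by (rule sim_btw[OF assms(1-3,5-10)])
  have io: "iord ?A r" "iord ?B s"
    by (rule iord_subset[OF assms(2) _ internal_btw[OF assms(2)]], simp add: btw_def)
      (rule iord_subset[OF assms(3) _ internal_btw[OF assms(3)]], simp add: btw_def)
  have dc: "drel (G\<inverse>)" using assms(4) by simp
  note ioc = iord_converse[OF io(1)] iord_converse[OF io(2)]
  show ?thesis unfolding fin_def
    using sim_wo[OF s assms(4) io] sim_wo[OF sim_converse[OF s] dc io(2,1)]
      sim_wo[OF sim_reverse[OF s] assms(4) ioc] sim_wo[OF sim_converse[OF sim_reverse[OF s]] dc ioc(2,1)]
    by metis
qed

lemma sim_no_min:
  assumes "sim G C r C' s" "\<forall>z \<in> C. \<exists>y \<in> C. (y, z) \<in> r" shows "\<forall>z \<in> C'. \<exists>y \<in> C'. (y, z) \<in> s"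
proof
  fix z assume z: "z \<in> C'"
  obtain x where x: "x \<in> C" "(x, z) \<in> G" using simD(2)[OF assms(1) z] by (elim bexE)
  obtain x' where x': "x' \<in> C" "(x', x) \<in> r" using bspec[OF assms(2) x(1)] by (elim bexE)
  obtain z' where z': "z' \<in> C'" "(x', z') \<in> G" using simD(1)[OF assms(1) x'(1)] by (elim bexE)
  have "(z', z) \<in> s" using simD(3)[OF assms(1) x'(1) x(1) z'(1) z z'(2) x(2)] x'(2) by simp
  then show "\<exists>y \<in> C'. (y, z) \<in> s" using z'(1) by auto
qed

text \<open>Finite distance is an order invariant. So the classes of a copy of \<open>H\<close>, and
  whether they are infinite, can be computed in \<open>H\<close>.\<close>

lemma sim_cls:
  assumes "sim G A r B s" "iord A r" "iord B s" "drel G" "x \<in> A" "y \<in> B" "(x, y) \<in> G"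
  shows "x' \<in> A \<Longrightarrow> y' \<in> B \<Longrightarrow> (x', y') \<in> G \<Longrightarrow> x' \<in> cls r A x \<longleftrightarrow> y' \<in> cls s B y"
    and "infc r A x \<longleftrightarrow> infc s B y"
proof -
  show 1: "x' \<in> cls r A x \<longleftrightarrow> y' \<in> cls s B y" if "x' \<in> A" "y' \<in> B" "(x', y') \<in> G" for x' y'
    using sim_fin[OF assms(1-4,5) that(1) assms(6) that(2) assms(7) that(3)] that unfolding cls_def by simp
  have AA: "z \<in> A" if "z \<in> cls r A x" for z using that unfolding cls_def by simp
  have BB: "z \<in> B" if "z \<in> cls s B y" for z using that unfolding cls_def by simp
  have S: "sim G (cls r A x) r (cls s B y) s"
  proof (rule simI)
    show "\<exists>v \<in> cls s B y. (u, v) \<in> G" if "u \<in> cls r A x" for u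
      using simD(1)[OF assms(1) AA[OF that]] 1[OF AA[OF that]] that by metis
    show "\<exists>u \<in> cls r A x. (u, v) \<in> G" if "v \<in> cls s B y" for v
      using simD(2)[OF assms(1) BB[OF that]] 1[OF _ BB[OF that]] that by metis
    show "(u, u') \<in> r \<longleftrightarrow> (v, v') \<in> s"
      if "u \<in> cls r A x" "u' \<in> cls r A x" "v \<in> cls s B y" "v' \<in> cls s B y" "(u, v) \<in> G" "(u', v') \<in> G" for u u' v v'
      by (rule simD(3)[OF assms(1) AA[OF that(1)] AA[OF that(2)] BB[OF that(3)] BB[OF that(4)] that(5,6)])
  qed
  have "(\<forall>z \<in> cls r A x. \<exists>y \<in> cls r A x. (y, z) \<in> r) \<longleftrightarrow> (\<forall>z \<in> cls s B y. \<exists>u \<in> cls s B y. (u, z) \<in> s)"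
    using sim_no_min[OF S] sim_no_min[OF sim_converse[OF S]] by (rule iffI)
  moreover have "(\<forall>z \<in> cls r A x. \<exists>y \<in> cls r A x. (z, y) \<in> r) \<longleftrightarrow> (\<forall>z \<in> cls s B y. \<exists>u \<in> cls s B y. (z, u) \<in> s)"
    using sim_no_min[OF sim_reverse[OF S]] sim_no_min[OF sim_converse[OF sim_reverse[OF S]]]
    unfolding converse_iff by (rule iffI)
  ultimately show "infc r A x \<longleftrightarrow> infc s B y" unfolding infc_def by simp
qed

end

context branching begin

text \<open>The colouring: to the left of some centre each infinite class is a comb growing to the left, to the
  right of it a comb growing to the right.\<close>

definition nice :: "('a \<times> 'a) set \<Rightarrow> 'a set \<Rightarrow> bool" where
  "nice r X \<longleftrightarrow> (\<forall>x \<in> X. infc r X x \<longrightarrow> (\<exists>c \<in> cls r X x. \<forall>a \<in> cls r X x. \<forall>b \<in> cls r X x. \<forall>d \<in> cls r X x.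
     (a, b) \<in> r \<and> (b, d) \<in> r \<longrightarrow> (le r d c \<longrightarrow> Up d b a) \<and> ((c, a) \<in> r \<longrightarrow> Up a b d)))"

end

context lin begin

lemma fo_btw [fo]: "ft s \<Longrightarrow> ft t \<Longrightarrow> ft u \<Longrightarrow> fo (\<lambda>v. s v \<in> btw r H (t v) (u v))"
  unfolding btw_def by (intro fo fiH)

lemma fo_fin [fo]: "ft s \<Longrightarrow> ft t \<Longrightarrow> fo (\<lambda>v. fin r H (s v) (t v))"
  by (rule fo_rel2[where R = "fin r H"]) (unfold fin_def, intro fo fiH)

lemma fo_cls [fo]: "ft s \<Longrightarrow> ft t \<Longrightarrow> fo (\<lambda>v. s v \<in> cls r H (t v))"
  unfolding cls_def by (intro fo fiH)

lemma fo_infc [fo]: "ft t \<Longrightarrow> fo (\<lambda>v. infc r H (t v))"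
  by (rule fo_subst[where P = "\<lambda>v. infc r H"]) (unfold infc_def, intro fo fiH)

lemma fin_refl: "fin r H x x"
proof -
  have "btw r H x x \<subseteq> {x}" unfolding btw_def using rD(12) by auto
  then show ?thesis unfolding fin_def using wo_subset[OF wo_singleton] by metis
qed

lemma fin_sym: "fin r H x y \<longleftrightarrow> fin r H y x"
  unfolding fin_def btw_def by (simp add: disj_commute)

lemma btw_H: "btw r H x y \<subseteq> H" unfolding btw_def by auto

lemma fin_mono: "btw r H x y \<subseteq> btw r H x' y' \<Longrightarrow> fin r H x' y' \<Longrightarrow> fin r H x y"
  unfolding fin_def using wo_subset by metis

lemma btw_Un:
  assumes "x \<in> H" "y \<in> H" "z \<in> H" shows "btw r H x z \<subseteq> btw r H x y \<union> btw r H y z"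
proof
  fix u assume u: "u \<in> btw r H x z"
  then have uH: "u \<in> H" using btw_H by auto
  show "u \<in> btw r H x y \<union> btw r H y z"
  proof (cases "le r u y")
    case True
    then show ?thesis using u uH unfolding btw_def by auto
  next
    case False
    then have "le r y u" using rD(6)[OF rD(9)[OF uH assms(2)]] by simp
    then show ?thesis using u uH unfolding btw_def by auto
  qed
qed

lemma fin_trans: assumes "x \<in> H" "y \<in> H" "z \<in> H" "fin r H x y" "fin r H y z" shows "fin r H x z"
proof -
  have f: "fo (\<lambda>v. v 0 \<in> btw r H a b)" for a b by (intro fo)
  have s: "btw r H x y \<union> btw r H y z \<subseteq> H" using btw_H by simp
  show ?thesis unfolding fin_def
    using wo_subset[OF wo_Un[OF H s f f] btw_Un[OF assms(1-3)]]
      wo_subset[OF wo_Un[OF iord_converse[OF H] s f f] btw_Un[OF assms(1-3)]] assms(4,5)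
    unfolding fin_def by simp
qed

lemma cls_H: "y \<in> cls r H x \<Longrightarrow> y \<in> H" unfolding cls_def by simp

lemma cls_self: "x \<in> H \<Longrightarrow> x \<in> cls r H x" unfolding cls_def using fin_refl by simp

lemma cls_eq: assumes "x \<in> H" "y \<in> cls r H x" shows "cls r H y = cls r H x"
proof -
  have y: "y \<in> H" "fin r H x y" "fin r H y x" using assms fin_sym unfolding cls_def by auto
  have "fin r H x z \<longleftrightarrow> fin r H y z" if "z \<in> H" for z
    using fin_trans[OF assms(1) y(1) that y(2)] fin_trans[OF y(1) assms(1) that y(3)] by metis
  then show ?thesis unfolding cls_def by auto
qed

lemma infc_eq: "x \<in> H \<Longrightarrow> y \<in> cls r H x \<Longrightarrow> infc r H y \<longleftrightarrow> infc r H x"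
  unfolding infc_def by (simp add: cls_eq)

lemma internal_cls: "internal (cls r H x)"
  by (rule internal_sep[OF iordD(1)[OF H]], rule subsetI, rule cls_H, assumption, intro fo)

lemma cls_convex:
  assumes "x \<in> H" "y \<in> cls r H x" "le r x z" "le r z y" "z \<in> H" shows "z \<in> cls r H x"
proof -
  have "btw r H x z \<subseteq> btw r H x y"
  proof
    fix u assume u: "u \<in> btw r H x z"
    have "le r x u \<and> le r u y"
      using u rD(5)[OF _ assms(4)] rD(5)[OF assms(3)] rD(12)[OF _ assms(3)] rD(5)[of z u x] assms(3,4) unfolding btw_def by auto
    then show "u \<in> btw r H x y" using u unfolding btw_def by simp
  qed
  then show ?thesis using fin_mono assms(2,5) unfolding cls_def by simp
qed

lemma cls_less:
  assumes "x \<in> H" "x' \<in> H" "(x, x') \<in> r" "x' \<notin> cls r H x" "y \<in> cls r H x" "y' \<in> cls r H x'"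
  shows "(y, y') \<in> r"
proof (rule ccontr)
  assume neg: "(y, y') \<notin> r"
  have yH: "y \<in> H" "y' \<in> H" by (rule cls_H[OF assms(5)], rule cls_H[OF assms(6)])
  have yy: "le r y' y" by (rule rD(10)[OF yH neg])
  have e: "cls r H y = cls r H x" "cls r H y' = cls r H x'" by (rule cls_eq[OF assms(1,5)], rule cls_eq[OF assms(2,6)])
  have dis: False if z: "z \<in> cls r H x" "z \<in> cls r H x'" for z
    using cls_eq[OF assms(1) z(1)] cls_eq[OF assms(2) z(2)] cls_self[OF assms(2)] assms(4) by simp
  show False
  proof (cases "le r x y'")
    case True
    have "y' \<in> cls r H x" by (rule cls_convex[OF assms(1,5) True yy yH(2)])
    then show False by (rule dis[OF _ assms(6)])
  next
    case False
    then have "(y', x) \<in> r" by (rule rD(9)[OF assms(1) yH(2)])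
    then have "le r y' x" by (rule rD(6))
    moreover have "x' \<in> cls r H y'" unfolding e(2) by (rule cls_self[OF assms(2)])
    ultimately have "x \<in> cls r H y'" using cls_convex[OF yH(2) _ _ rD(6)[OF assms(3)] assms(1)] by simp
    then show False using dis[of x] e(2) cls_self[OF assms(1)] by simp
  qed
qed

text \<open>All intervals from \<open>c\<close> to a point of \<open>R\<close> are well-ordered in
  both directions. Below any of its elements a subset of \<open>R\<close> therefore has a least
  element, and each proper initial segment of \<open>R\<close> is reverse well-ordered.\<close>

lemma half_om:
  assumes c: "c \<in> H" and R: "internal R" "R \<subseteq> cls r H c" "\<And>u. u \<in> R \<Longrightarrow> le r c u"
    "\<And>u. u \<in> R \<Longrightarrow> \<exists>v \<in> R. (u, v) \<in> r"
  shows "om r R"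
  unfolding om_def
proof (intro conjI ballI)
  have RH: "u \<in> H" if "u \<in> R" for u using R(2) that cls_H by auto
  have f: "wo r (btw r H c u)" "wo (r\<inverse>) (btw r H c u)" if "u \<in> R" for u
    using R(2) that unfolding cls_def fin_def by auto
  show "wo r R"
  proof (rule woI)
    fix N assume N: "internal N" "N \<subseteq> R" "N \<noteq> {}"
    then obtain u where u: "u \<in> N" by auto
    have uR: "u \<in> R" using u N(2) by auto
    have i: "internal {y \<in> N. le r y u}" by (rule internal_filter[OF N(1)]) (intro fo fiH)
    have s: "{y \<in> N. le r y u} \<subseteq> btw r H c u" using N(2) RH R(3) unfolding btw_def by auto
    have "u \<in> {y \<in> N. le r y u}" using u by simp
    then have ne: "{y \<in> N. le r y u} \<noteq> {}" by (rule nonemptyI)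
    obtain m where m: "m \<in> {y \<in> N. le r y u}" "\<forall>y \<in> {y \<in> N. le r y u}. y \<noteq> m \<longrightarrow> (m, y) \<in> r"
      using wo_min[OF f(1)[OF uR] i s ne] by (elim bexE)
    have "(m, y) \<in> r" if y: "y \<in> N" "y \<noteq> m" for y
    proof (cases "le r y u")
      case False
      have yH: "y \<in> H" using y(1) N(2) RH by auto
      have "(u, y) \<in> r" by (rule rD(9)[OF yH RH[OF uR] False])
      then show ?thesis using rD(7)[of m u y] m(1) by simp
    qed (use m(2) y in simp)
    then show "\<exists>m \<in> N. \<forall>y \<in> N. y \<noteq> m \<longrightarrow> (m, y) \<in> r" using m(1) by auto
  qed
  show "\<exists>v \<in> R. (u, v) \<in> r" if "u \<in> R" for u by (rule R(4)[OF that])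
  show "wo (r\<inverse>) {z \<in> R. (z, x) \<in> r}" if "x \<in> R" for x
    by (rule wo_subset[OF f(2)[OF that]]) (use RH R(3) rD(6) in \<open>auto simp: btw_def\<close>)
qed

end

section \<open>Thinning all infinite classes\<close>

context lin begin

text \<open>The centre is an endpoint of the class if there is one. So the part to its left is trivial or has
  no minimum, and the part to its right is empty or has no maximum.\<close>

definition centre_of :: "'a set \<Rightarrow> 'a" where
  "centre_of C = the1 (\<lambda>c. c \<in> C \<and> ((\<forall>u \<in> C. le r u c) \<or> \<not> (\<exists>m \<in> C. \<forall>u \<in> C. le r u m) \<and>
     ((\<forall>u \<in> C. le r c u) \<or> \<not> (\<exists>m \<in> C. \<forall>u \<in> C. le r m u) \<and> (\<forall>u \<in> C. u \<noteq> c \<longrightarrow> (c, u) \<in> w))))"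

definition centre :: "'a \<Rightarrow> 'a" where "centre x = centre_of (cls r H x)"

text \<open>The centre counts as left. If it is the maximum, the right half is empty; if it is the
  minimum, the left half is a single point; in both remaining directions an infinite class goes on
  forever.\<close>

definition right_half :: "'a \<Rightarrow> 'a set" where "right_half x = {u \<in> cls r H x. (centre x, u) \<in> r}"

definition left_half :: "'a \<Rightarrow> 'a set" where "left_half x = {u \<in> cls r H x. le r u (centre x)}"

lemma ft_centre [fo]: assumes "ft t" shows "ft (\<lambda>v. centre (t v))"
  unfolding centre_def centre_of_def
  by (intro fo fiH assms ft_ren[OF assms, of Suc] ft_ren[OF assms, of "\<lambda>n. Suc (Suc n)"]
      ft_ren[OF assms, of "\<lambda>n. Suc (Suc (Suc n))"])

lemma fo_right_half [fo]: "ft s \<Longrightarrow> ft t \<Longrightarrow> fo (\<lambda>v. s v \<in> right_half (t v))"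
  unfolding right_half_def by (intro fo fiH)

lemma fo_left_half [fo]: "ft s \<Longrightarrow> ft t \<Longrightarrow> fo (\<lambda>v. s v \<in> left_half (t v))"
  unfolding left_half_def by (intro fo fiH)

lemma centre_of:
  assumes "C \<subseteq> H" "internal C" "C \<noteq> {}"
  shows "centre_of C \<in> C" "\<exists>u \<in> C. (centre_of C, u) \<in> r \<Longrightarrow> u \<in> C \<Longrightarrow> \<exists>v \<in> C. (u, v) \<in> r"
    "\<not> (\<forall>u \<in> C. le r u (centre_of C)) \<Longrightarrow> \<exists>u \<in> C. (u, centre_of C) \<in> r \<Longrightarrow> u \<in> C \<Longrightarrow> \<exists>v \<in> C. (v, u) \<in> r"
proof -
  let ?mx = "\<lambda>c. \<forall>u \<in> C. le r u c" and ?mn = "\<lambda>c. \<forall>u \<in> C. le r c u"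
  let ?P = "\<lambda>c. c \<in> C \<and> (?mx c \<or> \<not> (\<exists>m \<in> C. ?mx m) \<and> (?mn c \<or> \<not> (\<exists>m \<in> C. ?mn m) \<and> (\<forall>u \<in> C. u \<noteq> c \<longrightarrow> (c, u) \<in> w)))"
  have f: "fo (\<lambda>v. v 0 \<in> C)" by (intro fo_in_internal assms(2) fo)
  obtain m where m: "m \<in> C" "\<forall>u \<in> C. u \<noteq> m \<longrightarrow> (m, u) \<in> w"
    using wo_least[OF w assms(1) f assms(3)] by (elim bexE conjE)
  have ex: "\<exists>c. ?P c" using m by metis
  have uniq: "c = c'" if "?P c" "?P c'" for c c'
    using that rD(12) iordD(5)[OF w(1)] by metis
  have P: "?P (centre_of C)" unfolding centre_of_def by (rule the1I) (rule ex_ex1I[OF ex], rule uniq)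
  show "centre_of C \<in> C" using P by simp
  have up: "\<exists>v \<in> C. (u, v) \<in> r" if "\<not> (\<exists>m \<in> C. ?mx m)" "u \<in> C" for u
    using that rD(9) assms(1) by (metis subsetD)
  have dn: "\<exists>v \<in> C. (v, u) \<in> r" if "\<not> (\<exists>m \<in> C. ?mn m)" "u \<in> C" for u
    using that rD(9) assms(1) by (metis subsetD)
  show "\<exists>v \<in> C. (u, v) \<in> r" if "\<exists>u \<in> C. (centre_of C, u) \<in> r" "u \<in> C"
    using P up that rD(11) by metis
  show "\<exists>v \<in> C. (v, u) \<in> r" if "\<not> ?mx (centre_of C)" "\<exists>u \<in> C. (u, centre_of C) \<in> r" "u \<in> C"
    using P dn that rD(11) by metis
qed

context
  fixes x
  assumes x: "x \<in> H" and inf: "infc r H x"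
begin

lemma C_facts: "cls r H x \<subseteq> H" "internal (cls r H x)" "cls r H x \<noteq> {}"
  using cls_H internal_cls cls_self[OF x] by auto

lemma centre_cls: "centre x \<in> cls r H x" unfolding centre_def by (rule centre_of(1)[OF C_facts])

lemma centre_H: "centre x \<in> H" by (rule cls_H[OF centre_cls])

lemma cls_centre: "cls r H (centre x) = cls r H x" by (rule cls_eq[OF x centre_cls])

lemma sub_halves: "right_half x \<subseteq> cls r H (centre x)" "left_half x \<subseteq> cls r H (centre x)"
  unfolding cls_centre unfolding right_half_def left_half_def by auto

lemma internal_halves: "internal (right_half x)" "internal (left_half x)"
  unfolding right_half_def left_half_def by (intro internal_filter[OF internal_cls] fo fiH)+

lemma right_half_no_max: assumes u: "u \<in> right_half x" shows "\<exists>v \<in> right_half x. (u, v) \<in> r"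
proof -
  have u': "u \<in> cls r H x" "(centre x, u) \<in> r" using u unfolding right_half_def by simp_all
  have "\<exists>v \<in> cls r H x. (u, v) \<in> r"
    by (rule centre_of(2)[OF C_facts _ u'(1)]) (use u' in \<open>auto simp: centre_def\<close>)
  then obtain v where v: "v \<in> cls r H x" "(u, v) \<in> r" by (elim bexE)
  have "(centre x, v) \<in> r" by (rule rD(2)[OF u'(2) v(2)])
  then show ?thesis using v unfolding right_half_def by auto
qed

lemma left_half_no_min: assumes e: "e \<in> left_half x" "(e, centre x) \<in> r" and u: "u \<in> left_half x" shows "\<exists>v \<in> left_half x. (v, u) \<in> r"
proof -
  have u': "u \<in> cls r H x" "le r u (centre x)" using u unfolding left_half_def by simp_all
  have e': "\<exists>u \<in> cls r H x. (u, centre x) \<in> r" using e unfolding left_half_def by auto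
  have "\<exists>v \<in> cls r H x. (v, u) \<in> r"
  \<comment> \<open>A class that is infinite and has the centre as its maximum can only be infinite
    downwards.\<close>
  proof (cases "\<forall>u \<in> cls r H x. le r u (centre x)")
    case True
    have "\<not> (\<forall>z \<in> cls r H x. \<exists>y \<in> cls r H x. (z, y) \<in> r)"
      using True centre_cls rD(11) by metis
    then show ?thesis using inf u'(1) unfolding infc_def by metis
  next
    case False
    show ?thesis by (rule centre_of(3)[OF C_facts _ _ u'(1)]) (use False e' in \<open>auto simp: centre_def\<close>)
  qed
  then obtain v where v: "v \<in> cls r H x" "(v, u) \<in> r" by (elim bexE)
  have "le r v (centre x)" by (rule rD(6)[OF rD(8)[OF v(2) u'(2)]])
  then show ?thesis using v unfolding left_half_def by auto
qed

lemma right_half_om: "om r (right_half x)"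
  by (rule half_om[OF centre_H internal_halves(1) sub_halves(1) _ right_half_no_max])
    (rule rD(6), simp add: right_half_def)

lemma left_half_om: assumes "e \<in> left_half x" "(e, centre x) \<in> r" shows "om (r\<inverse>) (left_half x)"
proof (rule lin.half_om[OF lin_converse centre_H internal_halves(2)])
  show "left_half x \<subseteq> cls (r\<inverse>) H (centre x)" using sub_halves(2) by simp
  show "le (r\<inverse>) (centre x) u" if "u \<in> left_half x" for u using that unfolding left_half_def by simp
  show "\<exists>v \<in> left_half x. (u, v) \<in> r\<inverse>" if "u \<in> left_half x" for u using left_half_no_min[OF assms that] by simp
qed

lemma halves_H: "u \<in> right_half x \<Longrightarrow> u \<in> H" "u \<in> left_half x \<Longrightarrow> u \<in> H"
  using cls_H[of u x] unfolding right_half_def left_half_def by simp_all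

lemma iord_halves: "iord (right_half x) r" "iord (left_half x) (r\<inverse>)"
  by (rule iord_subset[OF H _ internal_halves(1)], rule subsetI, rule halves_H(1), assumption)
    (rule iord_converse[OF iord_subset[OF H _ internal_halves(2)]], rule subsetI, rule halves_H(2))

lemma inj_halves:
  "a \<in> right_half x \<Longrightarrow> b \<in> right_half x \<Longrightarrow> a \<noteq> b \<Longrightarrow> \<exists>d \<in> D. ((d, a) \<in> bit) \<noteq> ((d, b) \<in> bit)"
  "a \<in> left_half x \<Longrightarrow> b \<in> left_half x \<Longrightarrow> a \<noteq> b \<Longrightarrow> \<exists>d \<in> D. ((d, a) \<in> bit) \<noteq> ((d, b) \<in> bit)"
  by (rule inj; (rule halves_H)?; assumption)+

lemma thin_sub: "thin r (right_half x) \<subseteq> right_half x" "thin (r\<inverse>) (left_half x) \<subseteq> left_half x"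
  unfolding thin_def by auto

lemma right_half_sim:
  assumes "right_half x \<noteq> {}" shows "sim (cmp (right_half x) r (thin r (right_half x)) r) (right_half x) r (thin r (right_half x)) r"
    "a \<in> thin r (right_half x) \<Longrightarrow> b \<in> thin r (right_half x) \<Longrightarrow> c \<in> thin r (right_half x) \<Longrightarrow> (a, b) \<in> r \<Longrightarrow> (b, c) \<in> r \<Longrightarrow> Up a b c"
    "internal (thin r (right_half x))"
proof -
  note t = thin_unbounded[OF iord_halves(1) right_half_om assms inj_halves(1)]
    thin_Up[OF iord_halves(1) right_half_om assms inj_halves(1)]
    internal_thin[OF iord_halves(1) right_half_om assms inj_halves(1)]
  show i: "internal (thin r (right_half x))" by (rule t(3))
  show "sim (cmp (right_half x) r (thin r (right_half x)) r) (right_half x) r (thin r (right_half x)) r"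
    by (rule om_cmp[OF iord_halves(1) right_half_om thin_sub(1) i]) (rule ballI, rule t(1))
  show "a \<in> thin r (right_half x) \<Longrightarrow> b \<in> thin r (right_half x) \<Longrightarrow> c \<in> thin r (right_half x) \<Longrightarrow> (a, b) \<in> r \<Longrightarrow> (b, c) \<in> r \<Longrightarrow> Up a b c"
    by (rule t(2))
qed

lemma left_half_sim:
  assumes "e \<in> left_half x" "(e, centre x) \<in> r"
  shows "sim (cmp (left_half x) (r\<inverse>) (thin (r\<inverse>) (left_half x)) (r\<inverse>)) (left_half x) (r\<inverse>) (thin (r\<inverse>) (left_half x)) (r\<inverse>)"
    "a \<in> thin (r\<inverse>) (left_half x) \<Longrightarrow> b \<in> thin (r\<inverse>) (left_half x) \<Longrightarrow> c \<in> thin (r\<inverse>) (left_half x) \<Longrightarrow> (a, b) \<in> r \<Longrightarrow> (b, c) \<in> r \<Longrightarrow> Up c b a"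
    "internal (thin (r\<inverse>) (left_half x))"
proof -
  have ne: "left_half x \<noteq> {}" using assms(1) by auto
  note om = left_half_om[OF assms]
  note t = thin_unbounded[OF iord_halves(2) om ne inj_halves(2)]
    thin_Up[OF iord_halves(2) om ne inj_halves(2)]
    internal_thin[OF iord_halves(2) om ne inj_halves(2)]
  show i: "internal (thin (r\<inverse>) (left_half x))" by (rule t(3))
  show "sim (cmp (left_half x) (r\<inverse>) (thin (r\<inverse>) (left_half x)) (r\<inverse>)) (left_half x) (r\<inverse>) (thin (r\<inverse>) (left_half x)) (r\<inverse>)"
    by (rule om_cmp[OF iord_halves(2) om thin_sub(2) i]) (rule ballI, rule t(1))
  show "Up c b a" if "a \<in> thin (r\<inverse>) (left_half x)" "b \<in> thin (r\<inverse>) (left_half x)" "c \<in> thin (r\<inverse>) (left_half x)" "(a, b) \<in> r" "(b, c) \<in> r"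
    by (rule t(2)[OF _ _ _ that(3,2,1)]) (use that(4,5) in simp_all)
qed

end

text \<open>The halves, their combs and the comparison maps are all determined by the point
  \<open>x\<close>, so one formula treats all classes. Finite classes and left halves that consist
  of the centre alone stay fixed.\<close>

definition thin_map :: "('a \<times> 'a) set" where
  "thin_map = {(x, y). x \<in> H \<and> y \<in> H \<and> (if infc r H x
     then if (centre x, x) \<in> r then (x, y) \<in> cmp (right_half x) r (thin r (right_half x)) r
       else if \<exists>e \<in> left_half x. (e, centre x) \<in> r then (x, y) \<in> cmp (left_half x) (r\<inverse>) (thin (r\<inverse>) (left_half x)) (r\<inverse>)
       else y = x
     else y = x)}"

lemma drel_thin_map: "drel thin_map"
  unfolding drel_def thin_map_def if_bool_eq_conj
  by (intro fo fiH)

lemma thin_map_cases: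
  assumes "(x, y) \<in> thin_map"
  obtains "\<not> infc r H x" "y = x"
    | "infc r H x" "(centre x, x) \<in> r" "(x, y) \<in> cmp (right_half x) r (thin r (right_half x)) r" "x \<in> right_half x" "y \<in> thin r (right_half x)" "y \<in> right_half x"
    | e where "infc r H x" "e \<in> left_half x" "(e, centre x) \<in> r" "(x, y) \<in> cmp (left_half x) (r\<inverse>) (thin (r\<inverse>) (left_half x)) (r\<inverse>)"
      "x \<in> left_half x" "y \<in> thin (r\<inverse>) (left_half x)" "y \<in> left_half x"
    | "infc r H x" "left_half x \<subseteq> {centre x}" "y = x" "x \<in> left_half x"
proof -
  have xH: "x \<in> H" using assms unfolding thin_map_def by simp
  consider "\<not> infc r H x" | "infc r H x" "(centre x, x) \<in> r" | "infc r H x" "(centre x, x) \<notin> r" "\<exists>e \<in> left_half x. (e, centre x) \<in> r"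
    | "infc r H x" "(centre x, x) \<notin> r" "\<not> (\<exists>e \<in> left_half x. (e, centre x) \<in> r)" by metis
  then show thesis
  proof cases
    case 1
    then show ?thesis using that(1) assms unfolding thin_map_def by simp
  next
    case 2
    then have c: "(x, y) \<in> cmp (right_half x) r (thin r (right_half x)) r" using assms unfolding thin_map_def by simp
    show ?thesis
      by (rule that(2)[OF 2 c cmpD(1)[OF c] cmpD(2)[OF c] subsetD[OF thin_sub(1)[OF xH 2(1)] cmpD(2)[OF c]]])
  next
    case 3
    then have c: "(x, y) \<in> cmp (left_half x) (r\<inverse>) (thin (r\<inverse>) (left_half x)) (r\<inverse>)" using assms unfolding thin_map_def by simp
    obtain e where e: "e \<in> left_half x" "(e, centre x) \<in> r" using 3(3) by (elim bexE)
    show ?thesis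
      by (rule that(3)[OF 3(1) e c cmpD(1)[OF c] cmpD(2)[OF c] subsetD[OF thin_sub(2)[OF xH 3(1)] cmpD(2)[OF c]]])
  next
    case 4
    have "le r x (centre x)" by (rule rD(10)[OF centre_H[OF xH 4(1)] xH 4(2)])
    then have "x \<in> left_half x" using cls_self[OF xH] unfolding left_half_def by simp
    moreover have "left_half x \<subseteq> {centre x}" using 4(3) unfolding left_half_def le_def by auto
    moreover have "y = x" using 4 assms unfolding thin_map_def by simp
    ultimately show ?thesis using that(4) 4(1) by simp
  qed
qed

lemma thin_map_H: "(x, y) \<in> thin_map \<Longrightarrow> x \<in> H" "(x, y) \<in> thin_map \<Longrightarrow> y \<in> H" unfolding thin_map_def by simp_all

lemma thin_map_cls: assumes "(x, y) \<in> thin_map" shows "y \<in> cls r H x"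
  using assms
  by (cases rule: thin_map_cases) (use cls_self[OF thin_map_H(1)[OF assms]] in \<open>auto simp: right_half_def left_half_def\<close>)

lemma thin_map_total: assumes x: "x \<in> H" shows "\<exists>y. (x, y) \<in> thin_map"
proof -
  consider "\<not> infc r H x" | "infc r H x" "(centre x, x) \<in> r" | "infc r H x" "(centre x, x) \<notin> r" "\<exists>e \<in> left_half x. (e, centre x) \<in> r"
    | "infc r H x" "(centre x, x) \<notin> r" "\<not> (\<exists>e \<in> left_half x. (e, centre x) \<in> r)" by metis
  then show ?thesis
  proof cases
    case 2
    then have xR: "x \<in> right_half x" using cls_self[OF x] unfolding right_half_def by simp
    then have ne: "right_half x \<noteq> {}" by (rule nonemptyI)
    obtain y where y: "y \<in> thin r (right_half x)" "(x, y) \<in> cmp (right_half x) r (thin r (right_half x)) r"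
      using simD(1)[OF right_half_sim(1)[OF x 2(1) ne] xR] by (elim bexE)
    have "y \<in> H" using halves_H(1)[OF x 2(1)] subsetD[OF thin_sub(1)[OF x 2(1)] y(1)] by simp
    then show ?thesis using 2 x y(2) unfolding thin_map_def by auto
  next
    case 3
    obtain e where e: "e \<in> left_half x" "(e, centre x) \<in> r" using 3(3) by (elim bexE)
    have "le r x (centre x)" by (rule rD(10)[OF centre_H[OF x 3(1)] x 3(2)])
    then have xL: "x \<in> left_half x" using cls_self[OF x] unfolding left_half_def by simp
    obtain y where y: "y \<in> thin (r\<inverse>) (left_half x)" "(x, y) \<in> cmp (left_half x) (r\<inverse>) (thin (r\<inverse>) (left_half x)) (r\<inverse>)"
      using simD(1)[OF left_half_sim(1)[OF x 3(1) e] xL] by (elim bexE)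
    have "y \<in> H" using halves_H(2)[OF x 3(1)] subsetD[OF thin_sub(2)[OF x 3(1)] y(1)] by simp
    then show ?thesis using 3 x y(2) unfolding thin_map_def by auto
  qed (use x in \<open>auto simp: thin_map_def\<close>)
qed

lemma cls_same:
  assumes "x \<in> H" "x' \<in> cls r H x"
  shows "centre x' = centre x" "right_half x' = right_half x" "left_half x' = left_half x" "infc r H x' = infc r H x"
  unfolding right_half_def left_half_def centre_def infc_def cls_eq[OF assms] by (rule refl)+

lemma thin_map_mono_same:
  assumes "(x, y) \<in> thin_map" "(x', y') \<in> thin_map" "x' \<in> cls r H x"
  shows "(x, x') \<in> r \<longleftrightarrow> (y, y') \<in> r"
proof (cases "infc r H x")
  case False
  note s = cls_same[OF thin_map_H(1)[OF assms(1)] assms(3)]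
  show ?thesis using assms(1,2) False s(4) unfolding thin_map_def by simp
next
  case inf: True
  note xH = thin_map_H(1)[OF assms(1)]
  note s = cls_same[OF xH assms(3)]
  note cR = right_half_sim(1)[OF xH inf] and cL = left_half_sim(1)[OF xH inf]
  have RL: "(l, g) \<in> r \<and> (g, l) \<notin> r" if "l \<in> left_half x" "g \<in> right_half x" for l g
  proof -
    have "(l, g) \<in> r" using that rD(7)[of l "centre x" g] unfolding left_half_def right_half_def by simp
    then show ?thesis using rD(3) by simp
  qed
  have L1: "(a, b) \<notin> r" if "left_half x \<subseteq> {centre x}" "a \<in> left_half x" "b \<in> left_half x" for a b
    using that rD(1) by auto
  have nE: "\<not> (e \<in> left_half x \<and> (e, centre x) \<in> r)" if "left_half x \<subseteq> {centre x}" for e using that rD(1) by auto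
  from assms(1) show ?thesis
  proof (cases rule: thin_map_cases)
    case 1
    then show ?thesis using inf by simp
  next
    case x: 2
    have ne: "right_half x \<noteq> {}" using x(4) by auto
    from assms(2) show ?thesis
    proof (cases rule: thin_map_cases)
      case 1
      then show ?thesis using inf s(4) by simp
    next
      case 2
      note 2 = 2[unfolded s]
      show ?thesis by (rule simD(3)[OF cR[OF ne] x(4) 2(4) x(5) 2(5) x(3) 2(3)])
    next
      case (3 e)
      note 3 = 3[unfolded s]
      show ?thesis using RL[OF 3(5) x(4)] RL[OF 3(7) x(6)] by simp
    next
      case 4
      note 4 = 4[unfolded s]
      show ?thesis using RL[OF 4(4) x(4)] RL[OF _ x(6), of y'] 4 by simp
    qed
  next
    case x: (3 e)
    from assms(2) show ?thesis
    proof (cases rule: thin_map_cases)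
      case 1
      then show ?thesis using inf s(4) by simp
    next
      case 2
      note 2 = 2[unfolded s]
      show ?thesis using RL[OF x(5) 2(4)] RL[OF x(7) 2(6)] by simp
    next
      case (3 e')
      note 3 = 3[unfolded s]
      show ?thesis using simD(3)[OF cL[OF x(2,3)] 3(5) x(5) 3(6) x(6) 3(4) x(4)] by simp
    next
      case 4
      note 4 = 4[unfolded s]
      show ?thesis using nE[OF 4(2)] x(2,3) by metis
    qed
  next
    case x: 4
    from assms(2) show ?thesis
    proof (cases rule: thin_map_cases)
      case 1
      then show ?thesis using inf s(4) by simp
    next
      case 2
      note 2 = 2[unfolded s]
      show ?thesis using RL[OF x(4) 2(4)] RL[OF x(4) 2(6)] x(3) by simp
    next
      case (3 e)
      note 3 = 3[unfolded s]
      show ?thesis using nE[OF x(2)] 3(2,3) by metis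
    next
      case 4
      note 4 = 4[unfolded s]
      show ?thesis using L1[OF x(2) x(4) 4(4)] x(3) 4(3) by simp
    qed
  qed
qed

text \<open>Every point is moved within its own class, and classes are convex, so only two points of
  the same class need a comparison of their halves.\<close>

lemma thin_map_mono: "mono_rel r thin_map"
  unfolding mono_rel_def
proof (intro allI impI)
  fix x y x' y' assume a: "(x, y) \<in> thin_map" "(x', y') \<in> thin_map"
  note xH = thin_map_H(1)[OF a(1)] thin_map_H(1)[OF a(2)]
  show "(x, x') \<in> r \<longleftrightarrow> (y, y') \<in> r"
  proof (cases "x' \<in> cls r H x")
    case True
    show ?thesis by (rule thin_map_mono_same[OF a True])
  next
    case False
    then have "x \<notin> cls r H x'" using fin_sym xH unfolding cls_def by simp
    moreover have "x \<noteq> x'" using False cls_self[OF xH(1)] by auto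
    ultimately show ?thesis
      using cls_less[OF xH _ False thin_map_cls[OF a(1)] thin_map_cls[OF a(2)]]
        cls_less[OF xH(2,1) _ _ thin_map_cls[OF a(2)] thin_map_cls[OF a(1)]] iordD(6)[OF H xH] rD(3) by metis
  qed
qed

end

section \<open>Existence of a bad embedding\<close>

context lin begin

lemma mono_sim:
  assumes "mono_rel r G" "H \<subseteq> Domain G" "G \<subseteq> H \<times> H" shows "sim G H r (Range G) r"
proof (rule simI)
  show "\<exists>y \<in> Range G. (x, y) \<in> G" if "x \<in> H" for x
    using subsetD[OF assms(2) that] by (metis DomainE RangeI)
  show "\<exists>x \<in> H. (x, y) \<in> G" if "y \<in> Range G" for y
    using that subsetD[OF assms(3)] by (metis RangeE SigmaD1)
  show "(x, x') \<in> r \<longleftrightarrow> (y, y') \<in> r" if "(x, y) \<in> G" "(x', y') \<in> G" for x x' y y'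
    by (rule mono_relD[OF assms(1) that])
qed

lemma Range_facts:
  assumes "drel G" "G \<subseteq> H \<times> H" shows "internal (Range G)" "Range G \<subseteq> H" "iord (Range G) r"
proof -
  show s: "Range G \<subseteq> H" using assms(2) by auto
  show i: "internal (Range G)"
    by (rule internal_sep[OF iordD(1)[OF H] s], unfold Range_iff) (intro fo fo_drel[OF assms(1)])
  show "iord (Range G) r" by (rule iord_subset[OF H s i])
qed

lemma thin_map_facts: "thin_map \<subseteq> H \<times> H" "H \<subseteq> Domain thin_map" "sim thin_map H r (Range thin_map) r"
proof -
  show 1: "thin_map \<subseteq> H \<times> H" using thin_map_H by auto
  show 2: "H \<subseteq> Domain thin_map" using thin_map_total by auto
  show "sim thin_map H r (Range thin_map) r" by (rule mono_sim[OF thin_map_mono 2 1])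
qed

lemma nice_thin_map: "nice r (Range thin_map)"
  unfolding nice_def
proof (intro ballI impI)
  fix y assume y: "y \<in> Range thin_map" "infc r (Range thin_map) y"
  let ?Y = "Range thin_map"
  obtain x where xy: "(x, y) \<in> thin_map" using y(1) by auto
  note xH = thin_map_H(1)[OF xy]
  note rf = Range_facts[OF drel_thin_map thin_map_facts(1)]
  note sc = sim_cls[OF thin_map_facts(3) H rf(3) drel_thin_map xH y(1) xy]
  have inf: "infc r H x" using sc(2) y(2) by simp
  \<comment> \<open>The image of the old centre serves as the centre of the thinned class.\<close>
  obtain c' where c': "(centre x, c') \<in> thin_map" using thin_map_total[OF centre_H[OF xH inf]] by (elim exE)
  have c'Y: "c' \<in> cls r ?Y y" using sc(1)[OF centre_H[OF xH inf] RangeI[OF c'] c'] centre_cls[OF xH inf] by simp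
  have pre: "\<exists>x'. (x', y') \<in> thin_map \<and> x' \<in> cls r H x" if "y' \<in> cls r ?Y y" for y'
  proof -
    have "y' \<in> ?Y" using that unfolding cls_def by simp
    then obtain x' where x': "(x', y') \<in> thin_map" by (elim RangeE)
    then show ?thesis using sc(1)[OF thin_map_H(1)[OF x'] RangeI[OF x'] x'] that by auto
  qed
  have iff: "(u, u') \<in> r \<longleftrightarrow> (v, v') \<in> r" if "(u, v) \<in> thin_map" "(u', v') \<in> thin_map" for u v u' v'
    by (rule mono_relD[OF thin_map_mono that])
  have "(le r d c' \<longrightarrow> Up d b a) \<and> ((c', a) \<in> r \<longrightarrow> Up a b d)"
    if abd: "a \<in> cls r ?Y y" "b \<in> cls r ?Y y" "d \<in> cls r ?Y y" "(a, b) \<in> r" "(b, d) \<in> r" for a b d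
  proof -
    obtain a' b' d' where p: "(a', a) \<in> thin_map" "(b', b) \<in> thin_map" "(d', d) \<in> thin_map"
      "a' \<in> cls r H x" "b' \<in> cls r H x" "d' \<in> cls r H x"
      using pre[OF abd(1)] pre[OF abd(2)] pre[OF abd(3)] by (elim exE conjE)
    have less: "(a', b') \<in> r" "(b', d') \<in> r" using iff p abd(4,5) by simp_all
    have R: "v \<in> thin r (right_half x)" if "(u, v) \<in> thin_map" "u \<in> cls r H x" "(centre x, u) \<in> r" for u v
    proof -
      note s = cls_same[OF xH that(2)]
      from that(1) show ?thesis
      proof (cases rule: thin_map_cases)
        case (3 e)
        then show ?thesis using that(3) rD(11) unfolding s left_half_def by simp
      next
        case 4
        then show ?thesis using that(3) rD(11) unfolding s left_half_def by simp
      qed (use inf s in simp_all)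
    qed
    have L: "v \<in> thin (r\<inverse>) (left_half x)" if "(u, v) \<in> thin_map" "u \<in> cls r H x" "le r u (centre x)" "e \<in> left_half x" "(e, centre x) \<in> r" for u v e
    proof -
      note s = cls_same[OF xH that(2)]
      from that(1) show ?thesis
      proof (cases rule: thin_map_cases)
        case 2
        then show ?thesis using that(3) rD(11) unfolding s by simp
      next
        case 4
        then have "e \<in> {centre x}" using that(4) unfolding s by auto
        then show ?thesis using that(5) rD(1) by auto
      qed (use inf s in simp_all)
    qed
    show ?thesis
    proof (intro conjI impI)
      assume dc: "le r d c'"
      have "le r d' (centre x)"
        using dc sim_le[OF thin_map_facts(3) H rf(3) thin_map_H(1)[OF p(3)] centre_H[OF xH inf] RangeI[OF p(3)] RangeI[OF c'] p(3) c'] by simp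
      then have b'c: "(b', centre x) \<in> r" by (rule rD(8)[OF less(2)])
      have a'c: "(a', centre x) \<in> r" by (rule rD(2)[OF less(1) b'c])
      \<comment> \<open>Since \<open>a'\<close> is strictly below the centre, the left half is not
        trivial, and \<open>thin_map\<close> maps it into the comb instead of leaving it
        fixed.\<close>
      have e: "a' \<in> left_half x" using p(4) rD(6)[OF a'c] unfolding left_half_def by simp
      show "Up d b a"
        by (rule left_half_sim(2)[OF xH inf e a'c L[OF p(1,4) rD(6)[OF a'c] e a'c] L[OF p(2,5) rD(6)[OF b'c] e a'c]
              L[OF p(3,6) \<open>le r d' (centre x)\<close> e a'c] abd(4,5)])
    next
      assume ca: "(c', a) \<in> r"
      then have ca': "(centre x, a') \<in> r" using iff[OF c' p(1)] by simp
      have cb': "(centre x, b') \<in> r" by (rule rD(2)[OF ca' less(1)])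
      have cd': "(centre x, d') \<in> r" by (rule rD(2)[OF cb' less(2)])
      have "a' \<in> right_half x" using p(4) ca' unfolding right_half_def by simp
      then have ne: "right_half x \<noteq> {}" by (rule nonemptyI)
      show "Up a b d"
        by (rule right_half_sim(2)[OF xH inf ne R[OF p(1,4) ca'] R[OF p(2,5) cb'] R[OF p(3,6) cd'] abd(4,5)])
    qed
  qed
  then show "\<exists>c \<in> cls r ?Y y. \<forall>a \<in> cls r ?Y y. \<forall>b \<in> cls r ?Y y. \<forall>d \<in> cls r ?Y y.
     (a, b) \<in> r \<and> (b, d) \<in> r \<longrightarrow> (le r d c \<longrightarrow> Up d b a) \<and> ((c, a) \<in> r \<longrightarrow> Up a b d)"
    using c'Y by (intro bexI[of _ c'] ballI impI) auto
qed

text \<open>A centre at or above \<open>p 2\<close> would make the first three points grow left. A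
  centre below \<open>p 2\<close> is also below \<open>p 3\<close> and would make the last three
  grow right. Both contradict asymmetry of \<open>Up\<close>.\<close>

lemma bad_not_nice:
  assumes "bad_embedding G m p" shows "\<not> nice r (Range G)"
proof
  assume nice: "nice r (Range G)"
  let ?Y = "Range G"
  have G: "drel G" "mono_rel r G" "G \<subseteq> H \<times> H" "H \<subseteq> Domain G" "infc r H (m 0)" "Up (p 0) (p 1) (p 2)" "Up (p 5) (p 4) (p 3)"
    and k: "\<forall>k<6. (m k, p k) \<in> G \<and> m k \<in> cls r H (m 0)" and step: "\<forall>k<5. (m k, m (Suc k)) \<in> r"
    using assms unfolding bad_embedding_def by simp_all
  note rf = Range_facts[OF G(1,3)]
  have s: "sim G H r ?Y r" by (rule mono_sim[OF G(2,4,3)])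
  have g: "(m k, p k) \<in> G" if "k < 6" for k using k that by simp
  have mH: "m k \<in> H" "p k \<in> ?Y" if "k < 6" for k using g[OF that] G(3) by auto
  note sc = sim_cls[OF s H rf(3) G(1) mH(1)[of 0] mH(2)[of 0] g[of 0]]
  have c: "p k \<in> cls r ?Y (p 0)" if "k < 6" for k
    using sc(1)[OF _ _ _ mH[OF that] g[OF that]] k that by simp
  have "infc r ?Y (p 0)" using sc(2) G(5) by simp
  then obtain z where z: "z \<in> cls r ?Y (p 0)"
    "\<forall>a \<in> cls r ?Y (p 0). \<forall>b \<in> cls r ?Y (p 0). \<forall>d \<in> cls r ?Y (p 0).
       (a, b) \<in> r \<and> (b, d) \<in> r \<longrightarrow> (le r d z \<longrightarrow> Up d b a) \<and> ((z, a) \<in> r \<longrightarrow> Up a b d)"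
    using nice mH(2)[of 0] unfolding nice_def by auto
  have pstep: "(p k, p (Suc k)) \<in> r" if "k < 5" for k
    using mono_relD[OF G(2) g[of k] g[of "Suc k"]] step that by simp
  have ps: "(p 0, p 1) \<in> r" "(p 1, p 2) \<in> r" "(p 2, p 3) \<in> r" "(p 3, p 4) \<in> r" "(p 4, p 5) \<in> r"
    using pstep[of 0] pstep[of 1] pstep[of 2] pstep[of 3] pstep[of 4] by (simp_all add: eval_nat_numeral)
  have cc: "p 0 \<in> cls r ?Y (p 0)" "p 1 \<in> cls r ?Y (p 0)" "p 2 \<in> cls r ?Y (p 0)" "p 3 \<in> cls r ?Y (p 0)"
    "p 4 \<in> cls r ?Y (p 0)" "p 5 \<in> cls r ?Y (p 0)" by (intro c; simp)+
  show False
  proof (cases "le r (p 2) z")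
    case True
    then have "Up (p 2) (p 1) (p 0)" using z(2) cc(1-3) ps(1,2) by simp
    then show False using Up_asym G(6) by simp
  next
    case False
    have "z \<in> H" "p 2 \<in> H" using z(1) rf(2) mH(2)[of 2] unfolding cls_def by auto
    then have "(z, p 2) \<in> r" using rD(9) False by simp
    then have "(z, p 3) \<in> r" using rD(2)[OF _ ps(3)] by simp
    then have "Up (p 3) (p 4) (p 5)" using z(2) cc(4-6) ps(4,5) by simp
    then show False using Up_asym G(7) by simp
  qed
qed

text \<open>Reading the six points backwards exchanges the two triples. The reference point of the
  class moves from \<open>m 0\<close> to \<open>m 5\<close>, which generates the same class.\<close>

lemma bad_converse:
  assumes "lin.bad_embedding E D od bit H (r\<inverse>) G m p" shows "bad_embedding G (\<lambda>k. m (5 - k)) (\<lambda>k. p (5 - k))"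
proof -
  note a = assms[unfolded lin.bad_embedding_def[OF lin_converse] cls_converse infc_converse]
  have G: "drel G" "mono_rel (r\<inverse>) G" "G \<subseteq> H \<times> H" "H \<subseteq> Domain G" "infc r H (m 0)" "Up (p 0) (p 1) (p 2)" "Up (p 5) (p 4) (p 3)"
    and k: "\<forall>k<6. (m k, p k) \<in> G \<and> m k \<in> cls r H (m 0)" and step: "\<forall>k<5. (m k, m (Suc k)) \<in> r\<inverse>"
    using a by simp_all
  have "(m 0, p 0) \<in> G" using k by simp
  then have m0: "m 0 \<in> H" using G(3) by auto
  have m5: "m 5 \<in> cls r H (m 0)" using k by simp
  have "mono_rel r G" using G(2) unfolding mono_rel_def by simp
  moreover have "(m (5 - k), m (5 - Suc k)) \<in> r" if "k < 5" for k
  proof -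
    have "Suc (5 - Suc k) = 5 - k" using that by simp
    then show ?thesis using step[rule_format, of "5 - Suc k"] that by simp
  qed
  moreover have "infc r H (m 5)" using infc_eq[OF m0 m5] G(5) by simp
  moreover have "(m (5 - j), p (5 - j)) \<in> G \<and> m (5 - j) \<in> cls r H (m 5)" for j
    using k unfolding cls_eq[OF m0 m5] by simp
  ultimately show ?thesis unfolding bad_embedding_def using G by simp
qed

lemma btw_converse: "btw (r\<inverse>) H x y = btw r H x y" unfolding btw_def by auto

lemma btw_sym: "btw r H x y = btw r H y x" unfolding btw_def by auto

section \<open>Splitting witnesses, and the classes of tame distance\<close>

lemma Qs_final:
  assumes "Qs r Z" "V \<subseteq> Z" "V \<noteq> {}" "\<And>u v. u \<in> V \<Longrightarrow> v \<in> Z \<Longrightarrow> (u, v) \<in> r \<Longrightarrow> v \<in> V"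
  shows "Qs r V"
  unfolding Qs_def
proof (intro conjI ballI assms(3))
  fix z assume z: "z \<in> V"
  then have zZ: "z \<in> Z" using assms(2) by auto
  obtain u where u: "u \<in> Z" "(z, u) \<in> r" "\<not> wo r {y \<in> Z. (z, y) \<in> r \<and> (y, u) \<in> r}"
    using assms(1) zZ unfolding Qs_def by auto
  have "{y \<in> Z. (z, y) \<in> r \<and> (y, u) \<in> r} = {y \<in> V. (z, y) \<in> r \<and> (y, u) \<in> r}"
    using assms(2) assms(4)[OF z] by auto
  then show "\<exists>u \<in> V. (z, u) \<in> r \<and> \<not> wo r {y \<in> V. (z, y) \<in> r \<and> (y, u) \<in> r}"
    using u assms(4)[OF z u(1,2)] by auto
qed

text \<open>Final segments of a witness are witnesses. So either the witness meets the final part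
  \<open>C\<close>, and its intersection with \<open>C\<close> is one, or it lies entirely in
  \<open>B\<close>. This is what makes \<open>tame\<close> transitive.\<close>

lemma hasQ_split:
  assumes "hasQ r A" "fo (\<lambda>v. v 0 \<in> C)" "A \<subseteq> B \<union> C" "\<And>u v. u \<in> A \<Longrightarrow> u \<in> C \<Longrightarrow> v \<in> A \<Longrightarrow> (u, v) \<in> r \<Longrightarrow> v \<in> C"
  shows "hasQ r B \<or> hasQ r C"
proof -
  obtain Z where Z: "elts E Z \<subseteq> A" "Qs r (elts E Z)" using assms(1) unfolding hasQ_def by (elim exE conjE)
  let ?V = "elts E Z \<inter> C"
  show ?thesis
  proof (cases "?V = {}")
    case True
    then have "elts E Z \<subseteq> B" using Z(1) assms(3) by auto
    then show ?thesis using Z(2) unfolding hasQ_def by auto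
  next
    case False
    have "internal ?V" by (rule internal_sep[OF internal_elts[of Z]]) (simp, intro fo assms(2))
    moreover have "Qs r ?V" by (rule Qs_final[OF Z(2) _ False]) (use Z(1) assms(4) in auto)
    ultimately show ?thesis using hasQI[of ?V C r] by auto
  qed
qed

lemma btw_final:
  assumes "le r x z" "u \<in> btw r H x z" "u \<in> btw r H y z" "v \<in> btw r H x z" "(u, v) \<in> r"
  shows "v \<in> btw r H y z"
proof -
  have vz: "le r v z" using assms(4) rD(5)[OF _ assms(1)] unfolding btw_def by auto
  have "\<not> le r z u" using rD(8)[OF assms(5) vz] rD(11) by simp
  then have "le r y u" using assms(3) unfolding btw_def by simp
  then have "le r y v" using rD(7)[OF _ assms(5)] rD(6) by simp
  then show ?thesis using vz assms(4) unfolding btw_def by simp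
qed

lemma hasQ_trans:
  assumes xyz: "x \<in> H" "y \<in> H" "z \<in> H" and Q: "hasQ r (btw r H x z)"
  shows "hasQ r (btw r H x y) \<or> hasQ r (btw r H y z)"
proof -
  have f: "fo (\<lambda>v. v 0 \<in> btw r H a b)" for a b by (intro fo)
  show ?thesis
  proof (cases "le r x z")
    case True
    show ?thesis by (rule hasQ_split[OF Q f btw_Un[OF xyz]]) (rule btw_final[OF True])
  next
    case False
    then have zx: "le r z x" using rD(9)[OF xyz(1,3)] rD(6) by simp
    have Q': "hasQ r (btw r H z x)" using Q btw_sym by metis
    have "hasQ r (btw r H z y) \<or> hasQ r (btw r H y x)"
      by (rule hasQ_split[OF Q' f btw_Un[OF xyz(3,2,1)]]) (rule btw_final[OF zx])
    then show ?thesis using btw_sym by metis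
  qed
qed

text \<open>Adjacent classes of this convex equivalence cannot both be free of witnesses. So if all classes
  were, their \<open>w\<close>-least elements would form a dense suborder.\<close>

definition tame :: "'a \<Rightarrow> 'a \<Rightarrow> bool" where
  "tame x y \<longleftrightarrow> \<not> hasQ r (btw r H x y) \<and> \<not> hasQ (r\<inverse>) (btw r H x y)"

definition Kc :: "'a \<Rightarrow> 'a set" where "Kc x = {y \<in> H. tame x y}"

lemma fo_tame [fo]: "ft s \<Longrightarrow> ft t \<Longrightarrow> fo (\<lambda>v. tame (s v) (t v))"
  by (rule fo_rel2[where R = tame]) (unfold tame_def, intro fo fiH)

lemma fo_Kc [fo]: "ft s \<Longrightarrow> ft t \<Longrightarrow> fo (\<lambda>v. s v \<in> Kc (t v))"
  unfolding Kc_def by (intro fo fiH)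

lemma tame_sym: "tame x y \<longleftrightarrow> tame y x"
  unfolding tame_def btw_sym[of x y] by (rule refl)

lemma tame_trans: "x \<in> H \<Longrightarrow> y \<in> H \<Longrightarrow> z \<in> H \<Longrightarrow> tame x y \<Longrightarrow> tame y z \<Longrightarrow> tame x z"
  using hasQ_trans lin.hasQ_trans[OF lin_converse] unfolding tame_def btw_converse by metis

lemma tame_refl: "tame x x"
proof -
  have *: "\<not> hasQ s {x}" if "s = r \<or> s = r\<inverse>" for s
  proof
    assume "hasQ s {x}"
    then obtain Z where Z: "elts E Z \<subseteq> {x}" "Qs s (elts E Z)" unfolding hasQ_def by (elim exE conjE)
    then have e: "elts E Z = {x}" unfolding Qs_def by auto
    have "(x, x) \<in> s" using Z(2) unfolding e Qs_def by auto
    then show False using that rD(1) by auto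
  qed
  have "btw r H x x \<subseteq> {x}" unfolding btw_def using rD(12) by auto
  then show ?thesis unfolding tame_def using hasQ_mono * by metis
qed

lemma Kc_H: "y \<in> Kc x \<Longrightarrow> y \<in> H" unfolding Kc_def by simp

lemma Kc_self: "x \<in> H \<Longrightarrow> x \<in> Kc x" unfolding Kc_def using tame_refl by simp

lemma tame_mono: "btw r H x y \<subseteq> btw r H x' y' \<Longrightarrow> tame x' y' \<Longrightarrow> tame x y"
  unfolding tame_def using hasQ_mono by metis

lemma Kc_tame: "x \<in> H \<Longrightarrow> y \<in> Kc x \<Longrightarrow> z \<in> Kc x \<Longrightarrow> tame y z"
  using tame_trans[of y x z] tame_sym unfolding Kc_def by simp

lemma btw_sub:
  assumes "le r x u" "le r u y" shows "btw r H x u \<subseteq> btw r H x y" "btw r H u y \<subseteq> btw r H x y"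
proof -
  show "btw r H x u \<subseteq> btw r H x y"
  proof
    fix v assume v: "v \<in> btw r H x u"
    then have "le r x v" "le r v u" using assms(1) rD(5) rD(12)[OF _ assms(1)] unfolding btw_def by (auto; metis)+
    then show "v \<in> btw r H x y" using v rD(5)[OF _ assms(2)] unfolding btw_def by simp
  qed
  show "btw r H u y \<subseteq> btw r H x y"
  proof
    fix v assume v: "v \<in> btw r H u y"
    then have "le r u v" "le r v y" using assms(2) rD(5) rD(12)[OF _ assms(2)] unfolding btw_def by (auto; metis)+
    then show "v \<in> btw r H x y" using v rD(5)[OF assms(1)] unfolding btw_def by simp
  qed
qed

lemma Kc_convex:
  assumes "x \<in> H" "y \<in> Kc x" "z \<in> Kc x" "u \<in> H" "le r y u" "le r u z" shows "u \<in> Kc x"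
proof -
  have "tame y u" by (rule tame_mono[OF btw_sub(1)[OF assms(5,6)] Kc_tame[OF assms(1-3)]])
  then have "tame x u" using tame_trans[OF assms(1) Kc_H[OF assms(2)] assms(4)] assms(2) unfolding Kc_def by simp
  then show ?thesis using assms(4) unfolding Kc_def by simp
qed

lemma seg_btw: "seg r H x y \<subseteq> btw r H x y" unfolding seg_def btw_def by auto

lemma internal_Kc: "internal (Kc x)"
  by (rule internal_sep[OF iordD(1)[OF H]], rule subsetI, rule Kc_H, assumption, intro fo)

lemma two_classes:
  assumes "x \<in> H" "y \<in> H" "le r x y" "btw r H x y \<subseteq> Kc x \<union> Kc y" "hasQ r (btw r H x y)"
  shows "hasQ r (Kc x) \<or> hasQ r (Kc y)"
proof (rule hasQ_split[OF assms(5) _ assms(4)])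
  show "fo (\<lambda>v. v 0 \<in> Kc y)" by (intro fo)
  fix u v assume a: "u \<in> btw r H x y" "u \<in> Kc y" "v \<in> btw r H x y" "(u, v) \<in> r"
  have vH: "v \<in> H" using a(3) btw_H by auto
  have "le r v y" using a(3) rD(5)[OF _ assms(3)] unfolding btw_def by auto
  then show "v \<in> Kc y" by (rule Kc_convex[OF assms(2) a(2) Kc_self[OF assms(2)] vH rD(6)[OF a(4)]])
qed

lemma tame_converse: "lin.tame E H (r\<inverse>) x y = tame x y"
  unfolding lin.tame_def[OF lin_converse] tame_def btw_converse by auto

lemma Kc_converse: "lin.Kc E H (r\<inverse>) x = Kc x"
  unfolding lin.Kc_def[OF lin_converse] Kc_def tame_converse by (rule refl)

lemma two_classes_converse:
  assumes "x \<in> H" "y \<in> H" "le r x y" "btw r H x y \<subseteq> Kc x \<union> Kc y" "hasQ (r\<inverse>) (btw r H x y)"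
  shows "hasQ (r\<inverse>) (Kc x) \<or> hasQ (r\<inverse>) (Kc y)"
proof -
  have "le (r\<inverse>) y x" using assms(3) by simp
  moreover have "btw r H y x \<subseteq> Kc y \<union> Kc x" "hasQ (r\<inverse>) (btw r H y x)"
    using assms(4,5) unfolding btw_sym[of y x] Un_commute[of "Kc y"] by simp_all
  ultimately show ?thesis
    using lin.two_classes[OF lin_converse assms(2,1)] unfolding btw_converse Kc_converse by metis
qed

lemma class_with_Q:
  assumes Q: "hasQ r H \<or> hasQ (r\<inverse>) H"
    and scat: "\<And>Z. internal Z \<Longrightarrow> Z \<subseteq> H \<Longrightarrow> \<exists>x \<in> Z. \<exists>y \<in> Z. x \<noteq> y \<Longrightarrow>
      \<exists>x \<in> Z. \<exists>y \<in> Z. (x, y) \<in> r \<and> \<not> (\<exists>z \<in> Z. (x, z) \<in> r \<and> (z, y) \<in> r)"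
  shows "\<exists>x \<in> H. hasQ r (Kc x) \<or> hasQ (r\<inverse>) (Kc x)"
proof (rule ccontr)
  assume "\<not> ?thesis"
  then have noQ: "\<not> hasQ r (Kc x)" "\<not> hasQ (r\<inverse>) (Kc x)" if "x \<in> H" for x using that by simp_all
  \<comment> \<open>The \<open>w\<close>-least point of each class represents it. In this way the
    representatives form a set of the model.\<close>
  define R where "R = {x \<in> H. \<forall>y \<in> H. tame x y \<longrightarrow> y \<noteq> x \<longrightarrow> (x, y) \<in> w}"
  have rep: "\<exists>p \<in> R. tame p x" if x: "x \<in> H" for x
  proof -
    have 1: "Kc x \<subseteq> H" using Kc_H by (rule subsetI)
    have 2: "fo (\<lambda>v. v 0 \<in> Kc x)" by (intro fo)
    have 3: "Kc x \<noteq> {}" using Kc_self[OF x] by (rule nonemptyI)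
    obtain p where p: "p \<in> Kc x" "\<forall>y \<in> Kc x. y \<noteq> p \<longrightarrow> (p, y) \<in> w"
      using wo_least[OF w 1 2 3] by (elim bexE conjE)
    have px: "tame p x" "p \<in> H" "tame x p" using p(1) tame_sym unfolding Kc_def by simp_all
    have "y \<in> Kc x" if "y \<in> H" "tame p y" for y
      using tame_trans[OF x px(2) that(1) px(3) that(2)] that(1) unfolding Kc_def by simp
    then have "p \<in> R" using p(2) px(2) unfolding R_def by simp
    then show ?thesis using px(1) by auto
  qed
  have uniq: "x = y" if "x \<in> R" "y \<in> R" "tame x y" for x y
  proof (rule ccontr)
    assume "x \<noteq> y"
    then have "(x, y) \<in> w" "(y, x) \<in> w" using that tame_sym[of x y] unfolding R_def by simp_all
    then show False using iordD(5)[OF w(1)] by simp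
  qed
  have RH: "x \<in> H" if "x \<in> R" for x using that unfolding R_def by simp
  have iR: "internal R" unfolding R_def by (rule internal_filter[OF iordD(1)[OF H]]) (intro fo fiH)
  \<comment> \<open>If there were only one class, it would be all of \<open>H\<close>, which
    contains a witness.\<close>
  have two: "\<exists>x \<in> R. \<exists>y \<in> R. x \<noteq> y"
  proof (rule ccontr)
    assume one: "\<not> (\<exists>x \<in> R. \<exists>y \<in> R. x \<noteq> y)"
    have "\<exists>x. x \<in> H" using Q unfolding hasQ_def Qs_def by auto
    then obtain x where x: "x \<in> H" by (elim exE)
    obtain p where p: "p \<in> R" "tame p x" using rep[OF x] by (elim bexE)
    have "H \<subseteq> Kc p"
    proof
      fix y assume y: "y \<in> H"
      obtain q where q: "q \<in> R" "tame q y" using rep[OF y] by (elim bexE)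
      have "q = p" using one p(1) q(1) by metis
      then show "y \<in> Kc p" using q(2) y unfolding Kc_def by simp
    qed
    then show False using Q noQ[OF RH[OF p(1)]] hasQ_mono by metis
  qed
  have RHs: "R \<subseteq> H" unfolding R_def by (rule Collect_restrict)
  obtain x y where xy: "x \<in> R" "y \<in> R" "(x, y) \<in> r" "\<not> (\<exists>z \<in> R. (x, z) \<in> r \<and> (z, y) \<in> r)"
    using scat[OF iR RHs two] by (elim bexE conjE)
  note xyH = RH[OF xy(1)] RH[OF xy(2)]
  have lexy: "le r x y" using xy(3) by (rule rD(6))
  have "\<not> tame x y" using uniq[OF xy(1,2)] xy(3) rD(1) by auto
  moreover have "btw r H x y \<subseteq> Kc x \<union> Kc y"
  proof
    fix u assume u: "u \<in> btw r H x y"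
    then have uH: "u \<in> H" using btw_H by auto
    have lu: "le r x u" "le r u y"
      using u lexy rD(5)[OF lexy] rD(5)[OF _ lexy] rD(11)[OF xy(3)] rD(5) unfolding btw_def by (auto; metis)+
    obtain p where p: "p \<in> R" "tame p u" using rep[OF uH] by (elim bexE)
    note pH = RH[OF p(1)]
    \<comment> \<open>By convexity of the classes, the representative of a point between
      \<open>x\<close> and \<open>y\<close> is not outside this interval unless it is tame with
      \<open>x\<close> or \<open>y\<close>. Strictly inside there is none, as \<open>x\<close> and
      \<open>y\<close> are neighbours in \<open>R\<close>.\<close>
    have "p = x \<or> p = y"
    proof (rule ccontr)
      assume n: "\<not> (p = x \<or> p = y)"
      have "le r x p"
      proof (rule ccontr)
        assume "\<not> le r x p"
        then have "le r p x" using rD(9)[OF xyH(1) pH] rD(6) by simp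
        then have "tame p x" using tame_mono[OF btw_sub(1)[OF _ lu(1)] p(2)] by simp
        then show False using uniq[OF p(1) xy(1)] n by simp
      qed
      moreover have "le r p y"
      proof (rule ccontr)
        assume "\<not> le r p y"
        then have yp: "le r y p" using rD(9)[OF pH xyH(2)] rD(6) by simp
        have "tame u p" using p(2) tame_sym by simp
        then have "tame y p" by (rule tame_mono[OF btw_sub(2)[OF lu(2) yp]])
        then show False using uniq[OF xy(2) p(1)] n by simp
      qed
      ultimately show False using xy(4) p(1) n unfolding le_def by auto
    qed
    then show "u \<in> Kc x \<union> Kc y" using p(2) uH unfolding Kc_def by auto
  qed
  ultimately show False
    using two_classes[OF xyH lexy] two_classes_converse[OF xyH lexy] noQ[OF xyH(1)] noQ[OF xyH(2)]
    unfolding tame_def by metis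
qed

lemma block_class:
  assumes x: "x \<in> H" and Q: "hasQ r (Kc x)" shows "block E D od bit H r w (Kc x)"
proof
  show "Kc x \<subseteq> H" using Kc_H by (rule subsetI)
  show "internal (Kc x)" by (rule internal_Kc)
  show "Kc x \<noteq> {}" using Kc_self[OF x] by (rule nonemptyI)
  show "seg r H a b \<subseteq> Kc x" if "a \<in> Kc x" "b \<in> Kc x" for a b
  proof
    fix u assume "u \<in> seg r H a b"
    then show "u \<in> Kc x" using Kc_convex[OF x that] unfolding seg_def by simp
  qed
  show n1: "\<not> hasQ r (seg r H a b)" if "a \<in> Kc x" "b \<in> Kc x" for a b
    using Kc_tame[OF x that] hasQ_mono[OF _ seg_btw] unfolding tame_def by metis
  show "\<not> hasQ (r\<inverse>) (seg r H a b)" if "a \<in> Kc x" "b \<in> Kc x" for a b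
    using Kc_tame[OF x that] hasQ_mono[OF _ seg_btw] unfolding tame_def by metis
  show "\<exists>b \<in> Kc x. le r a b \<and> \<not> wo r (seg r H a b)" if a: "a \<in> Kc x" for a
  proof -
    obtain Z where Z: "elts E Z \<subseteq> Kc x" "Qs r (elts E Z)" using Q unfolding hasQ_def by (elim exE conjE)
    have ZH: "u \<in> H" if "u \<in> elts E Z" for u using that Z(1) Kc_H by auto
    obtain z where z: "z \<in> elts E Z" using Z(2) unfolding Qs_def by auto
    \<comment> \<open>If the witness stayed below \<open>a\<close>, its final segment from
      \<open>z\<close> on would be a witness between \<open>z\<close> and \<open>a\<close>, two
      points of the same tame class.\<close>
    have "\<exists>z \<in> elts E Z. le r a z"
    proof (rule ccontr)
      assume neg: "\<not> (\<exists>z \<in> elts E Z. le r a z)"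
      let ?V = "{u \<in> elts E Z. le r z u}"
      have "internal ?V" by (rule internal_filter[OF internal_elts]) (intro fo fiH)
      moreover have "z \<in> ?V" using z by simp
      then have ne: "?V \<noteq> {}" by (rule nonemptyI)
      have "Qs r ?V"
      proof (rule Qs_final[OF Z(2) _ ne])
        fix u v assume "u \<in> ?V" "v \<in> elts E Z" "(u, v) \<in> r"
        then show "v \<in> ?V" using rD(7)[of z u v] rD(6) by simp
      qed simp
      moreover have "?V \<subseteq> seg r H z a"
      proof
        fix u assume u: "u \<in> ?V"
        then have "\<not> le r a u" using neg by auto
        then have "le r u a" using rD(9)[OF Kc_H[OF a] ZH[of u]] rD(6) u by simp
        then show "u \<in> seg r H z a" using u ZH unfolding seg_def by simp
      qed
      ultimately have "hasQ r (seg r H z a)" using hasQI[of ?V "seg r H z a" r] by simp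
      then show False using n1[of z a] z Z(1) a by auto
    qed
    then obtain z where z: "z \<in> elts E Z" "le r a z" by (elim bexE)
    obtain u where u: "u \<in> elts E Z" "(z, u) \<in> r" "\<not> wo r {y \<in> elts E Z. (z, y) \<in> r \<and> (y, u) \<in> r}"
      using Z(2) z(1) unfolding Qs_def by auto
    have "{y \<in> elts E Z. (z, y) \<in> r \<and> (y, u) \<in> r} \<subseteq> seg r H a u"
    proof
      fix y assume y: "y \<in> {y \<in> elts E Z. (z, y) \<in> r \<and> (y, u) \<in> r}"
      then show "y \<in> seg r H a u" using ZH[of y] rD(6)[OF rD(7)[OF z(2), of y]] rD(6)[of y u] unfolding seg_def by simp
    qed
    then have "\<not> wo r (seg r H a u)" using u(3) wo_subset by metis
    moreover have "le r a u" by (rule rD(6)[OF rD(7)[OF z(2) u(2)]])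
    moreover have "u \<in> Kc x" using u(1) Z(1) by auto
    ultimately show ?thesis by (intro bexI[of _ u] conjI)
  qed
qed

lemma bad_of_Q: assumes x: "x \<in> H" and Q: "hasQ r (Kc x)" shows "\<exists>G m p. bad_embedding G m p"
proof -
  interpret block E D od bit H r w "Kc x" by (rule block_class[OF assms])
  have "block_orbit E D od bit H r w (Kc x) x" by unfold_locales (rule Kc_self[OF x])
  then show ?thesis by (rule block_orbit.bad_embedding)
qed

lemma bad_exists:
  assumes "hasQ r H \<or> hasQ (r\<inverse>) H"
    and "\<And>Z. internal Z \<Longrightarrow> Z \<subseteq> H \<Longrightarrow> \<exists>x \<in> Z. \<exists>y \<in> Z. x \<noteq> y \<Longrightarrow>
      \<exists>x \<in> Z. \<exists>y \<in> Z. (x, y) \<in> r \<and> \<not> (\<exists>z \<in> Z. (x, z) \<in> r \<and> (z, y) \<in> r)"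
  shows "\<exists>G m p. bad_embedding G m p"
proof -
  have "\<exists>x \<in> H. hasQ r (Kc x) \<or> hasQ (r\<inverse>) (Kc x)"
    by (rule class_with_Q[OF assms(1)]) (rule assms(2))
  then obtain x where x: "x \<in> H" "hasQ r (Kc x) \<or> hasQ (r\<inverse>) (Kc x)" by (elim bexE)
  show ?thesis
  proof (cases "hasQ r (Kc x)")
    case True
    then show ?thesis by (rule bad_of_Q[OF x(1)])
  next
    case False
    then have "hasQ (r\<inverse>) (lin.Kc E H (r\<inverse>) x)" using x(2) Kc_converse by simp
    from lin.bad_of_Q[OF lin_converse x(1) this] show ?thesis using bad_converse by metis
  qed
qed

end

section \<open>Order types of the model\<close>

context zf_model begin

lemma lin_ordD:
  assumes "lin_ord E L"
  shows "iord (elts E (fst L)) (rel E (snd L))" "rel E (snd L) \<subseteq> elts E (fst L) \<times> elts E (fst L)"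
proof -
  have s: "elts E (snd L) \<subseteq> elts E (cross E (fst L) (fst L))"
    and o: "strict_linear_order_on (elts E (fst L)) (rel E (snd L))"
    using assms unfolding lin_ord_def by simp_all
  show "iord (elts E (fst L)) (rel E (snd L))" unfolding iord_def using o by simp
  have "x \<in> elts E (fst L) \<and> y \<in> elts E (fst L)" if "(x, y) \<in> rel E (snd L)" for x y
    using subsetD[OF s, of "pair E x y"] that unfolding rel_def by simp
  then show "rel E (snd L) \<subseteq> elts E (fst L) \<times> elts E (fst L)" by auto
qed

lemma drel_Int:
  assumes "drel r" shows "drel (r \<inter> elts E a \<times> elts E b)"
  unfolding drel_def Int_iff mem_Times_iff fst_conv snd_conv by (intro fo fo_drel[OF assms])

lemma fst_suborder [simp]: "fst (suborder E L X) = X"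
  unfolding suborder_def by simp

lemma rel_suborder: "rel E (snd (suborder E L X)) = rel E (snd L) \<inter> elts E X \<times> elts E X"
  unfolding suborder_def snd_conv
  by (rule rel_relset[where a = X and b = X]) (rule drel_Int[OF drel_rel], simp)

lemma suborder_suborder:
  assumes "elts E X \<subseteq> elts E Y" shows "suborder E (suborder E L Y) X = suborder E L X"
proof -
  have "rel E (snd (suborder E L Y)) \<inter> elts E X \<times> elts E X = rel E (snd L) \<inter> elts E X \<times> elts E X"
    unfolding rel_suborder using assms by auto
  then show ?thesis unfolding suborder_def[of E "suborder E L Y"] suborder_def[of E L X] by simp
qed

lemma sim_Int: "sim G A (r \<inter> A \<times> A) B s \<longleftrightarrow> sim G A r B s"
  unfolding sim_def by auto

lemma same_typeD:
  assumes "same_type E S T"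
  shows "\<exists>f. sim (rel E f) (elts E (fst S)) (rel E (snd S)) (elts E (fst T)) (rel E (snd T))"
proof -
  let ?A = "elts E (fst S)" and ?B = "elts E (fst T)"
  obtain f where f: "is_fun E f (fst S) (fst T)" "bij_betw (app E f) ?A ?B"
    "\<forall>x \<in> ?A. \<forall>y \<in> ?A. (x, y) \<in> rel E (snd S) \<longleftrightarrow> (app E f x, app E f y) \<in> rel E (snd T)"
    using assms unfolding same_type_def by (elim exE conjE)
  have app: "(x, app E f x) \<in> rel E f" "(x, y) \<in> rel E f \<Longrightarrow> y = app E f x" if "x \<in> ?A" for x y
  proof -
    have ex: "\<exists>!y. (x, y) \<in> rel E f" using f(1) that unfolding is_fun_def by simp
    show "(x, app E f x) \<in> rel E f" unfolding app_def by (rule theI'[OF ex])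
    then show "(x, y) \<in> rel E f \<Longrightarrow> y = app E f x" using ex by auto
  qed
  have "sim (rel E f) ?A (rel E (snd S)) ?B (rel E (snd T))"
  proof (rule simI)
    show "\<exists>y \<in> ?B. (x, y) \<in> rel E f" if "x \<in> ?A" for x
      using app(1)[OF that] bij_betwE[OF f(2)] that by auto
    show "\<exists>x \<in> ?A. (x, y) \<in> rel E f" if "y \<in> ?B" for y
    proof -
      have "y \<in> app E f ` ?A" using f(2) that unfolding bij_betw_def by simp
      then show ?thesis using app(1) by auto
    qed
    show "(x, x') \<in> rel E (snd S) \<longleftrightarrow> (y, y') \<in> rel E (snd T)"
      if "x \<in> ?A" "x' \<in> ?A" "(x, y) \<in> rel E f" "(x', y') \<in> rel E f" for x x' y y'
      using f(3) that(1,2) app(2)[OF that(1,3)] app(2)[OF that(2,4)] by simp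
  qed
  then show ?thesis by auto
qed

lemma same_typeI:
  assumes sim: "sim (rel E f) (elts E (fst S)) (rel E (snd S)) (elts E (fst T)) (rel E (snd T))"
    and io: "iord (elts E (fst S)) r" "rel E (snd S) = r \<inter> elts E (fst S) \<times> elts E (fst S)"
      "iord (elts E (fst T)) (rel E (snd T))"
  shows "same_type E S T"
proof -
  let ?A = "elts E (fst S)" and ?B = "elts E (fst T)"
  \<comment> \<open>A similarity may relate points outside the carriers in any way, so it is cut
    down before it is read as a function.\<close>
  let ?G = "rel E f \<inter> ?A \<times> ?B"
  have dG: "drel ?G" by (rule drel_Int[OF drel_rel])
  define g where "g = relset E ?G"
  have g: "rel E g = ?G" unfolding g_def by (rule rel_relset[OF dG, of "fst S" "fst T"]) simp
  have s: "sim (rel E f) ?A r ?B (rel E (snd T))" using sim unfolding io(2) sim_Int .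
  have uniq: "y = y'" if "(x, y) \<in> ?G" "(x, y') \<in> ?G" for x y y'
    using sim_inj[OF s io(1,3), of x x y y'] that by simp
  have inj: "x = x'" if "(x, y) \<in> ?G" "(x', y) \<in> ?G" for x x' y
    using sim_inj[OF s io(1,3), of x x' y y] that by simp
  have tot: "\<exists>y. (x, y) \<in> ?G" if "x \<in> ?A" for x using simD(1)[OF sim that] that by auto
  have ex1: "\<exists>!y. (x, y) \<in> rel E g" if "x \<in> ?A" for x
    unfolding g by (rule ex_ex1I[OF tot[OF that] uniq])
  have app: "(x, app E g x) \<in> ?G" if "x \<in> ?A" for x
  proof -
    have "(x, app E g x) \<in> rel E g" unfolding app_def by (rule theI'[OF ex1[OF that]])
    then show ?thesis unfolding g .
  qed
  have "is_fun E g (fst S) (fst T)"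
    unfolding is_fun_def
  proof (intro conjI ballI ex1)
    show "elts E g \<subseteq> elts E (cross E (fst S) (fst T))"
      using elts_relset[OF dG, of "fst S" "fst T"] unfolding g_def elts_cross by auto
  qed
  moreover have "bij_betw (app E g) ?A ?B"
    unfolding bij_betw_def
  proof
    show "inj_on (app E g) ?A" using app inj by (intro inj_onI) (metis (no_types, lifting))
    have "y \<in> app E g ` ?A" if y: "y \<in> ?B" for y
    proof -
      obtain x where x: "x \<in> ?A" "(x, y) \<in> rel E f" using simD(2)[OF sim y] by (elim bexE)
      then have "y = app E g x" using uniq[OF _ app[OF x(1)], of y] y by simp
      then show ?thesis using x(1) by simp
    qed
    then show "app E g ` ?A = ?B" using app by auto
  qed
  moreover have "(x, y) \<in> rel E (snd S) \<longleftrightarrow> (app E g x, app E g y) \<in> rel E (snd T)" if "x \<in> ?A" "y \<in> ?A" for x y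
    using simD(3)[OF sim that, of "app E g x" "app E g y"] app[OF that(1)] app[OF that(2)] by simp
  ultimately show ?thesis unfolding same_type_def by auto
qed

lemma same_type_suborder:
  assumes L: "lin_ord E L" and T: "lin_ord E \<tau>" and X: "elts E X \<subseteq> elts E (fst L)"
  shows "same_type E (suborder E L X) \<tau> \<longleftrightarrow>
    (\<exists>f. sim (rel E f) (elts E X) (rel E (snd L)) (elts E (fst \<tau>)) (rel E (snd \<tau>)))"
proof
  assume "same_type E (suborder E L X) \<tau>"
  from same_typeD[OF this]
  show "\<exists>f. sim (rel E f) (elts E X) (rel E (snd L)) (elts E (fst \<tau>)) (rel E (snd \<tau>))"
    unfolding fst_suborder rel_suborder sim_Int .
next
  assume "\<exists>f. sim (rel E f) (elts E X) (rel E (snd L)) (elts E (fst \<tau>)) (rel E (snd \<tau>))"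
  then obtain f where f: "sim (rel E f) (elts E X) (rel E (snd L)) (elts E (fst \<tau>)) (rel E (snd \<tau>))"
    by (elim exE)
  have io: "iord (elts E X) (rel E (snd L))" by (rule iord_subset[OF lin_ordD(1)[OF L] X internal_elts])
  show "same_type E (suborder E L X) \<tau>"
    by (rule same_typeI[where r = "rel E (snd L)" and f = f])
      (use f io rel_suborder lin_ordD(1)[OF T] sim_Int in simp_all)
qed

text \<open>With similarities in place of bijective functions the collection is visibly definable
  inside a power set, so that \<open>the_set\<close> denotes it.\<close>

lemma elts_typed_subsets:
  assumes L: "lin_ord E L" and T: "lin_ord E \<tau>" and H: "elts E H \<subseteq> elts E (fst L)"
  shows "elts E (typed_subsets E (suborder E L H) \<tau>) = {X. elts E X \<subseteq> elts E H \<and>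
    (\<exists>f. sim (rel E f) (elts E X) (rel E (snd L)) (elts E (fst \<tau>)) (rel E (snd \<tau>)))}" (is "_ = ?S")
    "elts E (typed_subsets E L \<tau>) = {X. elts E X \<subseteq> elts E (fst L) \<and>
    (\<exists>f. sim (rel E f) (elts E X) (rel E (snd L)) (elts E (fst \<tau>)) (rel E (snd \<tau>)))}"
proof -
  have i: "internal {X. elts E X \<subseteq> elts E h \<and>
    (\<exists>f. sim (rel E f) (elts E X) (rel E (snd L)) (elts E (fst \<tau>)) (rel E (snd \<tau>)))}" for h
  proof (rule internal_sep[OF internal_elts[of "pow E h"]])
    show "{X. elts E X \<subseteq> elts E h \<and>
      (\<exists>f. sim (rel E f) (elts E X) (rel E (snd L)) (elts E (fst \<tau>)) (rel E (snd \<tau>)))} \<subseteq> elts E (pow E h)"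
      unfolding elts_pow by auto
  qed (intro fo drel_rel)
  have "{X. elts E X \<subseteq> elts E (fst (suborder E L H)) \<and> same_type E (suborder E (suborder E L H) X) \<tau>} = ?S"
    unfolding fst_suborder
  proof (intro Collect_cong conj_cong refl)
    fix X assume X: "elts E X \<subseteq> elts E H"
    show "same_type E (suborder E (suborder E L H) X) \<tau> \<longleftrightarrow>
      (\<exists>f. sim (rel E f) (elts E X) (rel E (snd L)) (elts E (fst \<tau>)) (rel E (snd \<tau>)))"
      unfolding suborder_suborder[OF X] by (rule same_type_suborder[OF L T subset_trans[OF X H]])
  qed
  then show "elts E (typed_subsets E (suborder E L H) \<tau>) = ?S"
    unfolding typed_subsets_def using elts_the_set[OF i] by simp
  have "{X. elts E X \<subseteq> elts E (fst L) \<and> same_type E (suborder E L X) \<tau>} = {X. elts E X \<subseteq> elts E (fst L) \<and>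
    (\<exists>f. sim (rel E f) (elts E X) (rel E (snd L)) (elts E (fst \<tau>)) (rel E (snd \<tau>)))}"
    by (intro Collect_cong conj_cong refl) (rule same_type_suborder[OF L T])
  then show "elts E (typed_subsets E L \<tau>) = {X. elts E X \<subseteq> elts E (fst L) \<and>
    (\<exists>f. sim (rel E f) (elts E X) (rel E (snd L)) (elts E (fst \<tau>)) (rel E (snd \<tau>)))}"
    unfolding typed_subsets_def using elts_the_set[OF i] by simp
qed

definition zero :: 'a where "zero = the_set E {}"
definition one :: 'a where "one = upair E zero zero"

lemma elts_two: "elts E (two E) = {zero, one}"
  unfolding two_def zero_def[symmetric] one_def[symmetric] by (rule elts_upair)

lemma zero_one: "zero \<noteq> one"
proof -
  have "elts E zero = {}" unfolding zero_def by (rule elts_the_set[OF internal_empty])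
  moreover have "elts E one = {zero}" unfolding one_def by (simp add: elts_upair)
  ultimately show ?thesis by auto
qed

lemma two_colouring:
  assumes "fo (\<lambda>v. P (v 0))"
  shows "\<exists>F. is_fun E F S (two E) \<and> (\<forall>x \<in> elts E S. app E F x = (if P x then zero else one))"
proof -
  let ?c = "\<lambda>x. if P x then zero else one"
  let ?G = "{(x, y). x \<in> elts E S \<and> y = ?c x}"
  have P: "fo (\<lambda>v. P (t v))" if "ft t" for t by (rule fo_subst[where P = "\<lambda>v. P"]) (rule assms, rule that)
  have dG: "drel ?G" unfolding drel_def by (intro fo P)
  have sub: "?G \<subseteq> elts E S \<times> elts E (two E)" unfolding elts_two by auto
  define F where "F = relset E ?G"
  have rF: "rel E F = ?G" unfolding F_def by (rule rel_relset[OF dG sub])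
  have app: "app E F x = ?c x" if "x \<in> elts E S" for x
    unfolding app_def rF using that by (intro the_equality) simp_all
  have "is_fun E F S (two E)"
    unfolding is_fun_def
  proof (intro conjI ballI)
    show "elts E F \<subseteq> elts E (cross E S (two E))"
      unfolding F_def elts_relset[OF dG sub] elts_cross elts_two by auto
    show "\<exists>!y. (x, y) \<in> rel E F" if "x \<in> elts E S" for x unfolding rF using that by simp
  qed
  then show ?thesis using app by auto
qed

section \<open>The natural numbers of the model and the two products\<close>

definition nats :: "'a set" where "nats = {n. \<forall>I. is_inductive E I \<longrightarrow> n \<in> elts E I}"

lemma fo_inductive: "ft t \<Longrightarrow> fo (\<lambda>v. is_inductive E (t v))"
proof (rule fo_subst[where P = "\<lambda>v. is_inductive E"])
  have *: "elts E s = insert x (elts E x) \<longleftrightarrow> (\<forall>u. E u s \<longleftrightarrow> u = x \<or> E u x)" for s x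
    unfolding elts_def by auto
  show "fo (\<lambda>v. is_inductive E (v 0))" unfolding is_inductive_def * by (intro fo)
qed

lemma internal_nats: "internal nats"
proof -
  obtain I where I: "is_inductive E I" using zf_infinity by (elim exE)
  have "nats \<subseteq> elts E I" using I unfolding nats_def by auto
  moreover have "fo (\<lambda>v. v 0 \<in> nats)" unfolding nats_def by (intro fo fo_inductive)
  ultimately show ?thesis by (rule internal_sep[OF internal_elts])
qed

lemma nats_nonempty: "nats \<noteq> {}"
proof -
  obtain z where z: "elts E z = {}" using internal_empty unfolding internal_def by auto
  have "z \<in> elts E I" if I: "is_inductive E I" for I
  proof -
    obtain z' where "z' \<in> elts E I" "elts E z' = {}"
      using I unfolding is_inductive_def by (elim conjE bexE)
    then show ?thesis using ext[of z z'] z by simp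
  qed
  then show ?thesis unfolding nats_def by auto
qed

lemma nats_succ: assumes "n \<in> nats" shows "\<exists>s \<in> nats. E n s \<and> (\<forall>u. E u n \<longrightarrow> E u s)"
proof -
  obtain I0 where I0: "is_inductive E I0" using zf_infinity by (elim exE)
  have step: "\<exists>s \<in> elts E I. elts E s = insert n (elts E n)" if "is_inductive E I" for I
  proof -
    have "n \<in> elts E I" using assms that unfolding nats_def by simp
    then show ?thesis using that unfolding is_inductive_def by simp
  qed
  obtain s where s: "elts E s = insert n (elts E n)" using step[OF I0] by (elim bexE)
  have "s \<in> elts E I" if "is_inductive E I" for I
    using step[OF that] ext[of s] s by auto
  then have "s \<in> nats" unfolding nats_def by simp
  moreover have "E n s \<and> (\<forall>u. E u n \<longrightarrow> E u s)" using s unfolding elts_def by auto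
  ultimately show ?thesis by auto
qed

lemma omega:
  shows "elts E (fst (omega E)) = nats" "rel E (snd (omega E)) = {(x, y). x \<in> nats \<and> y \<in> nats \<and> E x y}"
    "fst (reverse E (omega E)) = fst (omega E)"
    "rel E (snd (reverse E (omega E))) = {(x, y). x \<in> nats \<and> y \<in> nats \<and> E y x}"
proof -
  let ?N = "the_set E {n. \<forall>I. is_inductive E I \<longrightarrow> n \<in> elts E I}"
  have f: "fst (omega E) = ?N" unfolding omega_def mem_ord_def by simp
  have N: "elts E ?N = nats" using elts_the_set[OF internal_nats] unfolding nats_def by simp
  show e: "elts E (fst (omega E)) = nats" using f N by simp
  have d: "drel {(x, y). x \<in> elts E ?N \<and> y \<in> elts E ?N \<and> E x y}" unfolding drel_def by (intro fo)
  have "rel E (snd (omega E)) = {(x, y). x \<in> elts E ?N \<and> y \<in> elts E ?N \<and> E x y}"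
    unfolding omega_def mem_ord_def snd_conv by (rule rel_relset[OF d, of ?N ?N]) auto
  then show r: "rel E (snd (omega E)) = {(x, y). x \<in> nats \<and> y \<in> nats \<and> E x y}" unfolding N .
  show "fst (reverse E (omega E)) = fst (omega E)" unfolding reverse_def by simp
  have dc: "drel ((rel E (snd (omega E)))\<inverse>)" by simp
  have "rel E (snd (reverse E (omega E))) = (rel E (snd (omega E)))\<inverse>"
    unfolding reverse_def snd_conv by (rule rel_relset[OF dc, of "fst (omega E)" "fst (omega E)"]) (use e r in auto)
  then show "rel E (snd (reverse E (omega E))) = {(x, y). x \<in> nats \<and> y \<in> nats \<and> E y x}" using r by auto
qed

lemma ord_mult:
  shows "elts E (fst (ord_mult E S T)) = {pair E a b | a b. a \<in> elts E (fst S) \<and> b \<in> elts E (fst T)}"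
    "(pair E a b, pair E a' b') \<in> rel E (snd (ord_mult E S T)) \<longleftrightarrow>
       a \<in> elts E (fst S) \<and> a' \<in> elts E (fst S) \<and> b \<in> elts E (fst T) \<and> b' \<in> elts E (fst T) \<and>
       ((b, b') \<in> rel E (snd T) \<or> b = b' \<and> (a, a') \<in> rel E (snd S))"
proof -
  show "elts E (fst (ord_mult E S T)) = {pair E a b | a b. a \<in> elts E (fst S) \<and> b \<in> elts E (fst T)}"
    unfolding ord_mult_def fst_conv by (rule elts_cross)
  let ?M = "{(pair E a b, pair E a' b') | a b a' b'.
        a \<in> elts E (fst S) \<and> a' \<in> elts E (fst S) \<and>
        b \<in> elts E (fst T) \<and> b' \<in> elts E (fst T) \<and>
        ((b, b') \<in> rel E (snd T) \<or> b = b' \<and> (a, a') \<in> rel E (snd S))}"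
  have d: "drel ?M" unfolding drel_def mem_Collect_eq prod.inject by (intro fo)
  have "rel E (snd (ord_mult E S T)) = ?M"
    unfolding ord_mult_def snd_conv
    by (rule rel_relset[OF d, of "cross E (fst S) (fst T)" "cross E (fst S) (fst T)"]) auto
  then show "(pair E a b, pair E a' b') \<in> rel E (snd (ord_mult E S T)) \<longleftrightarrow>
       a \<in> elts E (fst S) \<and> a' \<in> elts E (fst S) \<and> b \<in> elts E (fst T) \<and> b' \<in> elts E (fst T) \<and>
       ((b, b') \<in> rel E (snd T) \<or> b = b' \<and> (a, a') \<in> rel E (snd S))" by auto
qed

text \<open>Each copy of \<open>P\<close> lacks a minimum, and above every point there is a whole
  copy followed by a further one, since the order \<open>q\<close> of the copies has no maximum. The
  other product is covered by reversing all orders.\<close>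

lemma Qs_product:
  assumes io: "iord X s" and P: "internal P" "P \<noteq> {}"
    and sim: "sim G X s {pair E a b | a b. a \<in> P \<and> b \<in> P} m" "drel G"
    and less2: "\<And>a a' b b'. a \<in> P \<Longrightarrow> a' \<in> P \<Longrightarrow> b \<in> P \<Longrightarrow> b' \<in> P \<Longrightarrow> (b, b') \<in> q \<Longrightarrow> (pair E a b, pair E a' b') \<in> m"
    and less1: "\<And>a a' b. a \<in> P \<Longrightarrow> a' \<in> P \<Longrightarrow> b \<in> P \<Longrightarrow> (a', a) \<in> p \<Longrightarrow> (pair E a' b, pair E a b) \<in> m"
    and p: "\<And>a. a \<in> P \<Longrightarrow> \<exists>a' \<in> P. (a', a) \<in> p"
    and q: "\<And>b. b \<in> P \<Longrightarrow> \<exists>b' \<in> P. (b, b') \<in> q"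
  shows "Qs s X"
  unfolding Qs_def
proof (intro conjI ballI)
  let ?M = "{pair E a b | a b. a \<in> P \<and> b \<in> P}"
  have ex: "\<exists>x \<in> X. (x, pair E a b) \<in> G" if "a \<in> P" "b \<in> P" for a b
    using simD(2)[OF sim(1), of "pair E a b"] that by auto
  have mono: "(x, x') \<in> s"
    if "x \<in> X" "x' \<in> X" "a \<in> P" "a' \<in> P" "b \<in> P" "b' \<in> P" "(x, pair E a b) \<in> G" "(x', pair E a' b') \<in> G"
      "(pair E a b, pair E a' b') \<in> m" for x x' a a' b b'
    using simD(3)[OF sim(1) that(1,2) _ _ that(7,8)] that by auto
  obtain a0 where a0: "a0 \<in> P" using P(2) by auto
  then show "X \<noteq> {}" using ex[OF a0 a0] by auto
  fix z assume z: "z \<in> X"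
  obtain y where "y \<in> ?M" "(z, y) \<in> G" using simD(1)[OF sim(1) z] by (elim bexE)
  then obtain a b where ab: "a \<in> P" "b \<in> P" "(z, pair E a b) \<in> G" by auto
  obtain b' where b': "b' \<in> P" "(b, b') \<in> q" using q[OF ab(2)] by (elim bexE)
  \<comment> \<open>The point \<open>z\<close> may lie anywhere in the copy over \<open>b\<close>,
    so the full copy over \<open>b'\<close> is used, and \<open>u\<close> is taken from the next
    copy \<open>b''\<close> to lie above all of it.\<close>
  obtain b'' where b'': "b'' \<in> P" "(b', b'') \<in> q" using q[OF b'(1)] by (elim bexE)
  obtain u where u: "u \<in> X" "(u, pair E a0 b'') \<in> G" using ex[OF a0 b''(1)] by (elim bexE)
  let ?N = "{x \<in> X. \<exists>c \<in> P. (x, pair E c b') \<in> G}"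
  have iN: "internal ?N"
    by (rule internal_filter[OF iordD(1)[OF io]]) (intro fo fo_in_internal[OF P(1)] fo_drel[OF sim(2)])
  obtain x0 where x0: "x0 \<in> X" "(x0, pair E a0 b') \<in> G" using ex[OF a0 b'(1)] by (elim bexE)
  have N0: "x0 \<in> ?N" using x0 a0 by auto
  have zN: "(z, x) \<in> s \<and> (x, u) \<in> s" if x: "x \<in> ?N" for x
  proof -
    obtain c where c: "x \<in> X" "c \<in> P" "(x, pair E c b') \<in> G" using x by auto
    show ?thesis
      using mono[OF z c(1) ab(1) c(2) ab(2) b'(1) ab(3) c(3) less2[OF ab(1) c(2) ab(2) b'(1,2)]]
        mono[OF c(1) u(1) c(2) a0 b'(1) b''(1) c(3) u(2) less2[OF c(2) a0 b'(1) b''(1,2)]] by simp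
  qed
  have zu: "(z, u) \<in> s" using iordD(4)[OF io] zN[OF N0] by metis
  have "\<not> wo s {y \<in> X. (z, y) \<in> s \<and> (y, u) \<in> s}"
  proof
    assume wo: "wo s {y \<in> X. (z, y) \<in> s \<and> (y, u) \<in> s}"
    have sub: "?N \<subseteq> {y \<in> X. (z, y) \<in> s \<and> (y, u) \<in> s}" using zN by auto
    have ne: "?N \<noteq> {}" using N0 by (rule nonemptyI)
    obtain k where k: "k \<in> ?N" "\<forall>x \<in> ?N. x \<noteq> k \<longrightarrow> (k, x) \<in> s"
      using wo_min[OF wo iN sub ne] by (elim bexE)
    obtain c where c: "k \<in> X" "c \<in> P" "(k, pair E c b') \<in> G" using k(1) by auto
    obtain c' where c': "c' \<in> P" "(c', c) \<in> p" using p[OF c(2)] by (elim bexE)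
    obtain x where x: "x \<in> X" "(x, pair E c' b') \<in> G" using ex[OF c'(1) b'(1)] by (elim bexE)
    have xk: "(x, k) \<in> s" by (rule mono[OF x(1) c(1) c'(1) c(2) b'(1) b'(1) x(2) c(3) less1[OF c(2) c'(1) b'(1) c'(2)]])
    have "x \<in> ?N" using x c'(1) by auto
    then have "(k, x) \<in> s" using k(2) xk iordD(3)[OF io] by auto
    then show False using xk iordD(5)[OF io] by simp
  qed
  then show "\<exists>u \<in> X. (z, u) \<in> s \<and> \<not> wo s {y \<in> X. (z, y) \<in> s \<and> (y, u) \<in> s}" using u(1) zu by auto
qed

lemma type_le_hasQ:
  assumes T: "lin_ord E \<tau>"
    and le: "type_le E (ord_mult E (omega E) (reverse E (omega E))) \<tau> \<or>
         type_le E (ord_mult E (reverse E (omega E)) (omega E)) \<tau>"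
  shows "hasQ (rel E (snd \<tau>)) (elts E (fst \<tau>)) \<or> hasQ ((rel E (snd \<tau>))\<inverse>) (elts E (fst \<tau>))"
proof -
  let ?s = "rel E (snd \<tau>)" and ?T = "elts E (fst \<tau>)"
  let ?up = "{(x, y). x \<in> nats \<and> y \<in> nats \<and> E x y}"
  have up: "\<exists>b \<in> nats. (a, b) \<in> ?up" if "a \<in> nats" for a using nats_succ[OF that] that by auto
  have get: "\<exists>X f. elts E X \<subseteq> ?T \<and> sim (rel E f) (elts E X) ?s (elts E (fst M)) (rel E (snd M))"
    if tl: "type_le E M \<tau>" for M
  proof -
    obtain X where X: "elts E X \<subseteq> ?T" "same_type E (suborder E \<tau> X) M"
      using tl unfolding type_le_def by (elim exE conjE)
    show ?thesis using same_typeD[OF X(2)] X(1) unfolding fst_suborder rel_suborder sim_Int by auto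
  qed
  have io: "iord (elts E X) ?s" if "elts E X \<subseteq> ?T" for X
    by (rule iord_subset[OF lin_ordD(1)[OF T] that internal_elts])
  show ?thesis
  proof (rule disjE[OF le])
    let ?M = "ord_mult E (omega E) (reverse E (omega E))"
    assume tl: "type_le E ?M \<tau>"
    obtain X f where X: "elts E X \<subseteq> ?T" and f: "sim (rel E f) (elts E X) ?s (elts E (fst ?M)) (rel E (snd ?M))"
      using get[OF tl] by (elim exE conjE)
    have "Qs (?s\<inverse>) (elts E X)"
    proof (rule Qs_product[OF iord_converse[OF io[OF X]] internal_nats nats_nonempty _ drel_rel])
      show "sim (rel E f) (elts E X) (?s\<inverse>) {pair E a b | a b. a \<in> nats \<and> b \<in> nats} ((rel E (snd ?M))\<inverse>)"
        using sim_reverse[OF f] unfolding ord_mult(1) omega .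
      show "\<exists>b \<in> nats. (a, b) \<in> ?up" if "a \<in> nats" for a by (rule up[OF that])
      show "\<exists>b \<in> nats. (b, a) \<in> ?up\<inverse>" if "a \<in> nats" for a using up[OF that] by simp
    qed (simp_all add: ord_mult(2) omega)
    then show ?thesis using X unfolding hasQ_def by auto
  next
    let ?M = "ord_mult E (reverse E (omega E)) (omega E)"
    assume tl: "type_le E ?M \<tau>"
    obtain X f where X: "elts E X \<subseteq> ?T" and f: "sim (rel E f) (elts E X) ?s (elts E (fst ?M)) (rel E (snd ?M))"
      using get[OF tl] by (elim exE conjE)
    have "Qs ?s (elts E X)"
    proof (rule Qs_product[OF io[OF X] internal_nats nats_nonempty _ drel_rel])
      show "sim (rel E f) (elts E X) ?s {pair E a b | a b. a \<in> nats \<and> b \<in> nats} (rel E (snd ?M))"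
        using f unfolding ord_mult(1) omega .
      show "\<exists>b \<in> nats. (a, b) \<in> ?up" if "a \<in> nats" for a by (rule up[OF that])
      show "\<exists>b \<in> nats. (b, a) \<in> ?up\<inverse>" if "a \<in> nats" for a using up[OF that] by simp
    qed (simp_all add: ord_mult(2) omega)
    then show ?thesis using X unfolding hasQ_def by auto
  qed
qed

section \<open>Transport of the hypotheses along similarities\<close>

lemma sim_Qs:
  assumes sim: "sim G A r B s" "drel G" "iord A r" "iord B s" and Q: "Qs r A" shows "Qs s B"
  unfolding Qs_def
proof (intro conjI ballI)
  obtain x where "x \<in> A" using Q unfolding Qs_def by auto
  then show "B \<noteq> {}" using simD(1)[OF sim(1), of x] by auto
  fix y assume y: "y \<in> B"
  obtain x where x: "x \<in> A" "(x, y) \<in> G" using simD(2)[OF sim(1) y] by (elim bexE)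
  obtain u where u: "u \<in> A" "(x, u) \<in> r" "\<not> wo r {z \<in> A. (x, z) \<in> r \<and> (z, u) \<in> r}"
    using Q x(1) unfolding Qs_def by auto
  obtain v where v: "v \<in> B" "(u, v) \<in> G" using simD(1)[OF sim(1) u(1)] by (elim bexE)
  let ?A = "{z \<in> A. (x, z) \<in> r \<and> (z, u) \<in> r}" and ?B = "{z \<in> B. (y, z) \<in> s \<and> (z, v) \<in> s}"
  have "sim G ?A r ?B s"
  proof (rule simI)
    show "\<exists>z' \<in> ?B. (z, z') \<in> G" if z: "z \<in> ?A" for z
    proof -
      obtain z' where z': "z' \<in> B" "(z, z') \<in> G" using simD(1)[OF sim(1), of z] z by auto
      then show ?thesis
        using simD(3)[OF sim(1) x(1) _ y z'(1) x(2) z'(2)] simD(3)[OF sim(1) _ u(1) z'(1) v(1) z'(2) v(2)] z by auto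
    qed
    show "\<exists>z \<in> ?A. (z, z') \<in> G" if z: "z' \<in> ?B" for z'
    proof -
      obtain z'' where z'': "z'' \<in> A" "(z'', z') \<in> G" using simD(2)[OF sim(1), of z'] z by auto
      then show ?thesis
        using simD(3)[OF sim(1) x(1) z''(1) y _ x(2) z''(2)] simD(3)[OF sim(1) z''(1) u(1) _ v(1) z''(2) v(2)] z by auto
    qed
  qed (rule simD(3)[OF sim(1)]; simp)
  moreover have "iord ?A r"
    by (rule iord_subset[OF sim(3) Collect_restrict internal_filter[OF iordD(1)[OF sim(3)]]])
      (intro fo fo_drel[OF iordD(2)[OF sim(3)]])
  moreover have "iord ?B s"
    by (rule iord_subset[OF sim(4) Collect_restrict internal_filter[OF iordD(1)[OF sim(4)]]])
      (intro fo fo_drel[OF iordD(2)[OF sim(4)]])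
  ultimately have "\<not> wo s ?B" using sim_wo[OF sim_converse, of G ?A r ?B s] sim(2) u(3) by auto
  moreover have "(y, v) \<in> s" using simD(3)[OF sim(1) x(1) u(1) y v(1) x(2) v(2)] u(2) by simp
  ultimately show "\<exists>v \<in> B. (y, v) \<in> s \<and> \<not> wo s {z \<in> B. (y, z) \<in> s \<and> (z, v) \<in> s}" using v(1) by auto
qed

lemma sim_image:
  assumes "sim G A r B s" "Z \<subseteq> A"
  shows "sim G Z r {y \<in> B. \<exists>x \<in> Z. (x, y) \<in> G} s"
proof (rule simI)
  show "\<exists>y \<in> {y \<in> B. \<exists>x \<in> Z. (x, y) \<in> G}. (x, y) \<in> G" if "x \<in> Z" for x
    using simD(1)[OF assms(1), of x] assms(2) that by auto
  show "\<exists>x \<in> Z. (x, y) \<in> G" if "y \<in> {y \<in> B. \<exists>x \<in> Z. (x, y) \<in> G}" for y using that by simp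
  show "(x, x') \<in> r \<longleftrightarrow> (y, y') \<in> s"
    if "x \<in> Z" "x' \<in> Z" "y \<in> {y \<in> B. \<exists>x \<in> Z. (x, y) \<in> G}" "y' \<in> {y \<in> B. \<exists>x \<in> Z. (x, y) \<in> G}"
      "(x, y) \<in> G" "(x', y') \<in> G" for x x' y y'
    using simD(3)[OF assms(1) _ _ _ _ that(5,6)] that(1-4) assms(2) by auto
qed

lemma internal_image:
  assumes "drel G" "internal Z" "internal B" shows "internal {y \<in> B. \<exists>x \<in> Z. (x, y) \<in> G}"
  by (rule internal_filter[OF assms(3)]) (intro fo fo_in_internal[OF assms(2)] fo_drel[OF assms(1)])

lemma sim_hasQ:
  assumes sim: "sim G A r B s" "drel G" "iord A r" "iord B s" and Q: "hasQ r A" shows "hasQ s B"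
proof -
  obtain Z where Z: "elts E Z \<subseteq> A" "Qs r (elts E Z)" using Q unfolding hasQ_def by (elim exE conjE)
  let ?B = "{y \<in> B. \<exists>x \<in> elts E Z. (x, y) \<in> G}"
  have i: "internal ?B" by (rule internal_image[OF sim(2) internal_elts iordD(1)[OF sim(4)]])
  have "Qs s ?B"
    by (rule sim_Qs[OF sim_image[OF sim(1) Z(1)] sim(2) iord_subset[OF sim(3) Z(1) internal_elts]
          iord_subset[OF sim(4) Collect_restrict i] Z(2)])
  then show ?thesis using hasQI[OF i Collect_restrict] by simp
qed

lemma scattered_sim:
  assumes T: "lin_ord E \<tau>" and sc: "scattered E \<tau>"
    and sim: "sim G A r (elts E (fst \<tau>)) (rel E (snd \<tau>))" "drel G" "iord A r"
    and Z: "internal Z" "Z \<subseteq> A" "\<exists>x \<in> Z. \<exists>y \<in> Z. x \<noteq> y"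
  shows "\<exists>x \<in> Z. \<exists>y \<in> Z. (x, y) \<in> r \<and> \<not> (\<exists>z \<in> Z. (x, z) \<in> r \<and> (z, y) \<in> r)"
proof -
  let ?T = "elts E (fst \<tau>)" and ?s = "rel E (snd \<tau>)"
  let ?X = "{y \<in> ?T. \<exists>x \<in> Z. (x, y) \<in> G}"
  have sX: "sim G Z r ?X ?s" by (rule sim_image[OF sim(1) Z(2)])
  have "internal ?X" by (rule internal_image[OF sim(2) Z(1) internal_elts])
  then obtain X where X: "elts E X = ?X" unfolding internal_def by (elim exE)
  obtain a b where ab: "a \<in> Z" "b \<in> Z" "a \<noteq> b" using Z(3) by auto
  obtain a' b' where ab': "a' \<in> ?X" "(a, a') \<in> G" "b' \<in> ?X" "(b, b') \<in> G"
    using simD(1)[OF sX ab(1)] simD(1)[OF sX ab(2)] by (elim bexE)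
  have io: "iord Z r" "iord ?X ?s"
    by (rule iord_subset[OF sim(3) Z(2,1)])
      (rule iord_subset[OF lin_ordD(1)[OF T] Collect_restrict internal_image[OF sim(2) Z(1) internal_elts]])
  have "a' \<noteq> b'" using sim_inj[OF sX io ab(1,2) ab'(1,3,2,4)] ab(3) by simp
  then have two: "\<exists>x \<in> elts E X. \<exists>y \<in> elts E X. x \<noteq> y" unfolding X using ab'(1,3) by (intro bexI)
  have "elts E X \<subseteq> ?T" unfolding X by (rule Collect_restrict)
  then have "\<not> dense_ord E (suborder E \<tau> X)"
    using sc two unfolding scattered_def by metis
  then have "\<exists>u \<in> elts E X. \<exists>v \<in> elts E X. (u, v) \<in> rel E (snd (suborder E \<tau> X)) \<and>
      \<not> (\<exists>z \<in> elts E X. (u, z) \<in> rel E (snd (suborder E \<tau> X)) \<and> (z, v) \<in> rel E (snd (suborder E \<tau> X)))"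
    unfolding dense_ord_def fst_suborder by meson
  then obtain u v where uv0: "u \<in> elts E X" "v \<in> elts E X" "(u, v) \<in> ?s"
    "\<not> (\<exists>z \<in> elts E X. (u, z) \<in> ?s \<and> (z, v) \<in> ?s)"
    unfolding rel_suborder by (elim bexE conjE) simp
  note uv = uv0[unfolded X]
  obtain x y where xy: "x \<in> Z" "(x, u) \<in> G" "y \<in> Z" "(y, v) \<in> G"
    using simD(2)[OF sX uv(1)] simD(2)[OF sX uv(2)] by (elim bexE)
  have "(x, y) \<in> r" using simD(3)[OF sX xy(1,3) uv(1,2) xy(2,4)] uv(3) by simp
  moreover have "\<not> (\<exists>z \<in> Z. (x, z) \<in> r \<and> (z, y) \<in> r)"
  proof
    assume "\<exists>z \<in> Z. (x, z) \<in> r \<and> (z, y) \<in> r"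
    then obtain z where z: "z \<in> Z" "(x, z) \<in> r" "(z, y) \<in> r" by (elim bexE conjE)
    obtain z' where z': "z' \<in> ?X" "(z, z') \<in> G" using simD(1)[OF sX z(1)] by (elim bexE)
    have "(u, z') \<in> ?s" using simD(3)[OF sX xy(1) z(1) uv(1) z'(1) xy(2) z'(2)] z(2) by simp
    moreover have "(z', v) \<in> ?s" using simD(3)[OF sX z(1) xy(3) z'(1) uv(2) z'(2) xy(4)] z(3) by simp
    ultimately show False using uv0(4) z'(1) unfolding X by (meson bexI)
  qed
  ultimately show ?thesis using xy(1,3) by (intro bexI conjI)
qed

text \<open>Used to carry the well-order of \<tau> to a copy of \<tau> inside \<open>L\<close>,
  through the one similarity that is fixed for this copy.\<close>

lemma pull_back_wo:
  assumes sim: "sim G A r B s" "drel G" "iord A r" "iord B s" and w: "iord B t" "wo t B"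
  shows "\<exists>w. iord A w \<and> wo w A"
proof -
  let ?w = "{(x, x'). x \<in> A \<and> x' \<in> A \<and> (\<exists>y \<in> B. \<exists>y' \<in> B. (x, y) \<in> G \<and> (x', y') \<in> G \<and> (y, y') \<in> t)}"
  note inj = sim_inj[OF sim(1,3,4)]
  have img: "\<exists>y \<in> B. (x, y) \<in> G" if "x \<in> A" for x by (rule simD(1)[OF sim(1) that])
  have iff: "(x, x') \<in> ?w \<longleftrightarrow> (y, y') \<in> t"
    if "x \<in> A" "x' \<in> A" "y \<in> B" "y' \<in> B" "(x, y) \<in> G" "(x', y') \<in> G" for x x' y y'
  proof
    assume "(x, x') \<in> ?w"
    then obtain z z' where z: "z \<in> B" "z' \<in> B" "(x, z) \<in> G" "(x', z') \<in> G" "(z, z') \<in> t" by auto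
    have "z = y" using inj[OF that(1,1) z(1) that(3) z(3) that(5)] by simp
    moreover have "z' = y'" using inj[OF that(2,2) z(2) that(4) z(4) that(6)] by simp
    ultimately show "(y, y') \<in> t" using z(5) by simp
  qed (use that in auto)
  have s: "sim G A ?w B t"
    by (rule simI) (rule img, assumption, rule simD(2)[OF sim(1)], assumption, rule iff)
  have dw: "drel ?w"
    unfolding drel_def
    by (intro fo fo_in_internal[OF iordD(1)[OF sim(3)]] fo_in_internal[OF iordD(1)[OF sim(4)]]
        fo_drel[OF sim(2)] fo_drel[OF iordD(2)[OF w(1)]])
  have wA: "x \<in> A \<and> y \<in> A" if "(x, y) \<in> ?w" for x y using that by simp
  have io: "iord A ?w"
    unfolding iord_def strict_linear_order_on_def
  proof (intro conjI iordD(1)[OF sim(3)] dw)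
    show "trans ?w"
    proof (rule transI)
      fix a b c assume ab: "(a, b) \<in> ?w" and bc: "(b, c) \<in> ?w"
      have A: "a \<in> A" "b \<in> A" "c \<in> A" using wA[OF ab] wA[OF bc] by simp_all
      obtain a' b' c' where p: "a' \<in> B" "(a, a') \<in> G" "b' \<in> B" "(b, b') \<in> G" "c' \<in> B" "(c, c') \<in> G"
        using img[OF A(1)] img[OF A(2)] img[OF A(3)] by (elim bexE)
      have "(a', b') \<in> t" using iff[OF A(1,2) p(1,3,2,4)] ab by metis
      moreover have "(b', c') \<in> t" using iff[OF A(2,3) p(3,5,4,6)] bc by metis
      ultimately have "(a', c') \<in> t" by (rule iordD(4)[OF w(1)])
      then show "(a, c) \<in> ?w" using iff[OF A(1,3) p(1,5,2,6)] by metis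
    qed
    show "irrefl ?w"
    proof (rule irreflI)
      fix a show "(a, a) \<notin> ?w"
      proof
        assume aa: "(a, a) \<in> ?w"
        then have a: "a \<in> A" by simp
        obtain a' where a': "a' \<in> B" "(a, a') \<in> G" using img[OF a] by (elim bexE)
        show False using iff[OF a a a'(1,1,2,2)] aa iordD(3)[OF w(1)] by metis
      qed
    qed
    show "total_on A ?w"
    proof (rule total_onI)
      fix a b assume ab: "a \<in> A" "b \<in> A" "a \<noteq> b"
      obtain a' b' where p: "a' \<in> B" "(a, a') \<in> G" "b' \<in> B" "(b, b') \<in> G"
        using img[OF ab(1)] img[OF ab(2)] by (elim bexE)
      have "a' \<noteq> b'" using inj[OF ab(1,2) p(1,3,2,4)] ab(3) by simp
      then have "(a', b') \<in> t \<or> (b', a') \<in> t" using iordD(6)[OF w(1) p(1,3)] by metis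
      then show "(a, b) \<in> ?w \<or> (b, a) \<in> ?w"
        using iff[OF ab(1,2) p(1,3,2,4)] iff[OF ab(2,1) p(3,1,4,2)] by metis
    qed
  qed
  have dc: "drel (G\<inverse>)" using sim(2) by simp
  have "wo ?w A" by (rule sim_wo[OF sim_converse[OF s] dc w(1) io w(2)])
  then show ?thesis using io by (intro exI[of _ ?w] conjI)
qed

lemma ordinal_wo:
  assumes "is_ordinal E \<alpha>"
  shows "\<exists>od. iord (elts E \<alpha>) od \<and> wo od (elts E \<alpha>)"
proof -
  have w: "well_ord E (mem_ord E \<alpha>)" using assms unfolding is_ordinal_def by simp
  have f: "fst (mem_ord E \<alpha>) = \<alpha>" unfolding mem_ord_def by simp
  have "lin_ord E (mem_ord E \<alpha>)" using w unfolding well_ord_def by simp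
  from lin_ordD(1)[OF this] have "iord (elts E \<alpha>) (rel E (snd (mem_ord E \<alpha>)))" unfolding f .
  moreover have "wo (rel E (snd (mem_ord E \<alpha>))) (elts E \<alpha>)"
    using w unfolding well_ord_def wo_def f by simp
  ultimately show ?thesis by auto
qed

lemma well_orderable_wo:
  assumes "well_orderable E A" shows "\<exists>w. iord (elts E A) w \<and> wo w (elts E A)"
proof -
  obtain W where w: "well_ord E (A, W)" using assms unfolding well_orderable_def by (elim exE)
  have "lin_ord E (A, W)" using w unfolding well_ord_def by simp
  from lin_ordD(1)[OF this] have "iord (elts E A) (rel E W)" by simp
  moreover have "wo (rel E W) (elts E A)" using w unfolding well_ord_def wo_def by simp
  ultimately show ?thesis by auto
qed

lemma separating_bits:
  assumes j: "is_fun E j A (pow E \<alpha>)" "inj_on (app E j) (elts E A)"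
  shows "\<exists>bit. drel bit \<and> (\<forall>x \<in> elts E A. \<forall>y \<in> elts E A. x \<noteq> y \<longrightarrow>
    (\<exists>b \<in> elts E \<alpha>. ((b, x) \<in> bit) \<noteq> ((b, y) \<in> bit)))"
proof -
  let ?bit = "{(b, x). \<exists>y. (x, y) \<in> rel E j \<and> E b y}"
  have app: "(x, app E j x) \<in> rel E j" "(x, y) \<in> rel E j \<Longrightarrow> y = app E j x" if "x \<in> elts E A" for x y
  proof -
    have ex: "\<exists>!y. (x, y) \<in> rel E j" using j(1) that unfolding is_fun_def by simp
    show "(x, app E j x) \<in> rel E j" unfolding app_def by (rule theI'[OF ex])
    then show "(x, y) \<in> rel E j \<Longrightarrow> y = app E j x" using ex by auto
  qed
  have bit: "(b, x) \<in> ?bit \<longleftrightarrow> E b (app E j x)" if "x \<in> elts E A" for b x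
  proof
    assume "(b, x) \<in> ?bit"
    then obtain y where "(x, y) \<in> rel E j" "E b y" by auto
    then show "E b (app E j x)" using app(2)[OF that] by simp
  next
    assume "E b (app E j x)"
    then show "(b, x) \<in> ?bit" using app(1)[OF that] by auto
  qed
  have sub: "elts E (app E j x) \<subseteq> elts E \<alpha>" if "x \<in> elts E A" for x
  proof -
    have "pair E x (app E j x) \<in> elts E (cross E A (pow E \<alpha>))"
      using j(1) app(1)[OF that] unfolding is_fun_def rel_def by auto
    then show ?thesis by (simp add: elts_pow)
  qed
  have "\<exists>b \<in> elts E \<alpha>. ((b, x) \<in> ?bit) \<noteq> ((b, y) \<in> ?bit)"
    if xy: "x \<in> elts E A" "y \<in> elts E A" "x \<noteq> y" for x y
  proof -
    have "app E j x \<noteq> app E j y" using j(2) xy unfolding inj_on_def by metis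
    then have "elts E (app E j x) \<noteq> elts E (app E j y)" using ext by metis
    then obtain b where b: "E b (app E j x) \<noteq> E b (app E j y)" unfolding elts_def by auto
    then have "b \<in> elts E (app E j x) \<union> elts E (app E j y)" unfolding elts_def by auto
    then have "b \<in> elts E \<alpha>" using sub[OF xy(1)] sub[OF xy(2)] by auto
    then show ?thesis using b unfolding bit[OF xy(1)] bit[OF xy(2)] by (intro bexI)
  qed
  moreover have "drel ?bit" unfolding drel_def by (intro fo)
  ultimately show ?thesis by (intro exI[of _ ?bit]) simp
qed

end

context branching begin

text \<open>Definability with the set as a variable is what turns the property into a colouring that
  belongs to the model.\<close>

lemma fo_nice: "drel r \<Longrightarrow> fo (\<lambda>v. nice r (elts E (v 0)))"
  unfolding nice_def infc_def cls_def fin_def btw_def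
  by (intro fo fo_drel drel_converse[THEN iffD2])

end

lemma (in lin) both_colours:
  assumes Q: "hasQ r H \<or> hasQ (r\<inverse>) H"
    and scat: "\<And>Z. internal Z \<Longrightarrow> Z \<subseteq> H \<Longrightarrow> \<exists>x \<in> Z. \<exists>y \<in> Z. x \<noteq> y \<Longrightarrow>
      \<exists>x \<in> Z. \<exists>y \<in> Z. (x, y) \<in> r \<and> \<not> (\<exists>z \<in> Z. (x, z) \<in> r \<and> (z, y) \<in> r)"
  shows "\<exists>X G. elts E X \<subseteq> H \<and> drel G \<and> sim G H r (elts E X) r \<and> nice r (elts E X)"
    "\<exists>X G. elts E X \<subseteq> H \<and> drel G \<and> sim G H r (elts E X) r \<and> \<not> nice r (elts E X)"
proof -
  obtain X where X: "elts E X = Range thin_map"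
    using Range_facts(1)[OF drel_thin_map thin_map_facts(1)] unfolding internal_def by (elim exE)
  show "\<exists>X G. elts E X \<subseteq> H \<and> drel G \<and> sim G H r (elts E X) r \<and> nice r (elts E X)"
    by (rule exI[of _ X], rule exI[of _ thin_map], unfold X)
      (intro conjI Range_facts(2)[OF drel_thin_map thin_map_facts(1)] drel_thin_map thin_map_facts(3) nice_thin_map)
  have "\<exists>G m p. bad_embedding G m p" by (rule bad_exists[OF Q]) (rule scat)
  then obtain G m p where b: "bad_embedding G m p" by (elim exE)
  have G: "drel G" "mono_rel r G" "G \<subseteq> H \<times> H" "H \<subseteq> Domain G"
    using b unfolding bad_embedding_def by simp_all
  obtain Y where Y: "elts E Y = Range G"
    using Range_facts(1)[OF G(1,3)] unfolding internal_def by (elim exE)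
  show "\<exists>X G. elts E X \<subseteq> H \<and> drel G \<and> sim G H r (elts E X) r \<and> \<not> nice r (elts E X)"
    by (rule exI[of _ Y], rule exI[of _ G], unfold Y)
      (intro conjI Range_facts(2)[OF G(1,3)] G(1) mono_sim[OF G(2,4,3)] bad_not_nice[OF b])
qed

theorem theorem13:
  fixes E :: "'a \<Rightarrow> 'a \<Rightarrow> bool" and \<tau> L :: "'a ordset"
  assumes "ZF E"
    and "lin_ord E \<tau>"
    and "well_orderable E (fst \<tau>)"
    and "scattered E \<tau>"
    and "type_le E (ord_mult E (omega E) (reverse E (omega E))) \<tau> \<or>
         type_le E (ord_mult E (reverse E (omega E)) (omega E)) \<tau>"
    and "lin_ord E L"
    and "\<exists>\<alpha>. is_ordinal E \<alpha> \<and>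
           (\<exists>j. is_fun E j (fst L) (pow E \<alpha>) \<and> inj_on (app E j) (elts E (fst L)))"
  shows "\<not> arrows E L \<tau>"
proof
  interpret zf_model E by unfold_locales (rule assms(1))
  assume arr: "arrows E L \<tau>"
  let ?R = "rel E (snd L)" and ?T = "elts E (fst \<tau>)" and ?s = "rel E (snd \<tau>)"
  note T = assms(2) and L = assms(6)
  obtain \<alpha> j where \<alpha>: "is_ordinal E \<alpha>" and j: "is_fun E j (fst L) (pow E \<alpha>)" "inj_on (app E j) (elts E (fst L))"
    using assms(7) by (elim exE conjE)
  obtain od where od: "iord (elts E \<alpha>) od" "wo od (elts E \<alpha>)" using ordinal_wo[OF \<alpha>] by (elim exE conjE)
  obtain bit where bits: "drel bit" "\<forall>x \<in> elts E (fst L). \<forall>y \<in> elts E (fst L). x \<noteq> y \<longrightarrow>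
    (\<exists>b \<in> elts E \<alpha>. ((b, x) \<in> bit) \<noteq> ((b, y) \<in> bit))"
    using separating_bits[OF j] by (elim exE conjE)
  interpret branching E "elts E \<alpha>" od bit by unfold_locales (rule od bits(1))+
  have foN: "fo (\<lambda>v. nice ?R (elts E (v 0)))" by (rule fo_nice[OF drel_rel])
  obtain F where F: "is_fun E F (typed_subsets E L \<tau>) (two E)"
    "\<forall>x \<in> elts E (typed_subsets E L \<tau>). app E F x = (if nice ?R (elts E x) then zero else one)"
    using two_colouring[OF foN, of "typed_subsets E L \<tau>"] by (elim exE conjE)
  obtain H c where hom: "H \<in> elts E (typed_subsets E L \<tau>)"
    "\<forall>X \<in> elts E (typed_subsets E (suborder E L H) \<tau>). app E F X = c"
    using arr[unfolded arrows_def, rule_format, OF F(1)] by (elim bexE)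
  have TS: "elts E (typed_subsets E L \<tau>) = {X. elts E X \<subseteq> elts E (fst L) \<and>
    (\<exists>f. sim (rel E f) (elts E X) ?R ?T ?s)}"
    by (rule elts_typed_subsets(2)[OF L T subset_refl])
  obtain f where HL: "elts E H \<subseteq> elts E (fst L)" and f: "sim (rel E f) (elts E H) ?R ?T ?s"
    using hom(1) unfolding TS by (elim CollectE conjE exE)
  have io: "iord (elts E H) ?R" by (rule iord_subset[OF lin_ordD(1)[OF L] HL internal_elts])
  have ioT: "iord ?T ?s" by (rule lin_ordD(1)[OF T])
  \<comment> \<open>The homogeneous set inherits a well-order of its points from \<tau>, although
    \<open>L\<close> is only known to embed in a power set of an ordinal.\<close>
  obtain wt where wt: "iord ?T wt" "wo wt ?T" using well_orderable_wo[OF assms(3)] by (elim exE conjE)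
  obtain w where w: "iord (elts E H) w" "wo w (elts E H)"
    using pull_back_wo[OF f drel_rel io ioT wt] by (elim exE conjE)
  interpret lin E "elts E \<alpha>" od bit "elts E H" ?R w
  proof (unfold_locales, rule io, rule w, rule w)
    show "\<exists>b \<in> elts E \<alpha>. ((b, x) \<in> bit) \<noteq> ((b, y) \<in> bit)" if "x \<in> elts E H" "y \<in> elts E H" "x \<noteq> y" for x y
      using bits(2) that HL by (meson subsetD)
  qed
  have dc: "drel ((rel E f)\<inverse>)" by simp
  have Q: "hasQ ?R (elts E H) \<or> hasQ (?R\<inverse>) (elts E H)"
    using type_le_hasQ[OF T assms(5)] sim_hasQ[OF sim_converse[OF f] dc ioT io]
      sim_hasQ[OF sim_converse[OF sim_reverse[OF f]] dc iord_converse[OF ioT] iord_converse[OF io]] by metis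
  have bc: "\<exists>X G. elts E X \<subseteq> elts E H \<and> drel G \<and> sim G (elts E H) ?R (elts E X) ?R \<and> nice ?R (elts E X)"
    "\<exists>X G. elts E X \<subseteq> elts E H \<and> drel G \<and> sim G (elts E H) ?R (elts E X) ?R \<and> \<not> nice ?R (elts E X)"
    by (rule both_colours[OF Q]; rule scattered_sim[OF T assms(4) f drel_rel io]; assumption)+
  \<comment> \<open>Every definable copy of the homogeneous set inside itself is again of type
    \<tau>, by composition with \<open>f\<close>, and so gets the homogeneous colour. A nice and a
    non-nice copy then contradict each other.\<close>
  have colour: "c = (if nice ?R (elts E X) then zero else one)"
    if X: "elts E X \<subseteq> elts E H" and G: "drel G" "sim G (elts E H) ?R (elts E X) ?R" for X G
  proof -
    have dG: "drel (G\<inverse>)" using G(1) by simp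
    obtain g where g: "sim (rel E g) (elts E X) ?R (elts E H) ?R"
      using sim_code[OF sim_converse[OF G(2)] dG] by auto
    have "\<exists>k. sim (rel E k) (elts E X) ?R ?T ?s" by (rule sim_compose_code[OF g f]) simp_all
    then have "X \<in> elts E (typed_subsets E (suborder E L H) \<tau>)" "X \<in> elts E (typed_subsets E L \<tau>)"
      unfolding elts_typed_subsets[OF L T HL] using X HL by auto
    then show ?thesis using hom(2) F(2) by metis
  qed
  obtain X G where X: "elts E X \<subseteq> elts E H" "drel G" "sim G (elts E H) ?R (elts E X) ?R" "nice ?R (elts E X)"
    using bc(1) by (elim exE conjE)
  obtain Y G' where Y: "elts E Y \<subseteq> elts E H" "drel G'" "sim G' (elts E H) ?R (elts E Y) ?R" "\<not> nice ?R (elts E Y)"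
    using bc(2) by (elim exE conjE)
  show False using colour[OF X(1-3)] colour[OF Y(1-3)] X(4) Y(4) zero_one by simp
qed

end
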